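(* Let $\mathcal{K}$ be a complete directed $2$-complex, let $T_l$ be a left forest in $\mathrm{Sq}(\mathcal{K})$ and let $w$ be a non-empty $1$-path in $\mathcal{K}$. For every $n\ge0$, the $n$th integer homology group $H_n(G;\mathbb{Z})$ of the diagram group $G=\mathcal{D}(\mathcal{K},w)$ is free Abelian; it is isomorphic to the free Abelian group whose free basis consists of all essential $n$-cubes of $\mathrm{Sq}(\mathcal{K},w)$ (essential with respect to $T_l$).
   Context: Directed $2$-complexes. A directed $2$-complex $\mathcal{K}$ is a directed graph together with a set $\mathbf{F}$ of $2$-cells and maps $\lceil\cdot\rceil,\lfloor\cdot\rfloor\colon\mathbf{F}\to\mathbf{P}$ (top, bottom), ${}^{-1}\colon\mathbf{F}\to\mathbf{F}$ (inverse), where $\mathbf{P}$ is the set of all directed paths of the graph including empty paths (called $1$-paths; initial and terminal vertices are $\iota(p),\tau(p)$). It is required that for each $f$ the paths $\lceil f\rceil,\lfloor f\rfloor$ are non-empty with common initial vertex $\iota(f)$ and common terminal vertex $\tau(f)$, and that ${}^{-1}$ is an involution without fixed points with $\lceil f^{-1}\rceil=\lfloor f\rfloor$, $\lfloor f^{-1}\rfloor=\lceil f\rceil$. An orientation $\mathbf{F}=\mathbf{F}^+\sqcup\mathbf{F}^-$, $\mathbf{F}^-=(\mathbf{F}^+)^{-1}$, is fixed (positive and negative $2$-cells). Diagram groups. An atomic $2$-path is a triple $\delta=(p,f,q)$ with $p,q$ $1$-paths, $f\in\mathbf{F}$, $\tau(p)=\iota(f)$, $\tau(f)=\iota(q)$;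 $\lceil\delta\rceil=p\lceil f\rceil q$, $\lfloor\delta\rfloor=p\lfloor f\rfloor q$, $\delta^{-1}=(p,f^{-1},q)$. A $2$-path is a finite sequence $\delta_1\circ\cdots\circ\delta_n$ of atomic $2$-paths with $\lfloor\delta_i\rfloor=\lceil\delta_{i+1}\rceil$; its top and bottom are $\lceil\delta_1\rceil$, $\lfloor\delta_n\rfloor$; it is positive if all its $2$-cells are positive. Each $1$-path $p$ is also a trivial $2$-path from $p$ to $p$. Homotopy of $2$-paths is the smallest equivalence relation invariant under concatenation such that $\delta\circ\delta^{-1}$ is equivalent to the trivial $2$-path and $(p,f_1,q\lceil f_2\rceil r)\circ(p\lfloor f_1\rfloor q,f_2,r)$ is equivalent to $(p\lceil f_1\rceil q,f_2,r)\circ(p,f_1,q\lfloor f_2\rfloor r)$. The diagram group $\mathcal{D}(\mathcal{K},p)$ is the group of homotopy classes of $2$-paths from $p$ to $p$ under concatenation. Completeness. Write $p\stackrel{+}{\to}q$ if $p\ne q$ and there is a positive $2$-path with top $p$ and bottom $q$. $\mathcal{K}$ is Noetherian if every sequence $p_1\stackrel{+}{\to}p_2\stackrel{+}{\to}\cdots$ terminates; confluent if for any two positive $2$-paths $\delta_1,\delta_2$ with the same top there are positive $2$-paths $\delta_1\circ\delta_1'$, $\delta_2\circ\delta_2'$ (where $\delta_i'$ may be trivial) with the same bottom; complete if it is Noetherian and confluent. A $1$-path $p$ is irreducible if $p\stackrel{+}{\to}q$ holds for no $q$. Squier complex and left forests. $\mathrm{Sq}(\mathcal{K})$ is the cubical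 complex whose $n$-cubes are the thin diagrams with $n$ cells, i.e. formal sums $c=\varepsilon(u_0)+f_1+\varepsilon(u_1)+\cdots+f_n+\varepsilon(u_n)$ with $u_i$ $1$-paths (possibly empty), $f_i\in\mathbf{F}^-$, $\tau(u_{i-1})=\iota(f_i)$, $\tau(f_i)=\iota(u_i)$; its $i$th top (resp. bottom) face replaces $\varepsilon(u_{i-1})+f_i+\varepsilon(u_i)$ by $\varepsilon(u_{i-1}\lceil f_i\rceil u_i)$ (resp. $\varepsilon(u_{i-1}\lfloor f_i\rfloor u_i)$). $\mathrm{Sq}(\mathcal{K},w)$ is the connected component containing the vertex $w$. The $1$-skeleton, enriched by inverse edges, is the graph whose vertices are the $1$-paths and whose edges are the atomic $2$-paths $(p,f,q)$, going from $p\lceil f\rceil q$ to $p\lfloor f\rfloor q$, with inverse $(p,f^{-1},q)$. A spanning forest is a forest in this graph (closed under taking inverse edges) whose intersection with every connected component is a spanning tree of that component. For $\mathcal{K}$ complete, a spanning forest $T$ is a left forest if (F1) for any edge $(p,f,q)$ in $T$ the $1$-path $p$ is irreducible; (F2) if $(p,f,q)$ is in $T$, then every edge of the form $(p,f,q')$ is in $T$. By (F2), one writes $(p,f,* )\in T$ or $(p,f,* )\notin T$. Left forests exist for every complete $\mathcal{K}$. Essential cubes. An $n$-cube $\varepsilon(u_0)+f_1+\cdots+f_n+\varepsilon(u_n)$ is essential (with respect to $T_l$) if all $u_i$ ($0\le i\le n$) are irreducible and $(u_{i-1},f_i,* )\notin T_l$ for all $1\le i\le n$. *)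

theory Defs
  imports "HOL-Algebra.Free_Abelian_Groups" "Graph_Theory.Arc_Walk"
begin

section \<open>Walks in digraphs\<close>

text \<open>A walk is stored together with its initial vertex, so that there is one empty walk at each
  vertex.\<close>

type_synonym ('v, 'e) walk = "'v \<times> 'e list"

definition is_walk :: "('v, 'e) pre_digraph \<Rightarrow> ('v, 'e) walk \<Rightarrow> bool" where
  "is_walk G p \<longleftrightarrow> (\<exists>v. pre_digraph.awalk G (fst p) (snd p) v)"

definition walk_end :: "('v, 'e) pre_digraph \<Rightarrow> ('v, 'e) walk \<Rightarrow> 'v" where
  "walk_end G p = pre_digraph.awlast G (fst p) (snd p)"

text \<open>Concatenation; only meaningful if the second walk starts where the first one ends.\<close>

definition walk_append :: "('v, 'e) walk \<Rightarrow> ('v, 'e) walk \<Rightarrow> ('v, 'e) walk" (infixr \<open>\<cdot>\<close> 70) where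
  "p \<cdot> q = (fst p, snd p @ snd q)"


section \<open>Directed 2-complexes\<close>

record ('v, 'e, 'f) two_complex =
  base :: "('v, 'e) pre_digraph"
  cells :: "'f set"
  ctop :: "'f \<Rightarrow> ('v, 'e) walk"
  cbot :: "'f \<Rightarrow> ('v, 'e) walk"
  cinv :: "'f \<Rightarrow> 'f"
  pos_cells :: "'f set"

definition neg_cells :: "('v, 'e, 'f) two_complex \<Rightarrow> 'f set" where
  "neg_cells K = cinv K ` pos_cells K"

definition path1 :: "('v, 'e, 'f) two_complex \<Rightarrow> ('v, 'e) walk \<Rightarrow> bool" where
  "path1 K p \<longleftrightarrow> is_walk (base K) p"

abbreviation path1_end :: "('v, 'e, 'f) two_complex \<Rightarrow> ('v, 'e) walk \<Rightarrow> 'v" where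
  "path1_end K \<equiv> walk_end (base K)"

locale directed_2_complex =
  fixes K :: "('v, 'e, 'f) two_complex"
  assumes base_wf: "wf_digraph (base K)"
    and top_path: "f \<in> cells K \<Longrightarrow> path1 K (ctop K f)"
    and bot_path: "f \<in> cells K \<Longrightarrow> path1 K (cbot K f)"
    and top_nonempty: "f \<in> cells K \<Longrightarrow> snd (ctop K f) \<noteq> []"
    and bot_nonempty: "f \<in> cells K \<Longrightarrow> snd (cbot K f) \<noteq> []"
    and same_start: "f \<in> cells K \<Longrightarrow> fst (ctop K f) = fst (cbot K f)"
    and same_end: "f \<in> cells K \<Longrightarrow> path1_end K (ctop K f) = path1_end K (cbot K f)"
    and cinv_cell: "f \<in> cells K \<Longrightarrow> cinv K f \<in> cells K"
    and cinv_invol: "f \<in> cells K \<Longrightarrow> cinv K (cinv K f) = f"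
    and cinv_no_fixpoint: "f \<in> cells K \<Longrightarrow> cinv K f \<noteq> f"
    and top_cinv: "f \<in> cells K \<Longrightarrow> ctop K (cinv K f) = cbot K f"
    and bot_cinv: "f \<in> cells K \<Longrightarrow> cbot K (cinv K f) = ctop K f"
    and orientation_cover: "cells K = pos_cells K \<union> neg_cells K"
    and orientation_disjoint: "pos_cells K \<inter> neg_cells K = {}"


section \<open>2-paths and diagram groups\<close>

type_synonym ('v, 'e, 'f) atom = "('v, 'e) walk \<times> 'f \<times> ('v, 'e) walk"
type_synonym ('v, 'e, 'f) path2 = "(('v, 'e) walk, ('v, 'e, 'f) atom) walk"

fun is_atom :: "('v, 'e, 'f) two_complex \<Rightarrow> ('v, 'e, 'f) atom \<Rightarrow> bool" where
  "is_atom K (p, f, q) \<longleftrightarrow> path1 K p \<and> f \<in> cells K \<and> path1 K q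
     \<and> path1_end K p = fst (ctop K f) \<and> path1_end K (ctop K f) = fst q"

fun atom_top :: "('v, 'e, 'f) two_complex \<Rightarrow> ('v, 'e, 'f) atom \<Rightarrow> ('v, 'e) walk" where
  "atom_top K (p, f, q) = p \<cdot> ctop K f \<cdot> q"

fun atom_bot :: "('v, 'e, 'f) two_complex \<Rightarrow> ('v, 'e, 'f) atom \<Rightarrow> ('v, 'e) walk" where
  "atom_bot K (p, f, q) = p \<cdot> cbot K f \<cdot> q"

fun atom_inv :: "('v, 'e, 'f) two_complex \<Rightarrow> ('v, 'e, 'f) atom \<Rightarrow> ('v, 'e, 'f) atom" where
  "atom_inv K (p, f, q) = (p, cinv K f, q)"

text \<open>The 1-skeleton of the Squier complex, enriched by inverse edges.  The 2-paths are exactly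
  its walks, an empty walk being a trivial 2-path.\<close>

definition squier_graph ::
    "('v, 'e, 'f) two_complex \<Rightarrow> (('v, 'e) walk, ('v, 'e, 'f) atom) pre_digraph" where
  "squier_graph K =
     \<lparr> verts = Collect (path1 K), arcs = Collect (is_atom K),
       tail = atom_top K, head = atom_bot K \<rparr>"

definition path2 :: "('v, 'e, 'f) two_complex \<Rightarrow> ('v, 'e, 'f) path2 \<Rightarrow> bool" where
  "path2 K \<delta> \<longleftrightarrow> is_walk (squier_graph K) \<delta>"

definition path2_bot :: "('v, 'e, 'f) two_complex \<Rightarrow> ('v, 'e, 'f) path2 \<Rightarrow> ('v, 'e) walk" where
  "path2_bot K \<delta> = walk_end (squier_graph K) \<delta>"

abbreviation path2_top :: "('v, 'e, 'f) path2 \<Rightarrow> ('v, 'e) walk" where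
  "path2_top \<equiv> fst"

definition pos_path2 :: "('v, 'e, 'f) two_complex \<Rightarrow> ('v, 'e, 'f) path2 \<Rightarrow> bool" where
  "pos_path2 K \<delta> \<longleftrightarrow> path2 K \<delta> \<and> (\<forall>(p, f, q) \<in> set (snd \<delta>). f \<in> pos_cells K)"

inductive homotopic ::
    "('v, 'e, 'f) two_complex \<Rightarrow> ('v, 'e, 'f) path2 \<Rightarrow> ('v, 'e, 'f) path2 \<Rightarrow> bool" for K where
  refl: "path2 K \<delta> \<Longrightarrow> homotopic K \<delta> \<delta>"
| sym: "homotopic K \<delta> \<epsilon> \<Longrightarrow> homotopic K \<epsilon> \<delta>"
| trans: "homotopic K \<delta> \<epsilon> \<Longrightarrow> homotopic K \<epsilon> \<zeta> \<Longrightarrow> homotopic K \<delta> \<zeta>"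
| append_left: "homotopic K \<delta> \<epsilon> \<Longrightarrow> path2 K \<zeta> \<Longrightarrow> path2_bot K \<zeta> = path2_top \<delta> \<Longrightarrow>
    homotopic K (\<zeta> \<cdot> \<delta>) (\<zeta> \<cdot> \<epsilon>)"
| append_right: "homotopic K \<delta> \<epsilon> \<Longrightarrow> path2 K \<zeta> \<Longrightarrow> path2_bot K \<delta> = path2_top \<zeta> \<Longrightarrow>
    homotopic K (\<delta> \<cdot> \<zeta>) (\<epsilon> \<cdot> \<zeta>)"
| cancel: "is_atom K a \<Longrightarrow> homotopic K (atom_top K a, [a, atom_inv K a]) (atom_top K a, [])"
| exchange: "path1 K p \<Longrightarrow> f \<in> cells K \<Longrightarrow> path1 K q \<Longrightarrow> g \<in> cells K \<Longrightarrow> path1 K r \<Longrightarrow>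
    path1_end K p = fst (ctop K f) \<Longrightarrow> path1_end K (ctop K f) = fst q \<Longrightarrow>
    path1_end K q = fst (ctop K g) \<Longrightarrow> path1_end K (ctop K g) = fst r \<Longrightarrow>
    homotopic K
      (p \<cdot> ctop K f \<cdot> q \<cdot> ctop K g \<cdot> r,
        [(p, f, q \<cdot> ctop K g \<cdot> r), (p \<cdot> cbot K f \<cdot> q, g, r)])
      (p \<cdot> ctop K f \<cdot> q \<cdot> ctop K g \<cdot> r,
        [(p \<cdot> ctop K f \<cdot> q, g, r), (p, f, q \<cdot> cbot K g \<cdot> r)])"

definition homotopy :: "('v, 'e, 'f) two_complex \<Rightarrow> ('v, 'e, 'f) path2 rel" where
  "homotopy K = {(\<delta>, \<epsilon>). homotopic K \<delta> \<epsilon>}"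

definition diagram_group ::
    "('v, 'e, 'f) two_complex \<Rightarrow> ('v, 'e) walk \<Rightarrow> ('v, 'e, 'f) path2 set monoid" where
  "diagram_group K p =
     \<lparr> carrier = {\<delta>. path2 K \<delta> \<and> path2_top \<delta> = p \<and> path2_bot K \<delta> = p} // homotopy K,
       monoid.mult = (\<lambda>A B. \<Union>\<delta>\<in>A. \<Union>\<epsilon>\<in>B. homotopy K `` {\<delta> \<cdot> \<epsilon>}),
       one = homotopy K `` {(p, [])} \<rparr>"


section \<open>Completeness\<close>

definition derives :: "('v, 'e, 'f) two_complex \<Rightarrow> ('v, 'e) walk \<Rightarrow> ('v, 'e) walk \<Rightarrow> bool" where
  "derives K p q \<longleftrightarrow> p \<noteq> q \<and> (\<exists>\<delta>. pos_path2 K \<delta> \<and> path2_top \<delta> = p \<and> path2_bot K \<delta> = q)"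

definition noetherian_complex :: "('v, 'e, 'f) two_complex \<Rightarrow> bool" where
  "noetherian_complex K \<longleftrightarrow> \<not> (\<exists>p. \<forall>i::nat. derives K (p i) (p (Suc i)))"

definition confluent_complex :: "('v, 'e, 'f) two_complex \<Rightarrow> bool" where
  "confluent_complex K \<longleftrightarrow>
     (\<forall>\<delta>\<^sub>1 \<delta>\<^sub>2. pos_path2 K \<delta>\<^sub>1 \<and> pos_path2 K \<delta>\<^sub>2 \<and> path2_top \<delta>\<^sub>1 = path2_top \<delta>\<^sub>2 \<longrightarrow>
       (\<exists>\<epsilon>\<^sub>1 \<epsilon>\<^sub>2. pos_path2 K \<epsilon>\<^sub>1 \<and> pos_path2 K \<epsilon>\<^sub>2
          \<and> path2_top \<epsilon>\<^sub>1 = path2_bot K \<delta>\<^sub>1 \<and> path2_top \<epsilon>\<^sub>2 = path2_bot K \<delta>\<^sub>2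
          \<and> path2_bot K (\<delta>\<^sub>1 \<cdot> \<epsilon>\<^sub>1) = path2_bot K (\<delta>\<^sub>2 \<cdot> \<epsilon>\<^sub>2)))"

definition complete_complex :: "('v, 'e, 'f) two_complex \<Rightarrow> bool" where
  "complete_complex K \<longleftrightarrow> noetherian_complex K \<and> confluent_complex K"

definition irreducible_path :: "('v, 'e, 'f) two_complex \<Rightarrow> ('v, 'e) walk \<Rightarrow> bool" where
  "irreducible_path K p \<longleftrightarrow> path1 K p \<and> \<not> (\<exists>q. derives K p q)"


section \<open>The Squier complex\<close>

text \<open>The cube \<open>\<epsilon>(u\<^sub>0) + f\<^sub>1 + \<epsilon>(u\<^sub>1) + \<dots> + f\<^sub>n + \<epsilon>(u\<^sub>n)\<close> is encoded as
  \<open>(u\<^sub>0, [(f\<^sub>1, u\<^sub>1), \<dots>, (f\<^sub>n, u\<^sub>n)])\<close>.\<close>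

type_synonym ('v, 'e, 'f) cube = "('v, 'e) walk \<times> ('f \<times> ('v, 'e) walk) list"

fun is_cube :: "('v, 'e, 'f) two_complex \<Rightarrow> ('v, 'e, 'f) cube \<Rightarrow> bool" where
  "is_cube K (u, []) \<longleftrightarrow> path1 K u"
| "is_cube K (u, (f, v) # c) \<longleftrightarrow> path1 K u \<and> f \<in> neg_cells K
     \<and> path1_end K u = fst (ctop K f) \<and> path1_end K (ctop K f) = fst v \<and> is_cube K (v, c)"

abbreviation cube_dim :: "('v, 'e, 'f) cube \<Rightarrow> nat" where
  "cube_dim c \<equiv> length (snd c)"

text \<open>For \<open>i < cube_dim c\<close>, the term \<open>cube_face s i c\<close> collapses the cell with (0-based) index
  \<open>i\<close> to the side \<open>s\<close>, where \<open>s\<close> is \<open>ctop K\<close> for top faces and \<open>cbot K\<close> for bottom faces.\<close>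

fun cube_face ::
    "('f \<Rightarrow> ('v, 'e) walk) \<Rightarrow> nat \<Rightarrow> ('v, 'e, 'f) cube \<Rightarrow> ('v, 'e, 'f) cube" where
  "cube_face s i (u, []) = (u, [])"
| "cube_face s 0 (u, (f, v) # c) = (u \<cdot> s f \<cdot> v, c)"
| "cube_face s (Suc i) (u, (f, v) # c) = (let (v', c') = cube_face s i (v, c) in (u, (f, v') # c'))"

definition face_rel :: "('v, 'e, 'f) two_complex \<Rightarrow> ('v, 'e, 'f) cube rel" where
  "face_rel K = {(c, cube_face s i c) | c s i.
     is_cube K c \<and> i < cube_dim c \<and> s \<in> {ctop K, cbot K}}"

text \<open>The cubes of the connected component of the Squier complex that contains the vertex \<open>w\<close>.\<close>

definition squier_component ::
    "('v, 'e, 'f) two_complex \<Rightarrow> ('v, 'e) walk \<Rightarrow> ('v, 'e, 'f) cube set" where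
  "squier_component K w = {c. ((w, []), c) \<in> (face_rel K \<union> (face_rel K)\<inverse>)\<^sup>*}"


section \<open>Left forests and essential cubes\<close>

text \<open>In a graph whose edges come with inverses, the walk \<open>e, e\<^sup>-\<^sup>1\<close> is not a circuit, so
  a forest is a set of edges without non-trivial closed walks free of backtracking (the predicate
  \<open>forest\<close> of Graph_Theory would reject every graph containing such a pair of edges).
  Walks in \<open>T\<close> remain within one component of the Squier graph; hence the last clause says that
  \<open>T\<close> meets each component in a connected graph containing all its vertices.\<close>

definition spanning_forest ::
    "('v, 'e, 'f) two_complex \<Rightarrow> ('v, 'e, 'f) atom set \<Rightarrow> bool" where
  "spanning_forest K T \<longleftrightarrow>
     T \<subseteq> arcs (squier_graph K) \<and> atom_inv K ` T \<subseteq> T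
     \<and> \<not> (\<exists>u es. es \<noteq> [] \<and> pre_digraph.awalk ((squier_graph K)\<lparr>arcs := T\<rparr>) u es u
             \<and> successively (\<lambda>d e. e \<noteq> atom_inv K d) es)
     \<and> (\<forall>u v. reachable (squier_graph K) u v \<longrightarrow> reachable ((squier_graph K)\<lparr>arcs := T\<rparr>) u v)"

definition left_forest :: "('v, 'e, 'f) two_complex \<Rightarrow> ('v, 'e, 'f) atom set \<Rightarrow> bool" where
  "left_forest K T \<longleftrightarrow> spanning_forest K T
     \<and> (\<forall>p f q. (p, f, q) \<in> T \<longrightarrow> irreducible_path K p)
     \<and> (\<forall>p f q q'. (p, f, q) \<in> T \<and> is_atom K (p, f, q') \<longrightarrow> (p, f, q') \<in> T)"

fun essential :: "('v, 'e, 'f) two_complex \<Rightarrow> ('v, 'e, 'f) atom set \<Rightarrow> ('v, 'e, 'f) cube \<Rightarrow> bool" where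
  "essential K T (u, []) \<longleftrightarrow> irreducible_path K u"
| "essential K T (u, (f, v) # c) \<longleftrightarrow>
     irreducible_path K u \<and> \<not> (\<exists>q. (u, f, q) \<in> T) \<and> essential K T (v, c)"

definition essential_cubes ::
    "('v, 'e, 'f) two_complex \<Rightarrow> ('v, 'e, 'f) atom set \<Rightarrow> ('v, 'e) walk \<Rightarrow> nat
      \<Rightarrow> ('v, 'e, 'f) cube set" where
  "essential_cubes K T w n =
     {c \<in> squier_component K w. is_cube K c \<and> cube_dim c = n \<and> essential K T c}"


section \<open>Integer homology of a group\<close>

text \<open>\<open>H\<^sub>n(G; \<int>)\<close> is the homology of the inhomogeneous bar complex with trivial integer
  coefficients.  Its \<open>n\<close>-chains are generated by the symbols \<open>[g\<^sub>1|\<dots>|g\<^sub>n]\<close>, i.e. lists of length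
  \<open>n\<close>, and the boundary of such a symbol is
  \<open>[g\<^sub>2|\<dots>|g\<^sub>n] + (\<Sum>0<i<n. (-1)^i [g\<^sub>1|\<dots>|g\<^sub>i g\<^sub>i\<^sub>+\<^sub>1|\<dots>|g\<^sub>n]) + (-1)^n [g\<^sub>1|\<dots>|g\<^sub>n\<^sub>-\<^sub>1]\<close>.\<close>

definition bar_chain_group :: "nat \<Rightarrow> ('a, 'm) monoid_scheme \<Rightarrow> ('a list \<Rightarrow>\<^sub>0 int) monoid" where
  "bar_chain_group n G = free_Abelian_group {gs. length gs = n \<and> set gs \<subseteq> carrier G}"

definition bar_face :: "nat \<Rightarrow> ('a, 'm) monoid_scheme \<Rightarrow> nat \<Rightarrow> 'a list \<Rightarrow> 'a list" where
  "bar_face n G i gs =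
     (if i = 0 then tl gs
      else if i = n then butlast gs
      else take (i - 1) gs @ [gs ! (i - 1) \<otimes>\<^bsub>G\<^esub> gs ! i] @ drop (i + 1) gs)"

definition bar_boundary ::
    "nat \<Rightarrow> ('a, 'm) monoid_scheme \<Rightarrow> ('a list \<Rightarrow>\<^sub>0 int) \<Rightarrow> ('a list \<Rightarrow>\<^sub>0 int)" where
  "bar_boundary n G c =
     (if n = 0 then 0
      else frag_extend (\<lambda>gs. \<Sum>i\<le>n. frag_cmul ((-1) ^ i) (frag_of (bar_face n G i gs))) c)"

definition bar_cycles :: "nat \<Rightarrow> ('a, 'm) monoid_scheme \<Rightarrow> ('a list \<Rightarrow>\<^sub>0 int) set" where
  "bar_cycles n G = {c \<in> carrier (bar_chain_group n G). bar_boundary n G c = 0}"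

definition bar_boundaries :: "nat \<Rightarrow> ('a, 'm) monoid_scheme \<Rightarrow> ('a list \<Rightarrow>\<^sub>0 int) set" where
  "bar_boundaries n G = bar_boundary (Suc n) G ` carrier (bar_chain_group (Suc n) G)"

definition group_homology ::
    "nat \<Rightarrow> ('a, 'm) monoid_scheme \<Rightarrow> ('a list \<Rightarrow>\<^sub>0 int) set monoid" where
  "group_homology n G =
     subgroup_generated (bar_chain_group n G) (bar_cycles n G) Mod bar_boundaries n G"

end

theory Submission
  imports Defs
begin

text \<open>The cubes of the Squier complex of \<open>w\<close> generate a cellular chain complex. The theorem
  holds because the universal cover of the Squier complex is contractible, so that this complex
  computes the homology of the diagram group \<open>G\<close>, and because the left forest collapses it onto a
  complex with zero differential that is free on the essential cubes.

  \<^emph>\<open>Normal forms.\<close> Once the initial 1-path is known, a 2-path is determined by the word of its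
  pairs (offset of the cell, cell). In such a word a letter can be moved to an earlier place past
  any letter that lies to its left, and it may then meet its inverse and cancel; carrying this out
  for each letter in turn gives a normal form. Homotopic 2-paths have the same normal form, since
  pushing a letter into a normal word satisfies the two relations that define homotopy
  (\<open>push_inv\<close>, \<open>push_exchange\<close>), and conversely a 2-path is homotopic to its normal form
  (\<open>walk_normalize\<close>). So \<open>G\<close> is the group of normal words that lead from \<open>w\<close> to \<open>w\<close>.

  \<^emph>\<open>Contractibility.\<close> A cube of the universal cover is a pair of a normal word \<open>V\<close> and a cube \<open>c\<close>
  whose top is the 1-path reached by \<open>V\<close>. If \<open>V\<close> ends with the cell \<open>g\<close> and all cells of \<open>c\<close> lie to
  the right of \<open>g\<close>, then \<open>c\<close> is swept back along \<open>g\<close>, tracing out a cube with one more cell;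
  repeating this with shorter and shorter \<open>V\<close> until some cell of \<open>c\<close> is no longer to the right
  gives an explicit contracting homotopy (\<open>contraction\<close>). Since \<open>G\<close> acts freely, the cellular chains
  of the universal cover form a free resolution of the integers (\<open>cover_free_resolution\<close>). The
  comparison theorem for free resolutions (\<open>comparison_homotopy\<close>), applied to it and to the bar
  resolution, identifies the homology of \<open>G\<close> with that of the chains on the cubes of the
  component of \<open>w\<close>.

  \<^emph>\<open>Collapse.\<close> Write \<open>red u\<close> for the irreducible form of a 1-path \<open>u\<close>. The path in the forest
  from \<open>u\<close> to \<open>red u\<close> is a chain \<open>tree_chain u\<close> of edges with boundary \<open>u - red u\<close>. The two
  conditions on a left forest imply that this chain uses only edges \<open>(p, f, q)\<close> with \<open>p\<close> irreducible
  and that \<open>tree_chain (a b) = (tree_chain a) b + tree_chain ((red a) b)\<close>. For irreducible \<open>p\<close> the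
  edge \<open>(p, f)\<close> is closed up by two such chains to a cycle \<open>loop p f\<close>, which vanishes if the edge
  lies in the forest. Now send a cube \<open>u f c\<close>, with \<open>f\<close> its leftmost cell, to \<open>(red u) f\<close> followed
  by the image of \<open>c\<close>, or to \<open>0\<close> if \<open>(red u, f, *)\<close> is in the forest. This kills boundaries, as the
  top and the bottom of \<open>f\<close> have the same irreducible form. Replacing every \<open>(u, f)\<close> of an essential
  cube by \<open>loop u f\<close> turns the cube into a cycle that is mapped back to it, and an explicit homotopy
  (\<open>contract_homotopy\<close>) shows that the two maps are inverse up to homotopy. As the complex of
  essential cubes has zero differential, its homology is free on the essential cubes
  (\<open>cubes_collapse\<close>).\<close>

section \<open>Chains\<close>

definition chains :: "'a set \<Rightarrow> ('a \<Rightarrow>\<^sub>0 int) set" where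
  "chains S = {c. Poly_Mapping.keys c \<subseteq> S}"

lemma chains_iff: "c \<in> chains S \<longleftrightarrow> Poly_Mapping.keys c \<subseteq> S"
  by (simp add: chains_def)

lemmas lin = frag_extend_add frag_extend_diff frag_extend_minus

lemma frag_extend_frag_extend:
  "frag_extend f (frag_extend g c) = frag_extend (\<lambda>x. frag_extend f (g x)) c"
  by (induction c rule: frag_induction[OF subset_UNIV]) (auto simp: frag_extend_diff)

lemma frag_extend_cong_on:
  "\<lbrakk>c \<in> chains S; \<And>x. x \<in> S \<Longrightarrow> f x = g x\<rbrakk> \<Longrightarrow> frag_extend f c = frag_extend g c"
  by (rule frag_extend_eq) (auto simp: chains_iff)

lemma frag_extend_zero_fun [simp]: "frag_extend (\<lambda>x. 0) c = 0"
  by (simp add: frag_extend_eq_0)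

lemma frag_extend_add_fun: "frag_extend (\<lambda>x. f x + g x) c = frag_extend f c + frag_extend g c"
  by (induction c rule: frag_induction[OF subset_UNIV]) (auto simp: frag_extend_diff)

lemma frag_extend_diff_fun: "frag_extend (\<lambda>x. f x - g x) c = frag_extend f c - frag_extend g c"
  by (induction c rule: frag_induction[OF subset_UNIV]) (auto simp: frag_extend_diff)

lemma frag_extend_minus_fun: "frag_extend (\<lambda>x. - g x) c = - frag_extend g c"
  using frag_extend_diff_fun[of "\<lambda>_. 0" g c] by simp

lemma frag_extend_frag_of [simp]: "frag_extend frag_of c = c"
  using frag_expansion by metis

lemmas lin_fun = frag_extend_add_fun frag_extend_diff_fun frag_extend_minus_fun

lemma frag_extend_in_chains:
  "\<lbrakk>c \<in> chains S; \<And>x. x \<in> S \<Longrightarrow> f x \<in> chains S'\<rbrakk> \<Longrightarrow> frag_extend f c \<in> chains S'"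
  using keys_frag_extend[of f c] by (fastforce simp: chains_iff)

lemma chains_simps [simp, intro]:
  "0 \<in> chains S" "x \<in> chains S \<Longrightarrow> y \<in> chains S \<Longrightarrow> x + y \<in> chains S"
  "x \<in> chains S \<Longrightarrow> y \<in> chains S \<Longrightarrow> x - y \<in> chains S"
  "x \<in> chains S \<Longrightarrow> - x \<in> chains S" "x \<in> chains S \<Longrightarrow> frag_cmul k x \<in> chains S"
  using keys_add[of x y] keys_diff[of x y] keys_cmul[of k x] by (auto simp: chains_iff)

lemma frag_of_in_chains [simp]: "frag_of a \<in> chains S \<longleftrightarrow> a \<in> S"
  by (simp add: chains_iff)

section \<open>Comparison of free resolutions\<close>

text \<open>A free module over the group ring of \<open>G\<close> with basis \<open>B\<close> is the free Abelian group on \<open>G \<times> B\<close>.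
  In these terms \<open>shift\<close> is the action of \<open>G\<close>, \<open>equiv_ext F\<close> the module homomorphism given by its
  values on the basis, \<open>orbits\<close> the projection onto the coinvariants and \<open>aug\<close> the augmentation; the
  target of \<open>aug\<close> is the free Abelian group on one generator instead of the integers, so that the
  same linear calculus applies to it.\<close>

definition aug :: "('a \<Rightarrow>\<^sub>0 int) \<Rightarrow> (unit \<Rightarrow>\<^sub>0 int)" where
  "aug x = frag_extend (\<lambda>_. frag_of ()) x"

definition orbits :: "('g \<times> 'b \<Rightarrow>\<^sub>0 int) \<Rightarrow> ('b \<Rightarrow>\<^sub>0 int)" where
  "orbits x = frag_extend (\<lambda>p. frag_of (snd p)) x"

definition shift :: "('g, 'm) monoid_scheme \<Rightarrow> 'g \<Rightarrow> ('g \<times> 'b \<Rightarrow>\<^sub>0 int) \<Rightarrow> ('g \<times> 'b \<Rightarrow>\<^sub>0 int)" where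
  "shift G g x = frag_extend (\<lambda>p. frag_of (g \<otimes>\<^bsub>G\<^esub> fst p, snd p)) x"

definition equiv_ext :: "('g, 'm) monoid_scheme \<Rightarrow> ('b \<Rightarrow> ('g \<times> 'c \<Rightarrow>\<^sub>0 int)) \<Rightarrow>
    ('g \<times> 'b \<Rightarrow>\<^sub>0 int) \<Rightarrow> ('g \<times> 'c \<Rightarrow>\<^sub>0 int)" where
  "equiv_ext G F x = frag_extend (\<lambda>p. shift G (fst p) (F (snd p))) x"

lemma orbits_shift [simp]: "orbits (shift G g x) = orbits x"
  by (auto simp: orbits_def shift_def frag_extend_frag_extend case_prod_beta)

lemma aug_shift [simp]: "aug (shift G g x) = aug x"
  by (auto simp: aug_def shift_def frag_extend_frag_extend case_prod_beta)

lemma orbits_equiv_ext: "orbits (equiv_ext G F x) = frag_extend (\<lambda>b. orbits (F b)) (orbits x)"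
proof -
  have "orbits (equiv_ext G F x) = frag_extend (\<lambda>p. orbits (shift G (fst p) (F (snd p)))) x"
    by (simp add: orbits_def equiv_ext_def frag_extend_frag_extend case_prod_beta)
  then show ?thesis
    by (simp add: orbits_def[of x] frag_extend_frag_extend case_prod_beta)
qed

lemma equiv_ext_lin: "equiv_ext G F 0 = 0" "equiv_ext G F (x + y) = equiv_ext G F x + equiv_ext G F y"
  "equiv_ext G F (x - y) = equiv_ext G F x - equiv_ext G F y" "equiv_ext G F (- x) = - equiv_ext G F x"
  by (simp_all add: equiv_ext_def lin)

lemma shift_lin: "shift G g 0 = 0" "shift G g (x + y) = shift G g x + shift G g y"
  "shift G g (x - y) = shift G g x - shift G g y" "shift G g (- x) = - shift G g x"
  by (simp_all add: shift_def lin)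

lemma aug_lin: "aug 0 = 0" "aug (x + y) = aug x + aug y"
  "aug (x - y) = aug x - aug y" "aug (- x) = - aug x"
  by (simp_all add: aug_def lin)

lemma orbits_lin: "orbits 0 = 0" "orbits (x + y) = orbits x + orbits y"
  "orbits (x - y) = orbits x - orbits y" "orbits (- x) = - orbits x"
  by (simp_all add: orbits_def lin)

lemma orbits_in_chains: "x \<in> chains (A \<times> B) \<Longrightarrow> orbits x \<in> chains B"
  unfolding orbits_def by (erule frag_extend_in_chains) auto

context group
begin

lemma shift_in_chains: "\<lbrakk>g \<in> carrier G; x \<in> chains (carrier G \<times> B)\<rbrakk> \<Longrightarrow> shift G g x \<in> chains (carrier G \<times> B)"
  unfolding shift_def by (erule frag_extend_in_chains) auto

lemma shift_one: "x \<in> chains (carrier G \<times> B) \<Longrightarrow> shift G \<one> x = x"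
  unfolding shift_def by (subst frag_extend_cong_on[where g = frag_of]) auto

lemma shift_shift: "\<lbrakk>g \<in> carrier G; h \<in> carrier G; x \<in> chains (carrier G \<times> B)\<rbrakk> \<Longrightarrow>
    shift G g (shift G h x) = shift G (g \<otimes> h) x"
  unfolding shift_def frag_extend_frag_extend
  by (erule frag_extend_cong_on) (auto simp: m_assoc)

lemma equiv_ext_in_chains:
  "\<lbrakk>x \<in> chains (carrier G \<times> A); \<And>b. b \<in> A \<Longrightarrow> F b \<in> chains (carrier G \<times> B)\<rbrakk> \<Longrightarrow>
    equiv_ext G F x \<in> chains (carrier G \<times> B)"
  unfolding equiv_ext_def by (erule frag_extend_in_chains) (rule shift_in_chains; auto)

lemma equiv_ext_frag_of: "F b \<in> chains (carrier G \<times> B) \<Longrightarrow> equiv_ext G F (frag_of (\<one>, b)) = F b"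
  by (simp add: equiv_ext_def shift_one)

lemma equiv_ext_shift:
  assumes "g \<in> carrier G" "x \<in> chains (carrier G \<times> A)" "\<And>b. b \<in> A \<Longrightarrow> F b \<in> chains (carrier G \<times> B)"
  shows "equiv_ext G F (shift G g x) = shift G g (equiv_ext G F x)"
proof -
  have "equiv_ext G F (shift G g x) = frag_extend (\<lambda>p. shift G (g \<otimes> fst p) (F (snd p))) x"
    by (simp add: equiv_ext_def shift_def[of G g] frag_extend_frag_extend case_prod_beta)
  also have "\<dots> = frag_extend (\<lambda>p. shift G g (shift G (fst p) (F (snd p)))) x"
    using assms by (intro frag_extend_cong_on[OF assms(2)]) (auto intro!: shift_shift[symmetric])
  also have "\<dots> = shift G g (equiv_ext G F x)"
    by (simp add: equiv_ext_def shift_def[of G g "frag_extend _ _"] frag_extend_frag_extend case_prod_beta)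
       (simp add: shift_def[of G g])
  finally show ?thesis .
qed

lemma equiv_ext_equiv_ext:
  assumes "x \<in> chains (carrier G \<times> A)" "\<And>b. b \<in> A \<Longrightarrow> F b \<in> chains (carrier G \<times> B)"
    "\<And>b. b \<in> B \<Longrightarrow> F' b \<in> chains (carrier G \<times> C)"
  shows "equiv_ext G F' (equiv_ext G F x) = equiv_ext G (\<lambda>b. equiv_ext G F' (F b)) x"
proof -
  have "equiv_ext G F' (equiv_ext G F x) = frag_extend (\<lambda>p. equiv_ext G F' (shift G (fst p) (F (snd p)))) x"
    by (simp add: equiv_ext_def[of G F] equiv_ext_def[of G F' "frag_extend _ _"] frag_extend_frag_extend case_prod_beta)
       (simp add: equiv_ext_def case_prod_beta)
  also have "\<dots> = frag_extend (\<lambda>p. shift G (fst p) (equiv_ext G F' (F (snd p)))) x"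
  proof (rule frag_extend_cong_on[OF assms(1)])
    fix p assume "p \<in> carrier G \<times> A"
    then show "equiv_ext G F' (shift G (fst p) (F (snd p))) = shift G (fst p) (equiv_ext G F' (F (snd p)))"
      using assms by (intro equiv_ext_shift[where A = B and B = C]) auto
  qed
  finally show ?thesis
    by (simp add: equiv_ext_def[of G "\<lambda>b. equiv_ext G F' (F b)"] case_prod_beta)
qed

lemma equiv_ext_cong: "\<lbrakk>x \<in> chains (carrier G \<times> A); \<And>b. b \<in> A \<Longrightarrow> F b = F' b\<rbrakk> \<Longrightarrow> equiv_ext G F x = equiv_ext G F' x"
  unfolding equiv_ext_def by (erule frag_extend_cong_on) (metis mem_Sigma_iff prod.collapse)

lemma aug_equiv_ext:
  assumes "x \<in> chains (carrier G \<times> A)" "\<And>b. b \<in> A \<Longrightarrow> aug (F b) = frag_of ()"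
  shows "aug (equiv_ext G F x) = aug x"
proof -
  have "aug (equiv_ext G F x) = frag_extend (\<lambda>p. aug (shift G (fst p) (F (snd p)))) x"
    by (simp add: aug_def equiv_ext_def frag_extend_frag_extend case_prod_beta)
  also have "\<dots> = frag_extend (\<lambda>p. frag_of ()) x"
    using assms by (intro frag_extend_cong_on[OF assms(1)]) auto
  finally show ?thesis by (simp only: aug_def)
qed

end

text \<open>The contraction \<open>S\<close> is a homomorphism of Abelian groups only. In degree 0 it contracts
  everything onto the generator \<open>x0\<close>, which makes the augmented complex exact there.\<close>

locale free_resolution = group G for G :: "('g, 'm) monoid_scheme" (structure) +
  fixes B :: "nat \<Rightarrow> 'b set"
    and D :: "'b \<Rightarrow> ('g \<times> 'b \<Rightarrow>\<^sub>0 int)"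
    and S :: "'g \<times> 'b \<Rightarrow> ('g \<times> 'b \<Rightarrow>\<^sub>0 int)"
    and x0 :: "'g \<times> 'b"
  assumes D_in: "b \<in> B (Suc n) \<Longrightarrow> D b \<in> chains (carrier G \<times> B n)"
    and S_in: "x \<in> carrier G \<times> B n \<Longrightarrow> S x \<in> chains (carrier G \<times> B (Suc n))"
    and DD: "b \<in> B (Suc (Suc n)) \<Longrightarrow> equiv_ext G D (D b) = 0"
    and aug_D: "b \<in> B (Suc 0) \<Longrightarrow> aug (D b) = 0"
    and x0_in: "x0 \<in> carrier G \<times> B 0"
    and DS_0: "x \<in> carrier G \<times> B 0 \<Longrightarrow> equiv_ext G D (S x) = frag_of x - frag_of x0"
    and DS_Suc: "x \<in> carrier G \<times> B (Suc n) \<Longrightarrow>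
      equiv_ext G D (S x) + frag_extend S (equiv_ext G D (frag_of x)) = frag_of x"
begin

abbreviation "FC n \<equiv> chains (carrier G \<times> B n)"

lemma ext_S_in: "x \<in> FC n \<Longrightarrow> frag_extend S x \<in> FC (Suc n)"
  by (erule frag_extend_in_chains) (rule S_in)

text \<open>The contraction exhibits a chain that kills a given cycle. All constructions below obtain
  their values in the next degree from this and the next lemma.\<close>

lemma fill_0:
  assumes "x \<in> FC 0" "aug x = 0" shows "equiv_ext G D (frag_extend S x) = x"
proof -
  have "equiv_ext G D (frag_extend S x) = frag_extend (\<lambda>p. equiv_ext G D (S p)) x"
    by (simp add: equiv_ext_def frag_extend_frag_extend)
  also have "\<dots> = frag_extend (\<lambda>p. frag_of p - frag_of x0) x"
    by (rule frag_extend_cong_on[OF assms(1)]) (rule DS_0)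
  also have "\<dots> = x - frag_extend (\<lambda>_. frag_of x0) x"
    by (simp add: lin_fun)
  also have "frag_extend (\<lambda>_. frag_of x0) x = frag_extend (\<lambda>_. frag_of x0) (aug x)"
    by (simp add: aug_def frag_extend_frag_extend)
  finally show ?thesis using assms(2) by simp
qed

lemma fill_Suc:
  assumes "x \<in> FC (Suc n)" "equiv_ext G D x = 0" shows "equiv_ext G D (frag_extend S x) = x"
proof -
  have "equiv_ext G D (frag_extend S x) + frag_extend S (equiv_ext G D x)
      = frag_extend (\<lambda>p. equiv_ext G D (S p) + frag_extend S (equiv_ext G D (frag_of p))) x"
    by (simp add: equiv_ext_def frag_extend_frag_extend lin_fun)
  also have "\<dots> = x"
    using frag_extend_cong_on[OF assms(1) DS_Suc] by simp
  finally show ?thesis using assms(2) by simp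
qed

end

locale resolution_pair = A: free_resolution G B D S x0 + A': free_resolution G B' D' S' x0'
  for G :: "('g, 'm) monoid_scheme" (structure)
    and B :: "nat \<Rightarrow> 'b set" and D S x0 and B' :: "nat \<Rightarrow> 'c set" and D' S' x0'
begin

definition chain_map :: "(nat \<Rightarrow> 'b \<Rightarrow> ('g \<times> 'c \<Rightarrow>\<^sub>0 int)) \<Rightarrow> bool" where
  "chain_map \<alpha> \<longleftrightarrow> (\<forall>n. \<forall>b \<in> B n. \<alpha> n b \<in> A'.FC n) \<and> (\<forall>b \<in> B 0. aug (\<alpha> 0 b) = frag_of ())
     \<and> (\<forall>n. \<forall>b \<in> B (Suc n). equiv_ext G D' (\<alpha> (Suc n) b) = equiv_ext G (\<alpha> n) (D b))"

primrec lift :: "nat \<Rightarrow> 'b \<Rightarrow> ('g \<times> 'c \<Rightarrow>\<^sub>0 int)" where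
  "lift 0 b = frag_of x0'"
| "lift (Suc n) b = frag_extend S' (equiv_ext G (lift n) (D b))"

text \<open>Each value is obtained by filling the image of the boundary, which is a cycle by the previous
  degree and, in degree 1, because the augmentation is preserved.\<close>

lemma chain_map_lift: "chain_map lift"
proof -
  have mem: "\<forall>b \<in> B n. lift n b \<in> A'.FC n" for n
  proof (induction n)
    case 0
    then show ?case using A'.x0_in by auto
  next
    case (Suc n)
    show ?case
    proof
      fix b assume "b \<in> B (Suc n)"
      then show "lift (Suc n) b \<in> A'.FC (Suc n)"
        unfolding lift.simps
        by (intro A'.ext_S_in A.equiv_ext_in_chains[OF A.D_in]) (use Suc in blast)+
    qed
  qed
  have aug0: "aug (lift 0 b) = frag_of ()" for b by (simp add: aug_def)
  have "\<forall>b \<in> B (Suc n). equiv_ext G D' (lift (Suc n) b) = equiv_ext G (lift n) (D b)" for n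
  proof (induction n)
    case 0
    show ?case
    proof
      fix b assume b: "b \<in> B (Suc 0)"
      have "aug (equiv_ext G (lift 0) (D b)) = aug (D b)"
        by (rule A.aug_equiv_ext[OF A.D_in[OF b]]) (rule aug0)
      moreover have "equiv_ext G (lift 0) (D b) \<in> A'.FC 0"
        by (rule A.equiv_ext_in_chains[OF A.D_in[OF b]]) (use mem in blast)
      ultimately show "equiv_ext G D' (lift (Suc 0) b) = equiv_ext G (lift 0) (D b)"
        using A'.fill_0 A.aug_D[OF b] by simp
    qed
  next
    case (Suc n)
    show ?case
    proof
      fix b assume b: "b \<in> B (Suc (Suc n))"
      have Db: "D b \<in> A.FC (Suc n)" by (rule A.D_in[OF b])
      have in1: "equiv_ext G (lift (Suc n)) (D b) \<in> A'.FC (Suc n)"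
        by (rule A.equiv_ext_in_chains[OF Db]) (use mem in blast)
      have "equiv_ext G D' (equiv_ext G (lift (Suc n)) (D b)) = equiv_ext G (\<lambda>b. equiv_ext G D' (lift (Suc n) b)) (D b)"
        by (rule A.equiv_ext_equiv_ext[OF Db _ A'.D_in]) (use mem in blast)
      also have "\<dots> = equiv_ext G (\<lambda>b. equiv_ext G (lift n) (D b)) (D b)"
        by (rule A.equiv_ext_cong[OF Db]) (use Suc in blast)
      also have "\<dots> = equiv_ext G (lift n) (equiv_ext G D (D b))"
        by (rule A.equiv_ext_equiv_ext[OF Db A.D_in, symmetric, where C = "B' n"]) (use mem in blast)+
      also have "\<dots> = 0" using A.DD[OF b] by (simp add: equiv_ext_lin)
      finally show "equiv_ext G D' (lift (Suc (Suc n)) b) = equiv_ext G (lift (Suc n)) (D b)"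
        using A'.fill_Suc[OF in1] by simp
    qed
  qed
  with mem aug0 show ?thesis unfolding chain_map_def by blast
qed

primrec htpy :: "(nat \<Rightarrow> 'b \<Rightarrow> ('g \<times> 'c \<Rightarrow>\<^sub>0 int)) \<Rightarrow> (nat \<Rightarrow> 'b \<Rightarrow> ('g \<times> 'c \<Rightarrow>\<^sub>0 int)) \<Rightarrow> nat \<Rightarrow> 'b \<Rightarrow> ('g \<times> 'c \<Rightarrow>\<^sub>0 int)" where
  "htpy \<alpha> \<beta> 0 b = frag_extend S' (\<alpha> 0 b - \<beta> 0 b)"
| "htpy \<alpha> \<beta> (Suc n) b = frag_extend S' (\<alpha> (Suc n) b - \<beta> (Suc n) b - equiv_ext G (htpy \<alpha> \<beta> n) (D b))"

text \<open>The difference of two lifts, corrected by the homotopy one degree lower, is a cycle and can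
  therefore be filled.\<close>

lemma htpy:
  assumes "chain_map \<alpha>" "chain_map \<beta>"
  shows "\<forall>b \<in> B n. htpy \<alpha> \<beta> n b \<in> A'.FC (Suc n)"
    and "\<forall>b \<in> B 0. equiv_ext G D' (htpy \<alpha> \<beta> 0 b) = \<alpha> 0 b - \<beta> 0 b"
    and "\<forall>b \<in> B (Suc n). equiv_ext G D' (htpy \<alpha> \<beta> (Suc n) b) + equiv_ext G (htpy \<alpha> \<beta> n) (D b) = \<alpha> (Suc n) b - \<beta> (Suc n) b"
proof -
  let ?H = "htpy \<alpha> \<beta>"
  have in\<alpha>: "b \<in> B n \<Longrightarrow> \<alpha> n b \<in> A'.FC n" and in\<beta>: "b \<in> B n \<Longrightarrow> \<beta> n b \<in> A'.FC n" for b n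
    using assms unfolding chain_map_def by blast+
  have \<alpha>: "b \<in> B (Suc n) \<Longrightarrow> equiv_ext G D' (\<alpha> (Suc n) b) = equiv_ext G (\<alpha> n) (D b)"
   and \<beta>: "b \<in> B (Suc n) \<Longrightarrow> equiv_ext G D' (\<beta> (Suc n) b) = equiv_ext G (\<beta> n) (D b)" for b n
    using assms unfolding chain_map_def by blast+
  show mem: "\<forall>b \<in> B n. ?H n b \<in> A'.FC (Suc n)" for n
  proof (induction n)
    case 0
    then show ?case using in\<alpha>[of _ 0] in\<beta>[of _ 0] by (auto intro!: A'.ext_S_in)
  next
    case (Suc n)
    show ?case
    proof
      fix b assume b: "b \<in> B (Suc n)"
      have "equiv_ext G (?H n) (D b) \<in> A'.FC (Suc n)"
        by (rule A.equiv_ext_in_chains[OF A.D_in[OF b]]) (use Suc in blast)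
      then show "?H (Suc n) b \<in> A'.FC (Suc (Suc n))"
        using in\<alpha>[OF b] in\<beta>[OF b] unfolding htpy.simps by (intro A'.ext_S_in chains_simps)
    qed
  qed
  show H0: "\<forall>b \<in> B 0. equiv_ext G D' (?H 0 b) = \<alpha> 0 b - \<beta> 0 b"
  proof
    fix b assume b: "b \<in> B 0"
    have "aug (\<alpha> 0 b - \<beta> 0 b) = 0"
      using assms b by (simp add: chain_map_def aug_lin)
    then show "equiv_ext G D' (?H 0 b) = \<alpha> 0 b - \<beta> 0 b"
      unfolding htpy.simps by (intro A'.fill_0 chains_simps in\<alpha> in\<beta> b)
  qed
  have *: "equiv_ext G D' (?H (Suc n) b) + equiv_ext G (?H n) (D b) = \<alpha> (Suc n) b - \<beta> (Suc n) b"
    if b: "b \<in> B (Suc n)" and IH: "equiv_ext G (\<lambda>b. equiv_ext G D' (?H n b)) (D b)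
      = equiv_ext G (\<alpha> n) (D b) - equiv_ext G (\<beta> n) (D b)" for n b
  proof -
    have Db: "D b \<in> A.FC n" by (rule A.D_in[OF b])
    have in1: "equiv_ext G (?H n) (D b) \<in> A'.FC (Suc n)"
      by (rule A.equiv_ext_in_chains[OF Db]) (use mem in blast)
    have "equiv_ext G D' (equiv_ext G (?H n) (D b)) = equiv_ext G (\<lambda>b. equiv_ext G D' (?H n b)) (D b)"
      by (rule A.equiv_ext_equiv_ext[OF Db _ A'.D_in]) (use mem in blast)
    then have "equiv_ext G D' (\<alpha> (Suc n) b - \<beta> (Suc n) b - equiv_ext G (?H n) (D b)) = 0"
      using IH \<alpha>[OF b] \<beta>[OF b] by (simp add: equiv_ext_lin)
    then have "equiv_ext G D' (?H (Suc n) b) = \<alpha> (Suc n) b - \<beta> (Suc n) b - equiv_ext G (?H n) (D b)"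
      unfolding htpy.simps by (intro A'.fill_Suc[where n = n] chains_simps in\<alpha> in\<beta> b in1)
    then show ?thesis by simp
  qed
  show "\<forall>b \<in> B (Suc n). equiv_ext G D' (?H (Suc n) b) + equiv_ext G (?H n) (D b) = \<alpha> (Suc n) b - \<beta> (Suc n) b"
  proof (induction n)
    case 0
    show ?case
    proof
      fix b assume b: "b \<in> B (Suc 0)"
      have "equiv_ext G (\<lambda>b. equiv_ext G D' (?H 0 b)) (D b) = equiv_ext G (\<lambda>b. \<alpha> 0 b - \<beta> 0 b) (D b)"
        by (rule A.equiv_ext_cong[OF A.D_in[OF b]]) (use H0 in blast)
      then show "equiv_ext G D' (?H (Suc 0) b) + equiv_ext G (?H 0) (D b) = \<alpha> (Suc 0) b - \<beta> (Suc 0) b"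
        by (intro *[OF b]) (simp add: equiv_ext_def shift_lin lin_fun case_prod_beta)
    qed
  next
    case (Suc n)
    show ?case
    proof
      fix b assume b: "b \<in> B (Suc (Suc n))"
      have Db: "D b \<in> A.FC (Suc n)" by (rule A.D_in[OF b])
      have "equiv_ext G (\<lambda>b. equiv_ext G D' (?H (Suc n) b)) (D b)
          = equiv_ext G (\<lambda>b. \<alpha> (Suc n) b - \<beta> (Suc n) b - equiv_ext G (?H n) (D b)) (D b)"
        by (rule A.equiv_ext_cong[OF Db]) (use Suc in \<open>simp add: eq_diff_eq\<close>)
      also have "\<dots> = equiv_ext G (\<alpha> (Suc n)) (D b) - equiv_ext G (\<beta> (Suc n)) (D b)
          - equiv_ext G (\<lambda>b. equiv_ext G (?H n) (D b)) (D b)"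
        by (simp add: equiv_ext_def[of G "\<lambda>b. _ b - _ b - _ b"] shift_lin lin_fun case_prod_beta)
           (simp add: equiv_ext_def case_prod_beta)
      also have "equiv_ext G (\<lambda>b. equiv_ext G (?H n) (D b)) (D b) = equiv_ext G (?H n) (equiv_ext G D (D b))"
        by (rule A.equiv_ext_equiv_ext[OF Db A.D_in, symmetric, where C = "B' (Suc n)"]) (use mem in blast)+
      also have "\<dots> = 0" using A.DD[OF b] by (simp add: equiv_ext_lin)
      finally show "equiv_ext G D' (?H (Suc (Suc n)) b) + equiv_ext G (?H (Suc n)) (D b)
          = \<alpha> (Suc (Suc n)) b - \<beta> (Suc (Suc n)) b"
        by (intro *[OF b]) simp
    qed
  qed
qed

end


definition orbit_map :: "('b \<Rightarrow> ('g \<times> 'c \<Rightarrow>\<^sub>0 int)) \<Rightarrow> ('b \<Rightarrow>\<^sub>0 int) \<Rightarrow> ('c \<Rightarrow>\<^sub>0 int)" where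
  "orbit_map F = frag_extend (\<lambda>b. orbits (F b))"

lemma orbit_map_in_chains:
  "\<lbrakk>x \<in> chains A; \<And>b. b \<in> A \<Longrightarrow> F b \<in> chains (C \<times> B)\<rbrakk> \<Longrightarrow> orbit_map F x \<in> chains B"
  unfolding orbit_map_def by (erule frag_extend_in_chains) (metis orbits_in_chains)

lemma orbit_map_lin: "orbit_map F 0 = 0" "orbit_map F (x + y) = orbit_map F x + orbit_map F y"
  "orbit_map F (x - y) = orbit_map F x - orbit_map F y" "orbit_map F (- x) = - orbit_map F x"
  by (simp_all add: orbit_map_def lin)

lemma resolution_pairI:
  "free_resolution G B D S x0 \<Longrightarrow> free_resolution G B' D' S' x0' \<Longrightarrow>
    resolution_pair G B D S x0 B' D' S' x0'"
  by (simp add: resolution_pair_def)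

text \<open>Going to the other resolution and back is an augmentation preserving chain map, and so is the
  identity; any two of these are homotopic. Everything is then pushed down to the coinvariants,
  where the complexes of interest live.\<close>

lemma comparison_homotopy:
  fixes G :: "('g, 'm) monoid_scheme" and B :: "nat \<Rightarrow> 'b set"
  assumes A: "free_resolution G B D S x0" and A': "free_resolution G B' D' S' x0'"
  defines "\<alpha> \<equiv> resolution_pair.lift G D S' x0'" and "\<beta> \<equiv> resolution_pair.lift G D' S x0"
  shows "\<exists>H :: nat \<Rightarrow> 'b \<Rightarrow> ('g \<times> 'b \<Rightarrow>\<^sub>0 int).
    (\<forall>n. \<forall>x \<in> chains (B n). orbit_map (H n) x \<in> chains (B (Suc n)))
    \<and> (\<forall>x \<in> chains (B 0). orbit_map D (orbit_map (H 0) x) = orbit_map (\<beta> 0) (orbit_map (\<alpha> 0) x) - x)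
    \<and> (\<forall>n. \<forall>x \<in> chains (B (Suc n)). orbit_map D (orbit_map (H (Suc n)) x) + orbit_map (H n) (orbit_map D x)
        = orbit_map (\<beta> (Suc n)) (orbit_map (\<alpha> (Suc n)) x) - x)"
proof -
  interpret A: free_resolution G B D S x0 by (rule A)
  interpret A': free_resolution G B' D' S' x0' by (rule A')
  interpret P: resolution_pair G B D S x0 B' D' S' x0' by (rule resolution_pairI[OF A A'])
  interpret Q: resolution_pair G B' D' S' x0' B D S x0 by (rule resolution_pairI[OF A' A])
  interpret R: resolution_pair G B D S x0 B D S x0 by (rule resolution_pairI[OF A A])
  note cm = P.chain_map_lift[folded \<alpha>_def] Q.chain_map_lift[folded \<beta>_def]
  have \<alpha>in: "b \<in> B n \<Longrightarrow> \<alpha> n b \<in> A'.FC n" and \<beta>in: "c \<in> B' n \<Longrightarrow> \<beta> n c \<in> A.FC n" for b c n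
    using cm unfolding P.chain_map_def Q.chain_map_def by blast+
  let ?c = "\<lambda>n b. equiv_ext G (\<beta> n) (\<alpha> n b)" and ?i = "\<lambda>n b. frag_of (\<one>\<^bsub>G\<^esub>, b)"
  have D_eq: "D b = equiv_ext G (\<lambda>b. frag_of (\<one>\<^bsub>G\<^esub>, b)) (D b)" if "b \<in> B (Suc n)" for b n
  proof -
    have "equiv_ext G (\<lambda>b. frag_of (\<one>\<^bsub>G\<^esub>, b)) (D b) = frag_extend frag_of (D b)"
      unfolding equiv_ext_def by (rule frag_extend_cong_on[OF A.D_in[OF that]]) (auto simp: shift_def)
    then show ?thesis by simp
  qed
  have i: "R.chain_map ?i"
    unfolding R.chain_map_def using A.equiv_ext_frag_of[of D, OF A.D_in] D_eq by (auto simp: aug_def)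
  have c: "R.chain_map ?c"
    unfolding R.chain_map_def
  proof (intro conjI allI ballI)
    fix n b assume b: "b \<in> B n"
    show "?c n b \<in> A.FC n" by (rule A.equiv_ext_in_chains[OF \<alpha>in[OF b]]) (rule \<beta>in)
  next
    fix b assume b: "b \<in> B 0"
    have "aug (?c 0 b) = aug (\<alpha> 0 b)"
      using cm by (intro A.aug_equiv_ext[OF \<alpha>in[OF b]]) (auto simp: Q.chain_map_def)
    then show "aug (?c 0 b) = frag_of ()" using cm b by (auto simp: P.chain_map_def)
  next
    fix n b assume b: "b \<in> B (Suc n)"
    have "equiv_ext G D (?c (Suc n) b) = equiv_ext G (\<lambda>b. equiv_ext G D (\<beta> (Suc n) b)) (\<alpha> (Suc n) b)"
      by (rule A.equiv_ext_equiv_ext[OF \<alpha>in[OF b] \<beta>in A.D_in])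
    also have "\<dots> = equiv_ext G (\<lambda>b. equiv_ext G (\<beta> n) (D' b)) (\<alpha> (Suc n) b)"
      by (rule A.equiv_ext_cong[OF \<alpha>in[OF b]]) (use cm in \<open>auto simp: Q.chain_map_def\<close>)
    also have "\<dots> = equiv_ext G (\<beta> n) (equiv_ext G D' (\<alpha> (Suc n) b))"
      by (rule A.equiv_ext_equiv_ext[OF \<alpha>in[OF b] A'.D_in \<beta>in, symmetric])
    also have "equiv_ext G D' (\<alpha> (Suc n) b) = equiv_ext G (\<alpha> n) (D b)"
      using cm b by (auto simp: P.chain_map_def)
    also have "equiv_ext G (\<beta> n) (equiv_ext G (\<alpha> n) (D b)) = equiv_ext G (?c n) (D b)"
      by (rule A.equiv_ext_equiv_ext[OF A.D_in[OF b] \<alpha>in \<beta>in])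
    finally show "equiv_ext G D (?c (Suc n) b) = equiv_ext G (?c n) (D b)" .
  qed
  let ?H = "R.htpy ?c ?i"
  note h = R.htpy[OF c i]
  show ?thesis
  proof (intro exI[of _ ?H] conjI allI ballI)
    fix n x assume "x \<in> chains (B n)"
    then show "orbit_map (?H n) x \<in> chains (B (Suc n))"
      by (rule orbit_map_in_chains) (use h(1) in blast)
  next
    fix x assume x: "x \<in> chains (B 0)"
    have *: "orbits (equiv_ext G D (?H 0 b)) = orbits (equiv_ext G (\<beta> 0) (\<alpha> 0 b)) - frag_of b" if "b \<in> B 0" for b
      using h(2) that by (simp add: orbits_lin) (simp add: orbits_def)
    have "orbit_map D (orbit_map (?H 0) x) = frag_extend (\<lambda>b. orbits (equiv_ext G D (?H 0 b))) x"
      by (simp add: orbit_map_def orbits_equiv_ext frag_extend_frag_extend)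
    also have "\<dots> = frag_extend (\<lambda>b. orbits (equiv_ext G (\<beta> 0) (\<alpha> 0 b)) - frag_of b) x"
      by (rule frag_extend_cong_on[OF x]) (rule *)
    finally show "orbit_map D (orbit_map (?H 0) x) = orbit_map (\<beta> 0) (orbit_map (\<alpha> 0) x) - x"
      by (simp add: orbit_map_def orbits_equiv_ext frag_extend_frag_extend lin_fun)
  next
    fix n x assume x: "x \<in> chains (B (Suc n))"
    have *: "orbits (equiv_ext G D (?H (Suc n) b)) + orbits (equiv_ext G (?H n) (D b))
       = orbits (equiv_ext G (\<beta> (Suc n)) (\<alpha> (Suc n) b)) - frag_of b" if b: "b \<in> B (Suc n)" for b
    proof -
      have "orbits (equiv_ext G D (?H (Suc n) b)) + orbits (equiv_ext G (?H n) (D b))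
         = orbits (equiv_ext G D (?H (Suc n) b) + equiv_ext G (?H n) (D b))"
        by (simp only: orbits_lin)
      also have "\<dots> = orbits (?c (Suc n) b - ?i (Suc n) b)"
        using h(3) b by (metis (no_types, lifting))
      finally show ?thesis by (simp add: orbits_lin) (simp add: orbits_def)
    qed
    have "orbit_map D (orbit_map (?H (Suc n)) x) + orbit_map (?H n) (orbit_map D x)
        = frag_extend (\<lambda>b. orbits (equiv_ext G D (?H (Suc n) b)) + orbits (equiv_ext G (?H n) (D b))) x"
      by (simp add: orbit_map_def orbits_equiv_ext frag_extend_frag_extend lin_fun)
    also have "\<dots> = frag_extend (\<lambda>b. orbits (equiv_ext G (\<beta> (Suc n)) (\<alpha> (Suc n) b)) - frag_of b) x"
      by (rule frag_extend_cong_on[OF x]) (rule *)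
    finally show "orbit_map D (orbit_map (?H (Suc n)) x) + orbit_map (?H n) (orbit_map D x)
        = orbit_map (\<beta> (Suc n)) (orbit_map (\<alpha> (Suc n)) x) - x"
      by (simp add: orbit_map_def orbits_equiv_ext frag_extend_frag_extend lin_fun)
  qed
qed

context resolution_pair
begin

lemma orbits_lift_in: "x \<in> chains (B n) \<Longrightarrow> orbit_map (lift n) x \<in> chains (B' n)"
  by (erule orbit_map_in_chains) (use chain_map_lift[unfolded chain_map_def] in blast)

lemma orbits_lift_D:
  assumes x: "x \<in> chains (B (Suc n))"
  shows "orbit_map D' (orbit_map (lift (Suc n)) x) = orbit_map (lift n) (orbit_map D x)"
proof -
  have "orbit_map D' (orbit_map (lift (Suc n)) x) = frag_extend (\<lambda>b. orbits (equiv_ext G D' (lift (Suc n) b))) x"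
    by (simp add: orbit_map_def orbits_equiv_ext frag_extend_frag_extend del: lift.simps)
  also have "\<dots> = frag_extend (\<lambda>b. orbits (equiv_ext G (lift n) (D b))) x"
    by (rule frag_extend_cong_on[OF x]) (use chain_map_lift[unfolded chain_map_def] in auto)
  finally show ?thesis by (simp add: orbit_map_def orbits_equiv_ext frag_extend_frag_extend)
qed

end

text \<open>This is what is left, in degree \<open>n\<close>, of a chain homotopy equivalence \<open>\<phi>\<close> with the free
  Abelian group on \<open>E\<close> carrying the zero differential: \<open>\<phi>\<close> kills boundaries, hits every generator by
  a cycle, and a cycle that it kills is a boundary. In degree 0 every chain counts as a cycle.\<close>

definition collapses ::
  "(nat \<Rightarrow> 'b set) \<Rightarrow> (nat \<Rightarrow> ('b \<Rightarrow>\<^sub>0 int) \<Rightarrow> ('b \<Rightarrow>\<^sub>0 int)) \<Rightarrow> nat \<Rightarrow> 'e set \<Rightarrow> ('b \<Rightarrow> 'e \<Rightarrow>\<^sub>0 int) \<Rightarrow> bool" where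
  "collapses B d n E \<phi> \<longleftrightarrow>
    (\<forall>b \<in> B n. \<phi> b \<in> chains E)
    \<and> (\<forall>x \<in> chains (B (Suc n)). frag_extend \<phi> (d (Suc n) x) = 0)
    \<and> (\<forall>e \<in> E. \<exists>x \<in> chains (B n). (n > 0 \<longrightarrow> d n x = 0) \<and> frag_extend \<phi> x = frag_of e)
    \<and> (\<forall>x \<in> chains (B n). (n > 0 \<longrightarrow> d n x = 0) \<longrightarrow> frag_extend \<phi> x = 0 \<longrightarrow>
         (\<exists>y \<in> chains (B (Suc n)). d (Suc n) y = x))"

text \<open>The comparison maps are homotopy equivalences on coinvariants, and a map that kills boundaries
  does not see the homotopies.\<close>

lemma collapses_transfer:
  fixes G :: "('g, 'm) monoid_scheme" and B :: "nat \<Rightarrow> 'b set" and B' :: "nat \<Rightarrow> 'c set"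
  assumes A: "free_resolution G B D S x0" and A': "free_resolution G B' D' S' x0'"
    and col: "collapses B' (\<lambda>_. orbit_map D') n E \<phi>"
  shows "\<exists>\<psi>. collapses B (\<lambda>_. orbit_map D) n E \<psi>"
proof -
  interpret A: free_resolution G B D S x0 by (rule A)
  interpret A': free_resolution G B' D' S' x0' by (rule A')
  interpret P: resolution_pair G B D S x0 B' D' S' x0' by (rule resolution_pairI[OF A A'])
  interpret Q: resolution_pair G B' D' S' x0' B D S x0 by (rule resolution_pairI[OF A' A])
  let ?\<alpha> = "\<lambda>n. orbit_map (P.lift n)" and ?\<beta> = "\<lambda>n. orbit_map (Q.lift n)"
  let ?d = "orbit_map D" and ?d' = "orbit_map D'"
  obtain H :: "nat \<Rightarrow> 'b \<Rightarrow> ('g \<times> 'b \<Rightarrow>\<^sub>0 int)" where H_in: "\<And>n x. x \<in> chains (B n) \<Longrightarrow> orbit_map (H n) x \<in> chains (B (Suc n))"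
    and H0: "\<And>x. x \<in> chains (B 0) \<Longrightarrow> ?d (orbit_map (H 0) x) = ?\<beta> 0 (?\<alpha> 0 x) - x"
    and HS: "\<And>n x. x \<in> chains (B (Suc n)) \<Longrightarrow>
      ?d (orbit_map (H (Suc n)) x) + orbit_map (H n) (?d x) = ?\<beta> (Suc n) (?\<alpha> (Suc n) x) - x"
    using comparison_homotopy[OF A A'] by blast
  obtain H' :: "nat \<Rightarrow> 'c \<Rightarrow> ('g \<times> 'c \<Rightarrow>\<^sub>0 int)" where H'_in: "\<And>n x. x \<in> chains (B' n) \<Longrightarrow> orbit_map (H' n) x \<in> chains (B' (Suc n))"
    and H'0: "\<And>x. x \<in> chains (B' 0) \<Longrightarrow> ?d' (orbit_map (H' 0) x) = ?\<alpha> 0 (?\<beta> 0 x) - x"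
    and H'S: "\<And>n x. x \<in> chains (B' (Suc n)) \<Longrightarrow>
      ?d' (orbit_map (H' (Suc n)) x) + orbit_map (H' n) (?d' x) = ?\<alpha> (Suc n) (?\<beta> (Suc n) x) - x"
    using comparison_homotopy[OF A' A] by blast
  have H_cyc: "?d (orbit_map (H n) x) = ?\<beta> n (?\<alpha> n x) - x"
    if "x \<in> chains (B n)" "n > 0 \<longrightarrow> ?d x = 0" for x
    using that H0 HS by (cases n) (fastforce simp: orbit_map_lin)+
  have H'_cyc: "?d' (orbit_map (H' n) x) = ?\<alpha> n (?\<beta> n x) - x"
    if "x \<in> chains (B' n)" "n > 0 \<longrightarrow> ?d' x = 0" for x
    using that H'0 H'S by (cases n) (fastforce simp: orbit_map_lin)+
  have cyc\<alpha>: "n > 0 \<longrightarrow> ?d' (?\<alpha> n x) = 0" if "x \<in> chains (B n)" "n > 0 \<longrightarrow> ?d x = 0" for x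
    using that P.orbits_lift_D[of x "n - 1"] by (cases n) (auto simp: orbit_map_lin)
  have cyc\<beta>: "n > 0 \<longrightarrow> ?d (?\<beta> n x) = 0" if "x \<in> chains (B' n)" "n > 0 \<longrightarrow> ?d' x = 0" for x
    using that Q.orbits_lift_D[of x "n - 1"] by (cases n) (auto simp: orbit_map_lin)
  let ?\<psi> = "\<lambda>b. frag_extend \<phi> (orbits (P.lift n b))"
  have \<psi>: "frag_extend ?\<psi> x = frag_extend \<phi> (?\<alpha> n x)" for x
    by (simp add: orbit_map_def frag_extend_frag_extend)
  have \<phi>0: "frag_extend \<phi> (?d' x) = 0" if "x \<in> chains (B' (Suc n))" for x
    using col that unfolding collapses_def by blast
  have "collapses B (\<lambda>_. ?d) n E ?\<psi>"
    unfolding collapses_def \<psi>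
  proof (intro conjI ballI impI)
    fix b assume "b \<in> B n"
    then have "orbits (P.lift n b) \<in> chains (B' n)"
      using P.orbits_lift_in[of "frag_of b" n] by (simp add: orbit_map_def)
    then show "?\<psi> b \<in> chains E"
      by (rule frag_extend_in_chains) (use col in \<open>auto simp: collapses_def\<close>)
  next
    fix x assume x: "x \<in> chains (B (Suc n))"
    show "frag_extend \<phi> (?\<alpha> n (?d x)) = 0"
      using \<phi>0[OF P.orbits_lift_in[OF x]] P.orbits_lift_D[OF x] by simp
  next
    fix e assume "e \<in> E"
    then obtain x where x: "x \<in> chains (B' n)" "n > 0 \<longrightarrow> ?d' x = 0" "frag_extend \<phi> x = frag_of e"
      using col unfolding collapses_def by blast
    have "frag_extend \<phi> (?\<alpha> n (?\<beta> n x)) = frag_extend \<phi> (?\<alpha> n (?\<beta> n x) - x) + frag_of e"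
      by (simp add: lin x)
    also have "\<dots> = frag_of e"
      using \<phi>0[OF H'_in[OF x(1)]] H'_cyc[OF x(1,2)] by simp
    finally show "\<exists>x \<in> chains (B n). (n > 0 \<longrightarrow> ?d x = 0) \<and> frag_extend \<phi> (?\<alpha> n x) = frag_of e"
      using Q.orbits_lift_in[OF x(1)] cyc\<beta>[OF x(1,2)] by blast
  next
    fix x assume x: "x \<in> chains (B n)" "n > 0 \<longrightarrow> ?d x = 0" "frag_extend \<phi> (?\<alpha> n x) = 0"
    then obtain y where y: "y \<in> chains (B' (Suc n))" "?d' y = ?\<alpha> n x"
      using col P.orbits_lift_in[OF x(1)] cyc\<alpha>[OF x(1,2)] unfolding collapses_def by blast
    show "\<exists>y \<in> chains (B (Suc n)). ?d y = x"
    proof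
      show "?d (?\<beta> (Suc n) y - orbit_map (H n) x) = x"
        using Q.orbits_lift_D[OF y(1)] H_cyc[OF x(1,2)] by (simp add: orbit_map_lin(3) y(2) del: Q.lift.simps)
      show "?\<beta> (Suc n) y - orbit_map (H n) x \<in> chains (B (Suc n))"
        by (intro chains_simps Q.orbits_lift_in H_in x y)
    qed
  qed
  then show ?thesis by blast
qed

section \<open>Normal forms of 2-paths\<close>

text \<open>The data of a directed 2-complex that are left when 1-paths are replaced by their lists of
  edges; \<open>F\<close> is the set of 2-cells and \<open>N\<close> the set of negative ones. If the top of a cell is a
  factor of the edge list of a 1-path, the cell fits in at that place, so that nothing is lost.\<close>

locale cell_system =
  fixes F N :: "'f set" and tp bt :: "'f \<Rightarrow> 'e list" and iv :: "'f \<Rightarrow> 'f"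
  assumes iv_in: "f \<in> F \<Longrightarrow> iv f \<in> F" and iv_iv: "f \<in> F \<Longrightarrow> iv (iv f) = f"
    and tp_iv: "f \<in> F \<Longrightarrow> tp (iv f) = bt f" and bt_iv: "f \<in> F \<Longrightarrow> bt (iv f) = tp f"
    and tp_ne: "f \<in> F \<Longrightarrow> tp f \<noteq> []" and bt_ne: "f \<in> F \<Longrightarrow> bt f \<noteq> []"
    and N_F: "N \<subseteq> F" and N_iv: "f \<in> F \<Longrightarrow> iv f \<in> N \<longleftrightarrow> f \<notin> N"
begin

lemma len_pos: "f \<in> F \<Longrightarrow> length (tp f) > 0" "f \<in> F \<Longrightarrow> length (bt f) > 0"
  using tp_ne bt_ne by auto

text \<open>A 2-path is stored as the list of its letters (offset of the cell, cell), with the last letter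
  first, so that \<open>push a V\<close> multiplies \<open>V\<close> by \<open>a\<close> on the right. If \<open>a\<close> lies to the right of the
  bottom of the last letter \<open>(n, f)\<close>, it is moved before that letter; its offset then has to be
  measured in the 1-path in which \<open>f\<close> still shows its top.\<close>

fun push :: "nat \<times> 'f \<Rightarrow> (nat \<times> 'f) list \<Rightarrow> (nat \<times> 'f) list" where
  "push (m, g) [] = [(m, g)]"
| "push (m, g) ((n, f) # V) =
    (if m \<ge> n + length (bt f) then (n, f) # push (m - length (bt f) + length (tp f), g) V
     else if m = n \<and> f = iv g then V
     else (m, g) # (n, f) # V)"

text \<open>\<open>stays a V\<close> means that \<open>push\<close> leaves \<open>a\<close> at the end of \<open>V\<close>. A word is normal if this holds for
  each of its letters.\<close>

fun stays :: "nat \<times> 'f \<Rightarrow> (nat \<times> 'f) list \<Rightarrow> bool" where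
  "stays (m, g) [] \<longleftrightarrow> True"
| "stays (m, g) ((n, f) # V) \<longleftrightarrow> m < n + length (bt f) \<and> \<not> (m = n \<and> f = iv g)"

fun normal_word :: "(nat \<times> 'f) list \<Rightarrow> bool" where
  "normal_word [] \<longleftrightarrow> True"
| "normal_word (a # V) \<longleftrightarrow> snd a \<in> F \<and> stays a V \<and> normal_word V"

lemma push_stays: "stays a V \<Longrightarrow> push a V = a # V"
  by (cases a; cases V; auto)

lemma push_cells: "snd ` set (push a V) \<subseteq> insert (snd a) (snd ` set V)"
proof (induction a V rule: push.induct)
  case (2 m g n f V)
  then show ?case by (cases "m \<ge> n + length (bt f)") (simp_all, blast+)
qed simp

text \<open>In a normal word \<open>V\<close> with \<open>bound k V\<close>, a cell at offset \<open>k\<close> does not lie to the right of the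
  last letter.\<close>

definition bound :: "nat \<Rightarrow> (nat \<times> 'f) list \<Rightarrow> bool" where
  "bound k V \<longleftrightarrow> (case V of [] \<Rightarrow> True | (n, f) # _ \<Rightarrow> k < n + length (bt f))"

lemma bound_simps [simp]: "bound k []" "bound k ((n, f) # V) \<longleftrightarrow> k < n + length (bt f)"
  by (auto simp: bound_def)

text \<open>The critical case is that the pushed letter cancels the last letter \<open>(m, f)\<close> of \<open>V\<close>. Then
  \<open>m\<close> itself is bounded by the letter before, because \<open>V\<close> is normal.\<close>

lemma bound_push:
  assumes "normal_word V" "bound k V" "k \<le> m" "g \<in> F"
  shows "bound k (push (m, g) V)"
proof (cases V)
  case Nil
  then show ?thesis using assms len_pos[of g] by (auto simp del: length_greater_0_conv)
next
  case (Cons a V')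
  obtain n f where a: "a = (n, f)" by force
  show ?thesis
  proof (cases V')
    case Nil
    then show ?thesis using assms Cons a len_pos[of g] by (auto simp del: length_greater_0_conv)
  next
    case (Cons b V'')
    obtain n' f' where "b = (n', f')" by force
    then show ?thesis using assms \<open>V = a # V'\<close> Cons a len_pos[of g] by (auto simp del: length_greater_0_conv)
  qed
qed

text \<open>A letter pushed in further to the right does not disturb a letter that stays. Again only the
  cancellation of the last letter is critical, where the letter before it becomes visible; its
  bottom reaches beyond the offset \<open>m\<close> of the cancelled letter and hence beyond \<open>n\<close>.\<close>

lemma stays_push:
  assumes "normal_word V" "stays (n, f) V" "f \<in> F" "g \<in> F" "m \<ge> n + length (tp f)"
  shows "stays (n, f) (push (m, g) V)"
proof (cases V)
  case Nil
  then show ?thesis using assms len_pos[of f] by (auto simp del: length_greater_0_conv)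
next
  case (Cons a V')
  obtain n1 f1 where a: "a = (n1, f1)" by force
  show ?thesis
  proof (cases V')
    case Nil
    then show ?thesis using assms Cons a len_pos[of f] by (auto simp del: length_greater_0_conv)
  next
    case (Cons b V'')
    obtain n2 f2 where b: "b = (n2, f2)" by force
    show ?thesis 
      using assms \<open>V = a # V'\<close> Cons a b len_pos[of f] bt_iv[of f] by (auto simp del: length_greater_0_conv)
  qed
qed

lemma normal_word_push: "normal_word V \<Longrightarrow> snd a \<in> F \<Longrightarrow> normal_word (push a V)"
proof (induction a V rule: push.induct)
  case (2 m g n f V)
  show ?case
  proof (cases "m \<ge> n + length (bt f)")
    case True
    then show ?thesis using 2 by (auto intro!: stays_push)
  next
    case False
    then show ?thesis using 2 by (auto simp del: length_greater_0_conv)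
  qed
qed auto

text \<open>The relation \<open>\<delta> \<circ> \<delta>\<^sup>-\<^sup>1 = 1\<close>.\<close>

lemma push_inv:
  assumes "normal_word V" "g \<in> F"
  shows "push (m, iv g) (push (m, g) V) = V"
  using assms
proof (induction V arbitrary: m)
  case Nil
  then show ?case using iv_iv len_pos[of g] by (auto simp del: length_greater_0_conv)
next
  case (Cons a V)
  obtain n f where a: "a = (n, f)" by force
  consider "m \<ge> n + length (bt f)" | "m < n + length (bt f)" "m = n" "f = iv g"
    | "m < n + length (bt f)" "\<not> (m = n \<and> f = iv g)" by linarith
  then show ?case
  proof cases
    case 1
    then show ?thesis using Cons a by (auto simp del: length_greater_0_conv)
  next
    case 2
    then show ?thesis using Cons.prems a by (auto simp: push_stays)
  next
    case 3
    then show ?thesis using Cons.prems a iv_iv len_pos[of g] by (auto simp del: length_greater_0_conv)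
  qed
qed

lemma push_inv':
  assumes "normal_word V" "g \<in> F"
  shows "push (m, g) (push (m, iv g) V) = V"
  using push_inv[OF assms(1) iv_in[OF assms(2)]] iv_iv[OF assms(2)] by simp

text \<open>The relation that two disjoint cells may be applied in either order. The induction follows the
  left one of the two cells, \<open>f\<close>: while it moves to an earlier place in the word, so does \<open>g\<close>, and
  when it comes to rest, \<open>g\<close> continues and does not disturb it.\<close>

lemma push_exchange:
  assumes "normal_word V" "f \<in> F" "g \<in> F" "m \<ge> n + length (bt f)"
  shows "push (m, g) (push (n, f) V) = push (n, f) (push (m - length (bt f) + length (tp f), g) V)"
  using assms
proof (induction V arbitrary: m n)
  case Nil
  then have "n < m - length (bt f) + length (tp f)"
    using len_pos[of f] by (auto simp del: length_greater_0_conv)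
  then show ?case using Nil by auto
next
  case (Cons a V)
  obtain k e where a: "a = (k, e)" by force
  have e: "e \<in> F" and V: "normal_word V" and st: "stays (k, e) V" using Cons.prems a by (auto simp del: length_greater_0_conv)
  note lp = len_pos[OF e] len_pos[OF \<open>f \<in> F\<close>] len_pos[OF \<open>g \<in> F\<close>]
  let ?m = "m - length (bt f) + length (tp f)"
  consider (r) "n \<ge> k + length (bt e)" | (c) "n < k + length (bt e)" "n = k" "e = iv f"
    | (s) "n < k + length (bt e)" "\<not> (n = k \<and> e = iv f)" by linarith
  then show ?case
  proof cases
    case r
    let ?n = "n - length (bt e) + length (tp e)" and ?m' = "m - length (bt e) + length (tp e)"
    have "push (m, g) (push (n, f) (a # V)) = a # push (?m', g) (push (?n, f) V)"
      using r Cons.prems lp by (simp add: a)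
    also have "push (?m', g) (push (?n, f) V) = push (?n, f) (push (?m' - length (bt f) + length (tp f), g) V)"
      using r Cons.prems V by (intro Cons.IH) auto
    also have "?m' - length (bt f) + length (tp f) = ?m - length (bt e) + length (tp e)"
      using r Cons.prems by (auto simp del: length_greater_0_conv)
    finally have *: "push (m, g) (push (n, f) (a # V))
        = a # push (?n, f) (push (?m - length (bt e) + length (tp e), g) V)" .
    have "k + length (bt e) \<le> ?m" using r Cons.prems by simp
    then have "push (?m, g) (a # V) = a # push (?m - length (bt e) + length (tp e), g) V"
      by (simp add: a)
    with r show ?thesis unfolding * by (simp add: a)
  next
    case c
    have "?m \<ge> k + length (bt e)" using c Cons.prems bt_iv[of f] by (auto simp del: length_greater_0_conv)
    moreover have "?m - length (bt e) + length (tp e) = m"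
      using c Cons.prems bt_iv[of f] tp_iv[of f] by (auto simp del: length_greater_0_conv)
    ultimately show ?thesis using c Cons.prems lp by (simp add: a)
  next
    case s
    have "push (n, f) (a # V) = (n, f) # a # V" using s by (auto simp: a)
    then have "push (m, g) (push (n, f) (a # V)) = (n, f) # push (?m, g) (a # V)"
      using Cons.prems by simp
    also have "\<dots> = push (n, f) (push (?m, g) (a # V))"
      using s Cons.prems by (intro push_stays[symmetric] stays_push) (auto simp: a)
    finally show ?thesis .
  qed
qed

abbreviation mul :: "(nat \<times> 'f) list \<Rightarrow> (nat \<times> 'f) list \<Rightarrow> (nat \<times> 'f) list" where
  "mul V U \<equiv> foldr push U V"

definition winv :: "(nat \<times> 'f) list \<Rightarrow> (nat \<times> 'f) list" where
  "winv V = rev (map (\<lambda>(n, f). (n, iv f)) V)"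

lemma normal_word_cells: "normal_word V \<Longrightarrow> snd ` set V \<subseteq> F"
  by (induction V) auto

lemma normal_word_mul: "normal_word V \<Longrightarrow> snd ` set U \<subseteq> F \<Longrightarrow> normal_word (mul V U)"
  by (induction U) (auto intro!: normal_word_push)

text \<open>Pushing a letter into \<open>U\<close> uses only the two relations, so it makes no difference for the action
  of \<open>U\<close> on normal words. This gives the associativity of the multiplication.\<close>

lemma mul_push: "normal_word V \<Longrightarrow> snd a \<in> F \<Longrightarrow> snd ` set U \<subseteq> F \<Longrightarrow> mul V (push a U) = push a (mul V U)"
proof (induction a U rule: push.induct)
  case (2 m g n f U)
  have *: "normal_word (mul V U)" by (rule normal_word_mul) (use 2 in auto)
  show ?case
  proof (cases "m \<ge> n + length (bt f)")
    case True
    then show ?thesis using 2 push_exchange[OF *] by simp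
  next
    case False
    then show ?thesis using 2 push_inv'[OF *] by auto
  qed
qed auto

lemma mul_cells: "snd ` set V \<subseteq> F \<Longrightarrow> snd ` set U \<subseteq> F \<Longrightarrow> snd ` set (mul V U) \<subseteq> F"
proof (induction U)
  case (Cons b U)
  then have "insert (snd b) (snd ` set (mul V U)) \<subseteq> F" by simp
  then show ?case using order_trans[OF push_cells[of b "mul V U"]] by simp
qed auto

lemma mul_mul: "normal_word V \<Longrightarrow> snd ` set U \<subseteq> F \<Longrightarrow> snd ` set W \<subseteq> F \<Longrightarrow> mul V (mul U W) = mul (mul V U) W"
proof (induction W)
  case (Cons a W)
  have "snd ` set (mul U W) \<subseteq> F" using Cons.prems by (intro mul_cells) auto
  then show ?case using Cons by (simp add: mul_push)
qed auto

lemma mul_Nil: "normal_word V \<Longrightarrow> mul [] V = V"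
  by (induction V) (auto simp: push_stays)

lemma mul_winv: "normal_word V \<Longrightarrow> snd ` set U \<subseteq> F \<Longrightarrow> mul (mul V U) (winv U) = V"
proof (induction U)
  case (Cons a U)
  obtain n f where a: "a = (n, f)" by force
  have "mul (mul V (a # U)) (winv (a # U)) = mul (push (n, iv f) (push (n, f) (mul V U))) (winv U)"
    by (simp add: winv_def a)
  also have "\<dots> = mul (mul V U) (winv U)"
    using Cons.prems a by (subst push_inv) (auto intro!: normal_word_mul)
  finally show ?case using Cons by simp
qed (simp add: winv_def)

lemma winv_cells: "snd ` set U \<subseteq> F \<Longrightarrow> snd ` set (winv U) \<subseteq> F"
  using iv_in by (auto simp: winv_def)

lemma winv_winv: "snd ` set U \<subseteq> F \<Longrightarrow> winv (winv U) = U"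
  by (induction U) (auto simp: winv_def iv_iv)

lemma mul_winv': "normal_word V \<Longrightarrow> snd ` set U \<subseteq> F \<Longrightarrow> mul (mul V (winv U)) U = V"
  using mul_winv[of V "winv U"] by (simp add: winv_cells winv_winv)

subsection \<open>Endpoints\<close>

definition step :: "'e list \<Rightarrow> nat \<times> 'f \<Rightarrow> 'e list \<Rightarrow> bool" where
  "step u a v \<longleftrightarrow> (\<exists>p q. u = p @ tp (snd a) @ q \<and> length p = fst a \<and> v = p @ bt (snd a) @ q)"

fun runs :: "'e list \<Rightarrow> (nat \<times> 'f) list \<Rightarrow> 'e list \<Rightarrow> bool" where
  "runs u [] v \<longleftrightarrow> u = v"
| "runs u (a # V) v \<longleftrightarrow> (\<exists>x. runs u V x \<and> step x a v)"

lemma step_inv: "step u (n, f) v \<Longrightarrow> f \<in> F \<Longrightarrow> step v (n, iv f) u"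
  using tp_iv bt_iv by (auto simp: step_def)

lemma step_det: "step u a v \<Longrightarrow> step u a v' \<Longrightarrow> v = v'"
  by (auto simp: step_def)

lemma runs_append: "runs u (V @ U) v \<longleftrightarrow> (\<exists>x. runs u U x \<and> runs x V v)"
  by (induction V arbitrary: v) auto

lemma runs_winv: "runs u V v \<Longrightarrow> snd ` set V \<subseteq> F \<Longrightarrow> runs v (winv V) u"
proof (induction V arbitrary: v)
  case (Cons a V)
  obtain n f where "a = (n, f)" by force
  then obtain x where "runs u V x" "step x (n, f) v" using Cons by auto
  moreover have "step v (n, iv f) x" using calculation(2) Cons \<open>a = (n, f)\<close> by (intro step_inv) auto
  ultimately show ?case using Cons \<open>a = (n, f)\<close> by (auto simp: winv_def runs_append)
qed (auto simp: winv_def)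

text \<open>The letter \<open>(m, g)\<close> can be moved before \<open>(n, f)\<close> without changing where the 2-path leads.\<close>

lemma step_exchange:
  assumes "step x (n, f) y" "step y (m, g) z" "m \<ge> n + length (bt f)"
  shows "\<exists>y'. step x (m - length (bt f) + length (tp f), g) y' \<and> step y' (n, f) z"
proof -
  obtain p q where 1: "x = p @ tp f @ q" "length p = n" "y = p @ bt f @ q"
    using assms(1) by (auto simp: step_def)
  obtain p' q' where 2: "y = p' @ tp g @ q'" "length p' = m" "z = p' @ bt g @ q'"
    using assms(2) by (auto simp: step_def)
  have "(p @ bt f) @ q = p' @ (tp g @ q')" using 1 2 by simp
  moreover have "length (p @ bt f) \<le> length p'" using assms(3) 1 2 by simp
  ultimately obtain r where r: "p' = p @ bt f @ r" "q = r @ tp g @ q'"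
    by (auto simp: append_eq_append_conv2)
  have "step x (m - length (bt f) + length (tp f), g) (p @ tp f @ r @ bt g @ q')"
    unfolding step_def by (rule exI[of _ "p @ tp f @ r"], rule exI[of _ q']) (use 1 2 r in auto)
  moreover have "step (p @ tp f @ r @ bt g @ q') (n, f) z"
    unfolding step_def by (rule exI[of _ p], rule exI[of _ "r @ bt g @ q'"]) (use 1 2 r in auto)
  ultimately show ?thesis by blast
qed

lemma runs_push: "runs u V x \<Longrightarrow> step x a y \<Longrightarrow> snd ` set V \<subseteq> F \<Longrightarrow> snd a \<in> F \<Longrightarrow> runs u (push a V) y"
proof (induction a V arbitrary: x y rule: push.induct)
  case (2 m g n f V)
  obtain z where z: "runs u V z" "step z (n, f) x" using 2 by auto
  consider "m \<ge> n + length (bt f)" | "m < n + length (bt f)" "m = n" "f = iv g"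
    | "m < n + length (bt f)" "\<not> (m = n \<and> f = iv g)" by linarith
  then show ?case
  proof cases
    case 1
    then show ?thesis using step_exchange[OF z(2) 2(3) 1] z 2 by auto
  next
    case 2
    have "step z (m, iv g) x" using z 2 by simp
    then have "step x (m, g) z" using step_inv[of z m "iv g" x] iv_iv iv_in \<open>snd (m, g) \<in> F\<close> by simp
    then have "z = y" using \<open>step x (m, g) y\<close> step_det by blast
    then show ?thesis using 2 z by simp
  next
    case 3
    then show ?thesis using 2 by auto
  qed
qed auto

lemma runs_mul: "runs u V x \<Longrightarrow> runs x U y \<Longrightarrow> normal_word V \<Longrightarrow> snd ` set U \<subseteq> F \<Longrightarrow> runs u (mul V U) y"
proof (induction U arbitrary: y)
  case (Cons a U)
  then obtain z where z: "runs x U z" "step z a y" by auto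
  have "runs u (mul V U) z" using Cons z by auto
  then have "runs u (push a (mul V U)) y"
    by (rule runs_push[OF _ z(2) normal_word_cells[OF normal_word_mul]]) (use Cons in auto)
  then show ?case by simp
qed auto

text \<open>Two 1-paths lie in the same component of the Squier complex.\<close>

definition conn :: "'e list \<Rightarrow> 'e list \<Rightarrow> bool" where
  "conn u v \<longleftrightarrow> (\<exists>V. normal_word V \<and> runs u V v)"

lemma connI: "runs u V v \<Longrightarrow> snd ` set V \<subseteq> F \<Longrightarrow> conn u v"
  unfolding conn_def using runs_mul[of u "[]" u V v] normal_word_mul[of "[]" V] by auto

lemma conn_refl [simp]: "conn u u"
  unfolding conn_def by (rule exI[of _ "[]"]) simp

lemma conn_sym: "conn u v \<Longrightarrow> conn v u"
  unfolding conn_def using runs_winv normal_word_cells winv_cells connI[unfolded conn_def] by meson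

lemma conn_trans: "conn u v \<Longrightarrow> conn v x \<Longrightarrow> conn u x"
  unfolding conn_def by (meson runs_mul normal_word_mul normal_word_cells)

lemma step_ctxt: "step u (n, f) v \<Longrightarrow> step (p @ u @ q) (length p + n, f) (p @ v @ q)"
  unfolding step_def by (metis append.assoc fst_conv length_append snd_conv)

lemma conn_step: "f \<in> F \<Longrightarrow> conn (p @ tp f @ q) (p @ bt f @ q)"
  by (rule connI[of _ "[(length p, f)]"]) (auto simp: step_def)

lemma conn_ctxt: "conn u v \<Longrightarrow> conn (p @ u @ q) (p @ v @ q)"
proof -
  have "runs u V v \<Longrightarrow> snd ` set V \<subseteq> F \<Longrightarrow> conn (p @ u @ q) (p @ v @ q)" for V
  proof (induction V arbitrary: v)
    case (Cons a V)
    then obtain x where x: "runs u V x" "step x a v" by auto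
    obtain n f where a: "a = (n, f)" by force
    have "conn (p @ x @ q) (p @ v @ q)"
      using Cons.prems step_ctxt[of x n f v p q] x a by (intro connI[of _ "[(length p + n, f)]"]) auto
    then show ?case using Cons x conn_trans by fastforce
  qed auto
  then show "conn u v \<Longrightarrow> ?thesis" unfolding conn_def using normal_word_cells by blast
qed

end

section \<open>The universal cover of the Squier complex and its contraction\<close>

text \<open>A cube is written as a word in edges (\<open>Inl\<close>) and negative cells (\<open>Inr\<close>), where \<open>\<epsilon>(u)\<close> is
  the word of the edges of \<open>u\<close>. Concatenation of thin diagrams becomes concatenation of lists and
  all constructions can follow the cube letter by letter from the left.\<close>

abbreviation ed :: "'e list \<Rightarrow> ('e + 'f) list" where "ed \<equiv> map Inl"

definition cell_count :: "('e + 'f) list \<Rightarrow> nat" where "cell_count c = length (filter (\<lambda>x. \<not> isl x) c)"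

definition cell_set :: "('e + 'f) list \<Rightarrow> 'f set" where "cell_set c = {f. Inr f \<in> set c}"

lemma cell_count_simps [simp]: "cell_count [] = 0" "cell_count (Inl e # c) = cell_count c" "cell_count (Inr f # c) = Suc (cell_count c)"
  "cell_count (c @ c') = cell_count c + cell_count c'" "cell_count (ed p) = 0"
  by (auto simp: cell_count_def filter_empty_conv)

lemma cell_set_simps [simp]: "cell_set [] = {}" "cell_set (Inl e # c) = cell_set c" "cell_set (Inr f # c) = insert f (cell_set c)"
  "cell_set (c @ c') = cell_set c \<union> cell_set c'" "cell_set (ed p) = {}"
  by (auto simp: cell_set_def)

lemma cube_split: "\<exists>p c'. c = ed p @ c' \<and> (c' = [] \<or> (\<exists>f r. c' = Inr f # r))"
proof (induction c)
  case (Cons x c)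
  then obtain p c' where c: "c = ed p @ c' \<and> (c' = [] \<or> (\<exists>f r. c' = Inr f # r))" by blast
  show ?case
  proof (cases x)
    case (Inl e)
    then show ?thesis using c by (intro exI[of _ "e # p"]) auto
  next
    case (Inr f)
    then show ?thesis by (intro exI[of _ "[]"] exI[of _ "x # c"]) simp
  qed
qed auto

lemma list_all_isl_take: "list_all isl (take m (ed p @ Inr f # r)) \<longleftrightarrow> m \<le> length p"
proof (induction p arbitrary: m)
  case Nil
  then show ?case by (cases m) auto
next
  case (Cons e p)
  then show ?case by (cases m) auto
qed

definition prefix :: "('e + 'f) list \<Rightarrow> ('w \<times> ('e + 'f) list \<Rightarrow>\<^sub>0 int) \<Rightarrow> ('w \<times> ('e + 'f) list \<Rightarrow>\<^sub>0 int)" where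
  "prefix a x = frag_extend (\<lambda>q. frag_of (fst q, a @ snd q)) x"

lemma prefix_lin [simp]: "prefix a 0 = 0" "prefix a (x - y) = prefix a x - prefix a y" "prefix a (x + y) = prefix a x + prefix a y"
  "prefix a (- x) = - prefix a x"
  by (simp_all add: prefix_def lin)

lemma prefix_of [simp]: "prefix a (frag_of q) = frag_of (fst q, a @ snd q)"
  by (simp add: prefix_def)

lemma prefix_prefix [simp]: "prefix a (prefix b x) = prefix (a @ b) x"
  by (simp add: prefix_def frag_extend_frag_extend)

lemma frag_extend_prefix: "frag_extend f (prefix a x) = frag_extend (\<lambda>q. f (fst q, a @ snd q)) x"
  by (simp add: prefix_def frag_extend_frag_extend)

lemma prefix_frag_extend: "prefix a (frag_extend f x) = frag_extend (\<lambda>q. prefix a (f q)) x"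
  by (simp add: prefix_def frag_extend_frag_extend)

lemma prefix_Nil [simp]: "prefix [] x = x"
  by (simp add: prefix_def)

context cell_system
begin

text \<open>A cube of the universal cover is a pair \<open>(V, c)\<close> where the word \<open>V\<close> leads to the top of \<open>c\<close>, the
  vertex of \<open>c\<close> in which every cell shows its top. Bottom faces have another top, which is reached
  by pushing the collapsed cell into \<open>V\<close>. The parameter \<open>k\<close> of \<open>cover_bd\<close> is the offset of \<open>c\<close> in
  the whole cube, of which \<open>c\<close> is the part still to be processed.\<close>

fun cube_top :: "('e + 'f) list \<Rightarrow> 'e list" where
  "cube_top [] = []"
| "cube_top (Inl e # c) = e # cube_top c"
| "cube_top (Inr f # c) = tp f @ cube_top c"

lemma cube_top_append [simp]: "cube_top (c @ c') = cube_top c @ cube_top c'"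
  by (induction c rule: cube_top.induct) auto

lemma cube_top_ed [simp]: "cube_top (ed p) = p"
  by (induction p) auto

fun cover_bd :: "nat \<Rightarrow> (nat \<times> 'f) list \<Rightarrow> ('e + 'f) list \<Rightarrow> ((nat \<times> 'f) list \<times> ('e + 'f) list \<Rightarrow>\<^sub>0 int)" where
  "cover_bd k V [] = 0"
| "cover_bd k V (Inl e # c) = prefix [Inl e] (cover_bd (Suc k) V c)"
| "cover_bd k V (Inr f # c) = frag_of (V, ed (tp f) @ c) - frag_of (push (k, f) V, ed (bt f) @ c)
     - prefix [Inr f] (cover_bd (k + length (tp f)) V c)"

definition ext_cover_bd where "ext_cover_bd k x = frag_extend (\<lambda>q. cover_bd k (fst q) (snd q)) x"

lemma ext_cover_bd_lin [simp]: "ext_cover_bd k 0 = 0" "ext_cover_bd k (x - y) = ext_cover_bd k x - ext_cover_bd k y" "ext_cover_bd k (x + y) = ext_cover_bd k x + ext_cover_bd k y"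
  "ext_cover_bd k (- x) = - ext_cover_bd k x"
  by (simp_all add: ext_cover_bd_def lin)

lemma ext_cover_bd_of [simp]: "ext_cover_bd k (frag_of q) = cover_bd k (fst q) (snd q)"
  by (simp add: ext_cover_bd_def)

lemma cover_bd_ed: "cover_bd k V (ed p @ c) = prefix (ed p) (cover_bd (k + length p) V c)"
  by (induction p arbitrary: k) auto

definition push_chain where "push_chain a x = frag_extend (\<lambda>q. frag_of (push a (fst q), snd q)) x"

lemma push_chain_prefix: "push_chain a (prefix b x) = prefix b (push_chain a x)"
  by (simp add: push_chain_def prefix_def frag_extend_frag_extend)

lemma push_chain_simps [simp]: "push_chain a 0 = 0" "push_chain a (x - y) = push_chain a x - push_chain a y" "push_chain a (frag_of q) = frag_of (push a (fst q), snd q)"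
  by (simp_all add: push_chain_def lin)

text \<open>The cell \<open>f\<close> lies to the left of \<open>c\<close>, so it is exchanged with all cells of \<open>c\<close>.\<close>

lemma push_chain_cover_bd:
  assumes "normal_word V" "f \<in> F" "cell_set c \<subseteq> F"
  shows "push_chain (k, f) (cover_bd (k + length (tp f) + j) V c) = cover_bd (k + length (bt f) + j) (push (k, f) V) c"
  using assms(3)
proof (induction c arbitrary: j rule: cube_top.induct)
  case (2 e c)
  then show ?case using 2(1)[of "Suc j"] by (simp add: push_chain_prefix)
next
  case (3 g c)
  have "push (k + length (bt f) + j, g) (push (k, f) V) = push (k, f) (push (k + length (tp f) + j, g) V)"
    using push_exchange[of V f g k "k + length (bt f) + j"] assms 3 by (simp add: algebra_simps)
  then show ?case using 3(1)[of "j + length (tp g)"] 3(2) by (simp add: push_chain_prefix add.assoc)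
qed auto

lemma ext_cover_bd_prefix_ed: "ext_cover_bd k (prefix (ed p) x) = prefix (ed p) (ext_cover_bd (k + length p) x)"
  by (simp add: ext_cover_bd_def frag_extend_prefix prefix_frag_extend cover_bd_ed)

lemma ext_cover_bd_prefix_Inr: "ext_cover_bd k (prefix [Inr f] x) = prefix (ed (tp f)) x - prefix (ed (bt f)) (push_chain (k, f) x)
    - prefix [Inr f] (ext_cover_bd (k + length (tp f)) x)"
  by (simp add: ext_cover_bd_def frag_extend_prefix prefix_frag_extend lin_fun push_chain_def) (simp add: prefix_def)

text \<open>Collapsing the leftmost cell to its bottom and then taking the boundary of the rest is, by the
  previous lemma, the same in the other order; the two contributions cancel.\<close>

lemma cover_bd_cover_bd: "normal_word V \<Longrightarrow> cell_set c \<subseteq> F \<Longrightarrow> ext_cover_bd k (cover_bd k V c) = 0"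
proof (induction c arbitrary: k rule: cube_top.induct)
  case (2 e c)
  then show ?case using ext_cover_bd_prefix_ed[of k "[e]"] by simp
next
  case (3 f c)
  then show ?case using push_chain_cover_bd[of V f c k 0]
    by (simp add: ext_cover_bd_prefix_Inr cover_bd_ed)
qed auto

definition mul_chain where "mul_chain U x = frag_extend (\<lambda>q. frag_of (mul U (fst q), snd q)) x"

lemma mul_chain_prefix: "mul_chain a (prefix b x) = prefix b (mul_chain a x)"
  by (simp add: mul_chain_def prefix_def frag_extend_frag_extend)

lemma mul_chain_simps [simp]: "mul_chain a 0 = 0" "mul_chain a (x - y) = mul_chain a x - mul_chain a y" "mul_chain a (frag_of q) = frag_of (mul a (fst q), snd q)"
  by (simp_all add: mul_chain_def lin)

text \<open>The boundary commutes with the action of the group on the left.\<close>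

lemma mul_chain_cover_bd: "normal_word U \<Longrightarrow> snd ` set V \<subseteq> F \<Longrightarrow> cell_set c \<subseteq> F \<Longrightarrow> mul_chain U (cover_bd k V c) = cover_bd k (mul U V) c"
  by (induction c arbitrary: k rule: cube_top.induct) (auto simp: mul_chain_prefix mul_push)

text \<open>What matters about a face of \<open>(V, c)\<close>, apart from its dimension and its cells: its word differs from \<open>V\<close> at most by a letter pushed
  in at or beyond the offset \<open>k\<close>, and it leads to the top of the face.\<close>

definition face_set where "face_set k V c = {(V', c'). (V' = V \<or> (\<exists>m g. m \<ge> k \<and> g \<in> cell_set c \<and> V' = push (m, g) V))
   \<and> Suc (cell_count c') = cell_count c \<and> cell_set c' \<subseteq> cell_set c
   \<and> (\<forall>w p. runs w V (p @ cube_top c) \<longrightarrow> length p = k \<longrightarrow> runs w V' (p @ cube_top c'))}"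

lemma prefix_in_chains: "x \<in> chains A \<Longrightarrow> (\<And>V' c'. (V', c') \<in> A \<Longrightarrow> (V', a @ c') \<in> A') \<Longrightarrow> prefix a x \<in> chains A'"
  unfolding prefix_def by (erule frag_extend_in_chains) auto

lemma cover_bd_in_face_set: "snd ` set V \<subseteq> F \<Longrightarrow> cell_set c \<subseteq> F \<Longrightarrow> cover_bd k V c \<in> chains (face_set k V c)"
proof (induction c arbitrary: k rule: cube_top.induct)
  case (2 e c)
  have "cover_bd (Suc k) V c \<in> chains (face_set (Suc k) V c)" using 2 by simp
  then have "prefix [Inl e] (cover_bd (Suc k) V c) \<in> chains (face_set k V (Inl e # c))"
  proof (rule prefix_in_chains)
    fix V' c' assume a: "(V', c') \<in> face_set (Suc k) V c"
    have "runs w V' (p @ cube_top (Inl e # c'))" if "runs w V (p @ cube_top (Inl e # c))" "length p = k" for w p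
    proof -
      have "runs w V ((p @ [e]) @ cube_top c)" "length (p @ [e]) = Suc k" using that by auto
      then have "runs w V' ((p @ [e]) @ cube_top c')" using a unfolding face_set_def by blast
      then show ?thesis by simp
    qed
    moreover have "V' = V \<or> (\<exists>m g. m \<ge> k \<and> g \<in> cell_set c \<and> V' = push (m, g) V)"
      using a unfolding face_set_def by (auto dest: Suc_leD)
    ultimately show "(V', [Inl e] @ c') \<in> face_set k V (Inl e # c)"
      using a unfolding face_set_def by simp
  qed
  then show ?case by simp
next
  case (3 f c)
  have f: "f \<in> F" using 3 by simp
  have "cover_bd (k + length (tp f)) V c \<in> chains (face_set (k + length (tp f)) V c)" using 3 by simp
  then have A: "prefix [Inr f] (cover_bd (k + length (tp f)) V c) \<in> chains (face_set k V (Inr f # c))"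
  proof (rule prefix_in_chains)
    fix V' c' assume a: "(V', c') \<in> face_set (k + length (tp f)) V c"
    have "runs w V' (p @ cube_top (Inr f # c'))" if "runs w V (p @ cube_top (Inr f # c))" "length p = k" for w p
    proof -
      have "runs w V ((p @ tp f) @ cube_top c)" "length (p @ tp f) = k + length (tp f)" using that by auto
      then have "runs w V' ((p @ tp f) @ cube_top c')" using a unfolding face_set_def by blast
      then show ?thesis by simp
    qed
    moreover have "V' = V \<or> (\<exists>m g. m \<ge> k \<and> g \<in> cell_set c \<and> V' = push (m, g) V)"
      using a unfolding face_set_def by (auto dest: add_leD1)
    then have "V' = V \<or> (\<exists>m g. m \<ge> k \<and> g \<in> cell_set (Inr f # c) \<and> V' = push (m, g) V)"
      by auto
    ultimately show "(V', [Inr f] @ c') \<in> face_set k V (Inr f # c)"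
      using a unfolding face_set_def by (simp, blast)
  qed
  have "runs w (push (k, f) V) (p @ cube_top (ed (bt f) @ c))"
    if "runs w V (p @ cube_top (Inr f # c))" "length p = k" for w p
    by (rule runs_push[OF that(1) _ 3(2)]) (use that f in \<open>auto simp: step_def\<close>)
  then have B: "(push (k, f) V, ed (bt f) @ c) \<in> face_set k V (Inr f # c)"
    unfolding face_set_def by auto
  have C: "(V, ed (tp f) @ c) \<in> face_set k V (Inr f # c)"
    unfolding face_set_def by auto
  show ?case using A B C by simp
qed auto

text \<open>The cube \<open>p + g + r\<close> based at the word that leads to the side \<open>tp g\<close>, for a cell \<open>g\<close> of either
  sign. If \<open>g\<close> is positive, the cube proper contains the inverse of \<open>g\<close>, starts from the other side
  of \<open>g\<close>, and is counted with the opposite sign.\<close>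

definition cell_cube where "cell_cube p g x = frag_extend (\<lambda>q. if g \<in> N then frag_of (fst q, ed p @ Inr g # snd q)
   else - frag_of (push (length p, g) (fst q), ed p @ Inr (iv g) # snd q)) x"

lemma cell_cube_N: "g \<in> N \<Longrightarrow> cell_cube p g x = prefix (ed p) (prefix [Inr g] x)"
  by (simp add: cell_cube_def prefix_def frag_extend_frag_extend)

lemma cell_cube_notN: "g \<notin> N \<Longrightarrow> cell_cube p g x = - prefix (ed p) (prefix [Inr (iv g)] (push_chain (length p, g) x))"
  by (simp add: cell_cube_def prefix_def push_chain_def frag_extend_frag_extend lin_fun)

text \<open>With that convention the boundary has the same form for both signs of \<open>g\<close>.\<close>

lemma ext_cover_bd_cell_cube:
  assumes "normal_word V" "g \<in> F" "cell_set r \<subseteq> F"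
  shows "ext_cover_bd 0 (cell_cube p g (frag_of (V, r))) = frag_of (V, ed p @ ed (tp g) @ r)
    - frag_of (push (length p, g) V, ed p @ ed (bt g) @ r) - cell_cube p g (cover_bd (length p + length (tp g)) V r)"
proof (cases "g \<in> N")
  case True
  then show ?thesis by (simp add: cell_cube_N cover_bd_ed)
next
  case False
  have "push_chain (length p, g) (cover_bd (length p + length (tp g)) V r) = cover_bd (length p + length (bt g)) (push (length p, g) V) r"
    using push_chain_cover_bd[OF assms, of "length p" 0] by simp
  then show ?thesis using False assms push_inv[of V g "length p"]
    by (simp add: cell_cube_notN cover_bd_ed tp_iv bt_iv del: push.simps)
qed

text \<open>The contraction. If \<open>g\<close> is the last letter of the word and all cells of the cube lie to the right
  of \<open>g\<close>, the cube is swept along \<open>g\<close>, and the cube at the other side of \<open>g\<close> is treated in the same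
  way. The test looks only at the letters of \<open>c\<close> up to the end of the bottom of \<open>g\<close>, which have to
  be edges; a vertex always passes it.\<close>

fun cover_fill :: "(nat \<times> 'f) list \<Rightarrow> ('e + 'f) list \<Rightarrow> ((nat \<times> 'f) list \<times> ('e + 'f) list \<Rightarrow>\<^sub>0 int)" where
  "cover_fill [] c = 0"
| "cover_fill ((n, g) # V) c = (if list_all isl (take (n + length (bt g)) c)
     then cover_fill V (take n c @ ed (tp g) @ drop (n + length (bt g)) c)
       - cell_cube (map projl (take n c)) g (frag_of (V, drop (n + length (bt g)) c))
     else 0)"

definition ext_cover_fill where "ext_cover_fill x = frag_extend (\<lambda>q. cover_fill (fst q) (snd q)) x"

lemma cover_fill_right: "length p = n \<Longrightarrow> cover_fill ((n, g) # V) (ed p @ ed (bt g) @ r)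
    = cover_fill V (ed p @ ed (tp g) @ r) - cell_cube p g (frag_of (V, r))"
  by (auto simp: list_all_iff comp_def)

lemma cover_fill_bound: "bound (length p) V \<Longrightarrow> cover_fill V (ed p @ Inr f # r) = 0"
  by (cases V) (auto simp: list_all_isl_take simp del: take_append)

lemma ext_cover_fill_simps [simp]: "ext_cover_fill 0 = 0" "ext_cover_fill (x - y) = ext_cover_fill x - ext_cover_fill y" "ext_cover_fill (x + y) = ext_cover_fill x + ext_cover_fill y"
   "ext_cover_fill (frag_of q) = cover_fill (fst q) (snd q)"
  by (simp_all add: ext_cover_fill_def lin)

text \<open>If the leftmost cell \<open>f\<close> of the cube does not lie to the right of the last letter of \<open>V\<close>, the
  same holds for all faces that keep \<open>f\<close>, and these contribute nothing. Of the two faces that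
  collapse \<open>f\<close>, one is based at a word that is longer by the letter \<open>f\<close> than the word of the other,
  so that their sweeps differ by exactly the given cube. Which of the two faces this is depends on
  whether \<open>f\<close> cancels the last letter of \<open>V\<close>.\<close>

lemma contraction_left:
  assumes V: "normal_word V" and b: "bound (length p) V" and f: "f \<in> N" and r: "cell_set r \<subseteq> F"
  shows "ext_cover_fill (cover_bd 0 V (ed p @ Inr f # r)) = frag_of (V, ed p @ Inr f # r)"
proof -
  have fF: "f \<in> F" using f N_F by auto
  let ?X = "cover_bd (length p + length (tp f)) V r"
  have "?X \<in> chains (face_set (length p + length (tp f)) V r)"
    by (rule cover_bd_in_face_set[OF normal_word_cells[OF V] r])
  then have "ext_cover_fill (prefix (ed p @ [Inr f]) ?X) = frag_extend (\<lambda>q. 0) ?X"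
    unfolding ext_cover_fill_def frag_extend_prefix
  proof (rule frag_extend_cong_on)
    fix q assume q: "q \<in> face_set (length p + length (tp f)) V r"
    then have "bound (length p) (fst q)"
      using b bound_push[OF V b] r by (auto simp: face_set_def)
    then show "cover_fill (fst (fst q, (ed p @ [Inr f]) @ snd q)) (snd (fst q, (ed p @ [Inr f]) @ snd q)) = 0"
      by (simp add: cover_fill_bound)
  qed
  then have 0: "ext_cover_fill (prefix (ed p @ [Inr f]) ?X) = 0" by simp
  have "ext_cover_fill (cover_bd 0 V (ed p @ Inr f # r)) = cover_fill V (ed p @ ed (tp f) @ r)
      - cover_fill (push (length p, f) V) (ed p @ ed (bt f) @ r)"
    using 0 by (simp add: cover_bd_ed)
  also have "\<dots> = frag_of (V, ed p @ Inr f # r)"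
  proof (cases "stays (length p, f) V")
    case True
    have "cover_fill (push (length p, f) V) (ed p @ ed (bt f) @ r) = cover_fill V (ed p @ ed (tp f) @ r) - cell_cube p f (frag_of (V, r))"
      unfolding push_stays[OF True] by (rule cover_fill_right) simp
    then show ?thesis using f by (simp add: cell_cube_N)
  next
    case False
    then obtain g V' where V': "V = (length p, g) # V'" "g = iv f"
      using b by (cases V) auto
    have g: "g \<in> F" "f = iv g" "g \<notin> N" "bt g = tp f" "tp g = bt f"
      using V' fF iv_in[of f] iv_iv[of f] N_iv[of f] f bt_iv[of f] tp_iv[of f] by auto
    have i: "push (length p, f) V = V'" using g(1,2) V'(1) len_pos(2)[of g] iv_iv[of g] by auto
    have st: "push (length p, g) V' = V" using V V'(1) by (auto simp: push_stays)
    have "cover_fill V (ed p @ ed (bt g) @ r) = cover_fill V' (ed p @ ed (tp g) @ r) - cell_cube p g (frag_of (V', r))"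
      unfolding V'(1) by (rule cover_fill_right) simp
    then show ?thesis unfolding i using g st by (simp add: cell_cube_notN)
  qed
  finally show ?thesis .
qed

lemma take_isl: "list_all isl (take m c) \<Longrightarrow> m \<le> length (cube_top c) \<Longrightarrow> c = ed (take m (cube_top c)) @ drop m c"
proof (induction c arbitrary: m rule: cube_top.induct)
  case (2 e c)
  then show ?case by (cases m) auto
next
  case (3 f c)
  then show ?case by (cases m) auto
qed auto

text \<open>The induction is on the length of the word. If the cube lies to the right of the last letter
  \<open>g\<close>, then so do all its faces, and each of their words still ends with \<open>g\<close>; hence the sweep of
  the boundary is the boundary of the sweep, up to the two ends. Otherwise the previous lemma
  applies.\<close>

theorem contraction:
  assumes "normal_word V" "runs w V (cube_top c)" "cell_set c \<subseteq> N"
  shows "ext_cover_bd 0 (cover_fill V c) + ext_cover_fill (cover_bd 0 V c) = frag_of (V, c) - (if cell_count c = 0 then frag_of ([], ed w) else 0)"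
  using assms
proof (induction V arbitrary: c)
  case Nil
  obtain p c' where c: "c = ed p @ c'" and c': "c' = [] \<or> (\<exists>f r. c' = Inr f # r)"
    using cube_split by blast
  show ?case
  proof (cases "c' = []")
    case True
    then show ?thesis using Nil c cover_bd_ed[of 0 "[]" p "[]"] by simp
  next
    case False
    then obtain f r where fr: "c' = Inr f # r" using c' by auto
    then show ?thesis using Nil c contraction_left[of "[]" p f r] N_F by auto
  qed
next
  case (Cons a V)
  obtain n g where a: "a = (n, g)" by force
  have V: "normal_word V" and g: "g \<in> F" and st: "stays (n, g) V" using Cons.prems a by auto
  have cF: "cell_set c \<subseteq> F" using Cons.prems N_F by auto
  show ?case
  proof (cases "list_all isl (take (n + length (bt g)) c)")
    case True
    obtain p q x where pq: "cube_top c = p @ bt g @ q" "length p = n" "runs w V (p @ tp g @ q)"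
      using Cons.prems a by (auto simp: step_def)
    define r where "r = drop (n + length (bt g)) c"
    have c: "c = ed p @ ed (bt g) @ r"
      using take_isl[OF True] pq by (simp add: r_def)
    then have q: "cube_top r = q" using pq by simp
    let ?c = "ed p @ ed (tp g) @ r" and ?X = "cover_bd (n + length (tp g)) V r"
    have rF: "cell_set r \<subseteq> F" using cF c by simp
    have IH: "ext_cover_bd 0 (cover_fill V ?c) + ext_cover_fill (cover_bd 0 V ?c) = frag_of (V, ?c) - (if cell_count ?c = 0 then frag_of ([], ed w) else 0)"
      by (rule Cons.IH[OF V]) (use pq q Cons.prems c in auto)
    have d1: "cover_bd 0 V ?c = prefix (ed p @ ed (tp g)) ?X" using pq by (simp add: cover_bd_ed)
    have s: "cover_fill (a # V) c = cover_fill V ?c - cell_cube p g (frag_of (V, r))"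
      unfolding a c by (rule cover_fill_right[OF pq(2)])
    have dBr: "ext_cover_bd 0 (cell_cube p g (frag_of (V, r))) = frag_of (V, ?c) - frag_of (a # V, c) - cell_cube p g ?X"
      using ext_cover_bd_cell_cube[OF V g rF, of p] pq push_stays[OF st] a c by simp
    have X: "?X \<in> chains (face_set (n + length (tp g)) V r)"
      by (rule cover_bd_in_face_set[OF normal_word_cells[OF V] rF])
    have "cover_bd 0 (a # V) c = prefix (ed p @ ed (bt g)) (push_chain (n, g) ?X)"
      using push_chain_cover_bd[OF V g rF, of n 0] push_stays[OF st] pq a c by (simp add: cover_bd_ed)
    then have "ext_cover_fill (cover_bd 0 (a # V) c)
        = frag_extend (\<lambda>q. cover_fill (push (n, g) (fst q)) (ed p @ ed (bt g) @ snd q)) ?X"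
      by (simp add: ext_cover_fill_def frag_extend_prefix push_chain_def frag_extend_frag_extend)
    also have "\<dots> = frag_extend (\<lambda>q. cover_fill (fst q) (ed p @ ed (tp g) @ snd q) - cell_cube p g (frag_of q)) ?X"
    proof (rule frag_extend_cong_on[OF X])
      fix q assume q: "q \<in> face_set (n + length (tp g)) V r"
      have "stays (n, g) (fst q)"
        using q st stays_push[OF V st g] rF by (auto simp: face_set_def)
      then show "cover_fill (push (n, g) (fst q)) (ed p @ ed (bt g) @ snd q)
          = cover_fill (fst q) (ed p @ ed (tp g) @ snd q) - cell_cube p g (frag_of q)"
        using cover_fill_right[OF pq(2)] by (simp add: push_stays)
    qed
    also have "\<dots> = ext_cover_fill (prefix (ed p @ ed (tp g)) ?X) - cell_cube p g ?X"
      by (simp add: lin_fun ext_cover_fill_def frag_extend_prefix) (simp add: cell_cube_def)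
    finally have sd: "ext_cover_fill (cover_bd 0 (a # V) c) = ext_cover_fill (cover_bd 0 V ?c) - cell_cube p g ?X" unfolding d1 .
    have nc: "cell_count ?c = cell_count c" using c by simp
    show ?thesis unfolding sd s using IH dBr unfolding nc by (simp add: algebra_simps)
  next
    case False
    obtain p c' where c: "c = ed p @ c'" and c': "c' = [] \<or> (\<exists>f r. c' = Inr f # r)"
      using cube_split by blast
    have "list_all isl (take m (ed p))" for m by (auto simp: take_map list_all_iff)
    then obtain f r where fr: "c' = Inr f # r" using c c' False by auto
    have b: "bound (length p) (a # V)" using False c fr by (simp add: a list_all_isl_take del: take_append)
    have "cover_fill (a # V) c = 0" using False a by simp
    then show ?thesis using contraction_left[OF _ b, of f r] Cons.prems cF c fr by simp
  qed
qed

end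

section \<open>The bar resolution\<close>

context group
begin

definition bar_basis :: "nat \<Rightarrow> 'a list set" where
  "bar_basis n = {gs. length gs = n \<and> set gs \<subseteq> carrier G}"

definition bar_bd :: "'a list \<Rightarrow> ('a \<times> 'a list \<Rightarrow>\<^sub>0 int)" where
  "bar_bd gs = (\<Sum>i\<le>length gs. frag_cmul ((-1) ^ i)
     (frag_of (if i = 0 then hd gs else \<one>, bar_face (length gs) G i gs)))"

definition bar_fill :: "'a \<times> 'a list \<Rightarrow> ('a \<times> 'a list \<Rightarrow>\<^sub>0 int)" where
  "bar_fill x = frag_of (\<one>, fst x # snd x)"

lemma sum_in_chains: "(\<And>i. i \<in> I \<Longrightarrow> x i \<in> chains S) \<Longrightarrow> sum x I \<in> chains S"
  by (induction I rule: infinite_finite_induct) auto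

lemma set_bar_face:
  assumes "length gs = Suc n" "set gs \<subseteq> carrier G" "i \<le> Suc n"
  shows "bar_face (Suc n) G i gs \<in> bar_basis n"
proof -
  have "set (bar_face (Suc n) G i gs) \<subseteq> carrier G"
    unfolding bar_face_def using assms
    by (auto dest!: in_set_butlastD in_set_takeD in_set_dropD list.set_sel(2)[rotated]
        intro!: m_closed subsetD[OF assms(2) nth_mem])
  moreover have "length (bar_face (Suc n) G i gs) = n"
    unfolding bar_face_def using assms by auto
  ultimately show ?thesis by (simp add: bar_basis_def)
qed

lemma bar_bd_in: "gs \<in> bar_basis (Suc n) \<Longrightarrow> bar_bd gs \<in> chains (carrier G \<times> bar_basis n)"
proof -
  assume a: "gs \<in> bar_basis (Suc n)"
  then have l: "length gs = Suc n" "set gs \<subseteq> carrier G" by (auto simp: bar_basis_def)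
  then have "hd gs \<in> carrier G" by (cases gs) auto
  then show ?thesis unfolding bar_bd_def using set_bar_face[OF l] l by (intro sum_in_chains) auto
qed

lemma bar_face_Cons:
  assumes "length l = Suc n" "i \<le> Suc n"
  shows "bar_face (Suc (Suc n)) G (Suc i) (g # l)
    = (if i = 0 then (g \<otimes> hd l) # tl l else g # bar_face (Suc n) G i l)"
proof (cases l)
  case (Cons h t)
  then show ?thesis using assms by (cases i) (auto simp: bar_face_def)
qed (use assms in auto)

lemma bar_bd_Cons_Nil: "bar_bd [g] = frag_of (g, []) - frag_of (\<one>, [])"
  by (simp add: bar_bd_def bar_face_def)

text \<open>The contraction prepends the group coordinate to the symbol, which shifts the faces by one. In
  this form the lemma says at the same time that \<open>bar_fill\<close> is a contraction and how \<open>bar_bd\<close> can be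
  computed recursively.\<close>

lemma bar_bd_Cons:
  assumes l: "l \<in> bar_basis (Suc n)" and g: "g \<in> carrier G"
  shows "bar_bd (g # l) = frag_of (g, l) - frag_extend bar_fill (equiv_ext G bar_bd (frag_of (g, l)))"
proof -
  have len: "length l = Suc n" and lG: "set l \<subseteq> carrier G" using l by (auto simp: bar_basis_def)
  have "bar_bd (g # l) = frag_of (g, l) + (\<Sum>i\<le>Suc n. frag_cmul ((-1) ^ Suc i)
      (frag_of (\<one>, bar_face (Suc (Suc n)) G (Suc i) (g # l))))"
    unfolding bar_bd_def using len
    by (simp only: length_Cons sum.atMost_Suc_shift[of _ "Suc n"]) (simp add: bar_face_def)
  also have "(\<Sum>i\<le>Suc n. frag_cmul ((-1) ^ Suc i) (frag_of (\<one>, bar_face (Suc (Suc n)) G (Suc i) (g # l))))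
      = - (\<Sum>i\<le>Suc n. frag_cmul ((-1) ^ i) (frag_of (\<one>, (g \<otimes> (if i = 0 then hd l else \<one>)) # bar_face (Suc n) G i l)))"
    unfolding sum_negf[symmetric]
    by (intro sum.cong refl) (auto simp: bar_face_Cons[OF len] g bar_face_def[of _ _ 0])
  also have "(\<Sum>i\<le>Suc n. frag_cmul ((-1) ^ i) (frag_of (\<one>, (g \<otimes> (if i = 0 then hd l else \<one>)) # bar_face (Suc n) G i l)))
      = frag_extend bar_fill (equiv_ext G bar_bd (frag_of (g, l)))"
    by (auto simp: equiv_ext_def shift_def bar_bd_def len frag_extend_sum frag_extend_cmul bar_fill_def comp_def simp del: sum.atMost_Suc intro!: sum.cong)
  finally show ?thesis by simp
qed

lemma bar_basis_Suc: "x \<in> bar_basis (Suc n) \<longleftrightarrow> (\<exists>g l. x = g # l \<and> g \<in> carrier G \<and> l \<in> bar_basis n)"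
  by (cases x) (auto simp: bar_basis_def)

lemma equiv_ext_bar_bd_bar_fill:
  assumes "g \<in> carrier G" "l \<in> bar_basis n" shows "equiv_ext G bar_bd (bar_fill (g, l)) = bar_bd (g # l)"
  unfolding bar_fill_def using assms by (simp, intro equiv_ext_frag_of[of bar_bd, OF bar_bd_in[of _ n]]) (auto simp: bar_basis_Suc)

lemma aug_bar_bd: "gs \<in> bar_basis (Suc 0) \<Longrightarrow> aug (bar_bd gs) = 0"
  by (auto simp: bar_basis_def length_Suc_conv bar_bd_Cons_Nil aug_lin) (simp add: aug_def)

text \<open>Every symbol is a value of the contraction, and a contraction carries the vanishing of the
  squared boundary from one degree to the next.\<close>

lemma bar_bd_bd: "gs \<in> bar_basis (Suc (Suc n)) \<Longrightarrow> equiv_ext G bar_bd (bar_bd gs) = 0"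
proof (induction n arbitrary: gs)
  case 0
  then obtain g h where gs: "gs = [g, h]" "g \<in> carrier G" "h \<in> carrier G" "[h] \<in> bar_basis (Suc 0)"
    by (auto simp: bar_basis_Suc) (auto simp: bar_basis_def)
  have "equiv_ext G bar_bd (bar_bd gs) = equiv_ext G bar_bd (frag_of (g, [h])) - equiv_ext G bar_bd (frag_extend bar_fill (equiv_ext G bar_bd (frag_of (g, [h]))))"
    using bar_bd_Cons[OF gs(4,2)] gs by (simp add: equiv_ext_lin)
  also have "equiv_ext G bar_bd (frag_of (g, [h])) = frag_of (g \<otimes> h, []) - frag_of (g, [])"
    using gs by (simp add: equiv_ext_def bar_bd_Cons_Nil shift_lin) (simp add: shift_def)
  finally show ?case using gs
    by (simp add: lin equiv_ext_lin bar_fill_def) (simp add: equiv_ext_def bar_bd_Cons_Nil shift_lin, simp add: shift_def)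
next
  case (Suc n)
  then obtain g l where gs: "gs = g # l" "g \<in> carrier G" "l \<in> bar_basis (Suc (Suc n))"
    by (auto simp: bar_basis_Suc)
  let ?x = "frag_of (g, l)"
  have x: "?x \<in> chains (carrier G \<times> bar_basis (Suc (Suc n)))" using gs by auto
  let ?y = "equiv_ext G bar_bd ?x"
  have y: "?y \<in> chains (carrier G \<times> bar_basis (Suc n))" by (rule equiv_ext_in_chains[OF x bar_bd_in])
  have Dy: "equiv_ext G bar_bd ?y = 0"
    using Suc.IH[OF gs(3)] gs by (simp add: equiv_ext_equiv_ext[OF x bar_bd_in bar_bd_in]) (simp add: equiv_ext_def shift_lin)
  have "equiv_ext G bar_bd (frag_extend bar_fill ?y) = frag_extend (\<lambda>p. equiv_ext G bar_bd (bar_fill p)) ?y"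
    by (simp add: equiv_ext_def frag_extend_frag_extend)
  also have "\<dots> = frag_extend (\<lambda>p. frag_of p - frag_extend bar_fill (equiv_ext G bar_bd (frag_of p))) ?y"
    by (rule frag_extend_cong_on[OF y]) (auto simp: equiv_ext_bar_bd_bar_fill bar_bd_Cons)
  also have "\<dots> = ?y - frag_extend bar_fill (equiv_ext G bar_bd ?y)"
    by (simp add: lin_fun) (simp add: equiv_ext_def frag_extend_frag_extend)
  finally have "equiv_ext G bar_bd (frag_extend bar_fill ?y) = ?y" using Dy by simp
  then show ?case using bar_bd_Cons[OF gs(3,2)] gs by (simp add: equiv_ext_lin)
qed

lemma bar_free_resolution: "free_resolution G bar_basis bar_bd bar_fill (\<one>, [])"
proof unfold_locales
  fix x assume x: "x \<in> carrier G \<times> bar_basis 0"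
  then have "snd x = []" "fst x \<in> carrier G" by (auto simp: bar_basis_def)
  then show "equiv_ext G bar_bd (bar_fill x) = frag_of x - frag_of (\<one>, [])"
    using equiv_ext_bar_bd_bar_fill[of "fst x" "snd x" 0] x by (cases x) (auto simp: bar_bd_Cons_Nil)
next
  fix x n assume x: "x \<in> carrier G \<times> bar_basis (Suc n)"
  then show "equiv_ext G bar_bd (bar_fill x) + frag_extend bar_fill (equiv_ext G bar_bd (frag_of x)) = frag_of x"
    by (cases x) (auto simp: equiv_ext_bar_bd_bar_fill bar_bd_Cons)
qed (use bar_bd_in bar_bd_bd aug_bar_bd in \<open>auto simp: bar_fill_def bar_basis_Suc, auto simp: bar_basis_def\<close>)

lemma bar_boundary_orbit_map: "x \<in> chains (bar_basis (Suc n)) \<Longrightarrow> bar_boundary (Suc n) G x = orbit_map bar_bd x"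
  unfolding bar_boundary_def orbit_map_def
  by (simp del: sum.atMost_Suc, erule frag_extend_cong_on)
     (auto simp: bar_bd_def bar_basis_def orbits_def frag_extend_sum frag_extend_cmul comp_def simp del: sum.atMost_Suc)

end

section \<open>The resolution given by the universal cover\<close>

text \<open>The group \<open>G\<close> is the group of normal words that lead from \<open>w\<close> to \<open>w\<close>, up to the isomorphism
  \<open>\<theta>\<close>.\<close>

locale diagram_cells = cell_system F N tp bt iv + group G
  for F N :: "'f set" and tp bt :: "'f \<Rightarrow> 'e list" and iv :: "'f \<Rightarrow> 'f" and G :: "('g, 'm) monoid_scheme" (structure) +
  fixes w :: "'e list" and \<theta> :: "'g \<Rightarrow> (nat \<times> 'f) list"
  assumes \<theta>_bij: "bij_betw \<theta> (carrier G) {V. normal_word V \<and> runs w V w}"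
    and \<theta>_mult: "g \<in> carrier G \<Longrightarrow> h \<in> carrier G \<Longrightarrow> \<theta> (g \<otimes> h) = mul (\<theta> g) (\<theta> h)"
begin

definition component :: "nat \<Rightarrow> ('e + 'f) list set" where
  "component n = {c. conn w (cube_top c) \<and> cell_set c \<subseteq> N \<and> cell_count c = n}"

definition cover_cubes :: "nat \<Rightarrow> ((nat \<times> 'f) list \<times> ('e + 'f) list) set" where
  "cover_cubes n = {(V, c). normal_word V \<and> runs w V (cube_top c) \<and> cell_set c \<subseteq> N \<and> cell_count c = n}"

text \<open>A word from \<open>w\<close> to each vertex is chosen; \<open>coord\<close> and \<open>of_coord\<close> are the mutually inverse changes
  between a cube \<open>(V, c)\<close> of the universal cover and its coordinates \<open>(g, c)\<close> in \<open>G \<times> component n\<close>,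
  where \<open>V\<close> is \<open>g\<close> followed by the chosen word.\<close>

definition ref_word :: "'e list \<Rightarrow> (nat \<times> 'f) list" where
  "ref_word u = (SOME V. normal_word V \<and> runs w V u)"

definition coord where "coord q = (inv_into (carrier G) \<theta> (mul (fst q) (winv (ref_word (cube_top (snd q))))), snd q)"
definition of_coord where "of_coord q = (mul (\<theta> (fst q)) (ref_word (cube_top (snd q))), snd q)"

lemma ref_word: "conn w u \<Longrightarrow> normal_word (ref_word u) \<and> runs w (ref_word u) u"
  unfolding ref_word_def conn_def by (rule someI_ex)

lemma \<theta>_in: "g \<in> carrier G \<Longrightarrow> normal_word (\<theta> g) \<and> runs w (\<theta> g) w"
  using \<theta>_bij by (auto simp: bij_betw_def)

lemma of_coord_in: "q \<in> carrier G \<times> component n \<Longrightarrow> of_coord q \<in> cover_cubes n"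
proof -
  assume q: "q \<in> carrier G \<times> component n"
  let ?r = "ref_word (cube_top (snd q))"
  have r: "normal_word ?r" "runs w ?r (cube_top (snd q))" using ref_word q by (auto simp: component_def)
  have t: "normal_word (\<theta> (fst q))" "runs w (\<theta> (fst q)) w" using \<theta>_in q by auto
  have "normal_word (mul (\<theta> (fst q)) ?r)" by (rule normal_word_mul[OF t(1) normal_word_cells[OF r(1)]])
  moreover have "runs w (mul (\<theta> (fst q)) ?r) (cube_top (snd q))"
    by (rule runs_mul[OF t(2) r(2) t(1) normal_word_cells[OF r(1)]])
  ultimately show ?thesis using q by (auto simp: of_coord_def cover_cubes_def component_def)
qed

lemma cover_cubes_conn: "q \<in> cover_cubes n \<Longrightarrow> conn w (cube_top (snd q))"
  by (auto simp: cover_cubes_def conn_def)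

lemma loop_in: "q \<in> cover_cubes n \<Longrightarrow> mul (fst q) (winv (ref_word (cube_top (snd q)))) \<in> {V. normal_word V \<and> runs w V w}"
proof -
  assume q: "q \<in> cover_cubes n"
  let ?r = "ref_word (cube_top (snd q))"
  have r: "normal_word ?r" "runs w ?r (cube_top (snd q))" using ref_word[OF cover_cubes_conn[OF q]] by auto
  have t: "normal_word (fst q)" "runs w (fst q) (cube_top (snd q))" using q by (auto simp: cover_cubes_def)
  note c = winv_cells[OF normal_word_cells[OF r(1)]]
  show ?thesis
    using normal_word_mul[OF t(1) c] runs_mul[OF t(2) runs_winv[OF r(2) normal_word_cells[OF r(1)]] t(1) c] by simp
qed

lemma \<theta>_inv: "V \<in> {V. normal_word V \<and> runs w V w} \<Longrightarrow> inv_into (carrier G) \<theta> V \<in> carrier G \<and> \<theta> (inv_into (carrier G) \<theta> V) = V"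
  using \<theta>_bij by (metis bij_betw_def f_inv_into_f inv_into_into)

lemma coord_in: "q \<in> cover_cubes n \<Longrightarrow> coord q \<in> carrier G \<times> component n"
  using \<theta>_inv[OF loop_in] cover_cubes_conn[of q n] by (auto simp: coord_def component_def cover_cubes_def)

lemma of_coord_coord: "q \<in> cover_cubes n \<Longrightarrow> of_coord (coord q) = q"
proof -
  assume q: "q \<in> cover_cubes n"
  have "mul (mul (fst q) (winv (ref_word (cube_top (snd q))))) (ref_word (cube_top (snd q))) = fst q"
    by (rule mul_winv'[OF _ normal_word_cells]) (use q ref_word[OF cover_cubes_conn[OF q]] in \<open>auto simp: cover_cubes_def\<close>)
  then show ?thesis using \<theta>_inv[OF loop_in[OF q]] by (simp add: of_coord_def coord_def)
qed

lemma coord_of_coord: "q \<in> carrier G \<times> component n \<Longrightarrow> coord (of_coord q) = q"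
proof -
  assume q: "q \<in> carrier G \<times> component n"
  then have r: "normal_word (ref_word (cube_top (snd q)))" using ref_word by (auto simp: component_def)
  have "mul (mul (\<theta> (fst q)) (ref_word (cube_top (snd q)))) (winv (ref_word (cube_top (snd q)))) = \<theta> (fst q)"
    by (rule mul_winv[OF _ normal_word_cells[OF r]]) (use q \<theta>_in in auto)
  moreover have "inv_into (carrier G) \<theta> (\<theta> (fst q)) = fst q"
    using q \<theta>_bij by (auto simp: bij_betw_def)
  ultimately show ?thesis by (simp add: coord_def of_coord_def)
qed

lemma coord_shift:
  assumes g: "g \<in> carrier G" and q: "q \<in> cover_cubes n"
  shows "(g \<otimes> fst (coord q), snd (coord q)) = coord (mul (\<theta> g) (fst q), snd q)"
proof -
  let ?r = "ref_word (cube_top (snd q))"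
  have fc: "fst (coord q) \<in> carrier G" using coord_in[OF q] by auto
  have r: "normal_word ?r" using ref_word[OF cover_cubes_conn[OF q]] by auto
  have t: "normal_word (\<theta> g)" "normal_word (fst q)" using \<theta>_in[OF g] q by (auto simp: cover_cubes_def)
  have 1: "\<theta> (fst (coord q)) = mul (fst q) (winv ?r)"
    using \<theta>_inv[OF loop_in[OF q]] by (simp add: coord_def)
  have 2: "mul (\<theta> g) (mul (fst q) (winv ?r)) = mul (mul (\<theta> g) (fst q)) (winv ?r)"
    by (rule mul_mul[OF t(1) normal_word_cells[OF t(2)] winv_cells[OF normal_word_cells[OF r]]])
  have 3: "\<theta> (g \<otimes> fst (coord q)) = mul (mul (\<theta> g) (fst q)) (winv ?r)"
    unfolding \<theta>_mult[OF g fc] 1 2 ..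
  have "inv_into (carrier G) \<theta> (\<theta> (g \<otimes> fst (coord q))) = g \<otimes> fst (coord q)"
    by (rule inv_into_f_f[OF bij_betw_imp_inj_on[OF \<theta>_bij] m_closed[OF g fc]])
  then have "inv_into (carrier G) \<theta> (mul (mul (\<theta> g) (fst q)) (winv ?r)) = g \<otimes> fst (coord q)"
    unfolding 3 .
  then show ?thesis by (simp add: coord_def)
qed

definition coord_chain where "coord_chain x = frag_extend (\<lambda>q. frag_of (coord q)) x"

lemma coord_chain_simps [simp]: "coord_chain 0 = 0" "coord_chain (x - y) = coord_chain x - coord_chain y" "coord_chain (x + y) = coord_chain x + coord_chain y" "coord_chain (frag_of q) = frag_of (coord q)"
  by (simp_all add: coord_chain_def lin)

lemma coord_chain_in: "x \<in> chains (cover_cubes n) \<Longrightarrow> coord_chain x \<in> chains (carrier G \<times> component n)"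
  unfolding coord_chain_def by (erule frag_extend_in_chains) (use coord_in in auto)

definition res_bd where "res_bd c = coord_chain (cover_bd 0 (ref_word (cube_top c)) c)"
definition res_fill where "res_fill q = coord_chain (cover_fill (fst (of_coord q)) (snd (of_coord q)))"

lemma cover_bd_in: "q \<in> cover_cubes (Suc n) \<Longrightarrow> cover_bd 0 (fst q) (snd q) \<in> chains (cover_cubes n)"
proof -
  assume q: "q \<in> cover_cubes (Suc n)"
  obtain V c where qq: "q = (V, c)" by force
  have V: "normal_word V" "cell_set c \<subseteq> F" using q qq N_F by (auto simp: cover_cubes_def)
  have "face_set 0 V c \<subseteq> cover_cubes n"
    using q V unfolding cover_cubes_def face_set_def qq by (fastforce intro!: normal_word_push)
  then show ?thesis using cover_bd_in_face_set[OF normal_word_cells[OF V(1)] V(2), of 0] qq by (auto simp: chains_iff)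
qed

lemma cover_fill_in: "q \<in> cover_cubes n \<Longrightarrow> cover_fill (fst q) (snd q) \<in> chains (cover_cubes (Suc n))"
proof -
  have "(V, c) \<in> cover_cubes n \<Longrightarrow> cover_fill V c \<in> chains (cover_cubes (Suc n))" for V c
  proof (induction V arbitrary: c)
    case (Cons a V)
    obtain m g where a: "a = (m, g)" by force
    have V: "normal_word (a # V)" "runs w (a # V) (cube_top c)" "cell_set c \<subseteq> N" "cell_count c = n"
      using Cons.prems by (auto simp: cover_cubes_def)
    have g: "g \<in> F" using V a by auto
    show ?case
    proof (cases "list_all isl (take (m + length (bt g)) c)")
      case True
      obtain p q x where pq: "cube_top c = p @ bt g @ q" "length p = m" "runs w V (p @ tp g @ q)"
        using V a by (auto simp: step_def)
      define r where "r = drop (m + length (bt g)) c"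
      have c: "c = ed p @ ed (bt g) @ r"
        using take_isl[OF True] pq by (simp add: r_def)
      then have q: "cube_top r = q" using pq by simp
      have s: "cover_fill (a # V) c = cover_fill V (ed p @ ed (tp g) @ r) - cell_cube p g (frag_of (V, r))"
        unfolding a c by (rule cover_fill_right[OF pq(2)])
      have 1: "cover_fill V (ed p @ ed (tp g) @ r) \<in> chains (cover_cubes (Suc n))"
        by (rule Cons.IH) (use V pq q c in \<open>auto simp: cover_cubes_def\<close>)
      have "cell_cube p g (frag_of (V, r)) \<in> chains (cover_cubes (Suc n))"
      proof (cases "g \<in> N")
        case True
        then show ?thesis using V pq q c by (auto simp: cell_cube_N cover_cubes_def)
      next
        case False
        have st: "push (m, g) V = a # V" using V a by (auto simp: push_stays)
        have "(a # V, ed p @ Inr (iv g) # r) \<in> cover_cubes (Suc n)"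
          using V pq q c False g tp_iv[OF g] N_iv[OF g] by (auto simp: cover_cubes_def)
        then show ?thesis using False st pq by (simp add: cell_cube_notN)
      qed
      then show ?thesis unfolding s using 1 by auto
    qed (simp add: a)
  qed simp
  then show "q \<in> cover_cubes n \<Longrightarrow> ?thesis" by (cases q) auto
qed

lemma shift_coord_chain:
  assumes "g \<in> carrier G" "x \<in> chains (cover_cubes n)"
  shows "shift G g (coord_chain x) = coord_chain (mul_chain (\<theta> g) x)"
proof -
  have "shift G g (coord_chain x) = frag_extend (\<lambda>q. frag_of (g \<otimes> fst (coord q), snd (coord q))) x"
    by (simp add: shift_def coord_chain_def frag_extend_frag_extend)
  also have "\<dots> = frag_extend (\<lambda>q. frag_of (coord (mul (\<theta> g) (fst q), snd q))) x"
    by (rule frag_extend_cong_on[OF assms(2)]) (simp only: coord_shift[OF assms(1)])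
  finally show ?thesis by (simp add: mul_chain_def coord_chain_def frag_extend_frag_extend)
qed

text \<open>In coordinates, the boundary of the universal cover is the equivariant extension of its values
  on the cubes that are based at the chosen words.\<close>

lemma equiv_ext_res_bd_coord_chain:
  assumes x: "x \<in> chains (cover_cubes (Suc n))"
  shows "equiv_ext G res_bd (coord_chain x) = coord_chain (ext_cover_bd 0 x)"
proof -
  have "equiv_ext G res_bd (coord_chain x) = frag_extend (\<lambda>q. shift G (fst (coord q)) (res_bd (snd (coord q)))) x"
    by (simp add: equiv_ext_def coord_chain_def frag_extend_frag_extend)
  also have "\<dots> = frag_extend (\<lambda>q. coord_chain (cover_bd 0 (fst q) (snd q))) x"
  proof (rule frag_extend_cong_on[OF x])
    fix q assume q: "q \<in> cover_cubes (Suc n)"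
    let ?r = "ref_word (cube_top (snd q))"
    have r: "normal_word ?r" "runs w ?r (cube_top (snd q))" using ref_word[OF cover_cubes_conn[OF q]] by auto
    have "(?r, snd q) \<in> cover_cubes (Suc n)" using r q by (auto simp: cover_cubes_def)
    then have "cover_bd 0 ?r (snd q) \<in> chains (cover_cubes n)" using cover_bd_in by fastforce
    then have "shift G (fst (coord q)) (res_bd (snd q)) = coord_chain (mul_chain (\<theta> (fst (coord q))) (cover_bd 0 ?r (snd q)))"
      unfolding res_bd_def using coord_in[OF q] by (intro shift_coord_chain) auto
    also have "mul_chain (\<theta> (fst (coord q))) (cover_bd 0 ?r (snd q)) = cover_bd 0 (mul (\<theta> (fst (coord q))) ?r) (snd q)"
      by (rule mul_chain_cover_bd[OF _ normal_word_cells[OF r(1)]])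
        (use \<theta>_in[of "fst (coord q)"] coord_in[OF q] q N_F in \<open>auto simp: cover_cubes_def\<close>)
    also have "mul (\<theta> (fst (coord q))) ?r = fst q"
      using of_coord_coord[OF q] unfolding of_coord_def by (metis coord_def fst_conv snd_conv)
    finally show "shift G (fst (coord q)) (res_bd (snd (coord q))) = coord_chain (cover_bd 0 (fst q) (snd q))"
      by (simp add: coord_def)
  qed
  finally show ?thesis by (simp add: ext_cover_bd_def coord_chain_def frag_extend_frag_extend)
qed

lemma ext_res_fill_coord_chain:
  assumes x: "x \<in> chains (cover_cubes n)"
  shows "frag_extend res_fill (coord_chain x) = coord_chain (ext_cover_fill x)"
proof -
  have "frag_extend res_fill (coord_chain x) = frag_extend (\<lambda>q. res_fill (coord q)) x"
    by (simp add: coord_chain_def frag_extend_frag_extend)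
  also have "\<dots> = frag_extend (\<lambda>q. coord_chain (cover_fill (fst q) (snd q))) x"
  proof (rule frag_extend_cong_on[OF x])
    fix q assume q: "q \<in> cover_cubes n"
    show "res_fill (coord q) = coord_chain (cover_fill (fst q) (snd q))" unfolding res_fill_def of_coord_coord[OF q] ..
  qed
  finally show ?thesis by (simp add: ext_cover_fill_def coord_chain_def frag_extend_frag_extend)
qed

lemma aug_coord_chain: "aug (coord_chain x) = aug x"
  by (simp add: aug_def coord_chain_def frag_extend_frag_extend)

lemma aug_prefix: "aug (prefix a x) = aug x"
  by (simp add: aug_def prefix_def frag_extend_frag_extend)

lemma aug_cover_bd: "aug (cover_bd k V c) = 0"
  by (induction k V c rule: cover_bd.induct) (simp_all add: aug_prefix aug_lin, simp add: aug_def)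

lemma cell_count_0: "cell_count c = 0 \<Longrightarrow> c = ed (cube_top c)"
  by (induction c rule: cube_top.induct) auto

theorem cover_free_resolution: "free_resolution G component res_bd res_fill (coord ([], ed w))"
proof unfold_locales
  have w: "([], ed w) \<in> cover_cubes 0" by (simp add: cover_cubes_def)
  have res_bd: "(ref_word (cube_top c), c) \<in> cover_cubes n" if "c \<in> component n" for c n
    using that ref_word by (auto simp: component_def cover_cubes_def)
  have D_in: "cover_bd 0 (ref_word (cube_top c)) c \<in> chains (cover_cubes n)" if "c \<in> component (Suc n)" for c n
    using cover_bd_in[OF res_bd[OF that]] by simp
  show "res_bd b \<in> chains (carrier G \<times> component n)" if "b \<in> component (Suc n)" for b n
    unfolding res_bd_def by (rule coord_chain_in[OF D_in[OF that]])
  show "res_fill x \<in> chains (carrier G \<times> component (Suc n))" if "x \<in> carrier G \<times> component n" for x n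
    unfolding res_fill_def by (rule coord_chain_in[OF cover_fill_in[OF of_coord_in[OF that]]])
  show "equiv_ext G res_bd (res_bd b) = 0" if "b \<in> component (Suc (Suc n))" for b n
  proof -
    have "normal_word (ref_word (cube_top b))" "cell_set b \<subseteq> F" using that ref_word N_F by (auto simp: component_def)
    then show ?thesis unfolding res_bd_def[of b] equiv_ext_res_bd_coord_chain[OF D_in[OF that]] by (simp add: cover_bd_cover_bd)
  qed
  show "aug (res_bd b) = 0" if "b \<in> component (Suc 0)" for b
    by (simp add: res_bd_def aug_coord_chain aug_cover_bd)
  show "coord ([], ed w) \<in> carrier G \<times> component 0" by (rule coord_in[OF w])
  have main: "equiv_ext G res_bd (res_fill x) + coord_chain (ext_cover_fill (cover_bd 0 (fst (of_coord x)) (snd (of_coord x))))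
     = frag_of x - (if n = 0 then frag_of (coord ([], ed w)) else 0)" if x: "x \<in> carrier G \<times> component n" for x n
  proof -
    have u: "of_coord x \<in> cover_cubes n" by (rule of_coord_in[OF x])
    have "equiv_ext G res_bd (res_fill x) = coord_chain (ext_cover_bd 0 (cover_fill (fst (of_coord x)) (snd (of_coord x))))"
      unfolding res_fill_def by (rule equiv_ext_res_bd_coord_chain[OF cover_fill_in[OF u]])
    then have "equiv_ext G res_bd (res_fill x) + coord_chain (ext_cover_fill (cover_bd 0 (fst (of_coord x)) (snd (of_coord x))))
       = coord_chain (ext_cover_bd 0 (cover_fill (fst (of_coord x)) (snd (of_coord x))) + ext_cover_fill (cover_bd 0 (fst (of_coord x)) (snd (of_coord x))))" by simp
    also have "\<dots> = coord_chain (frag_of (of_coord x) - (if n = 0 then frag_of ([], ed w) else 0))"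
      using u by (subst contraction[where w = w]) (auto simp: cover_cubes_def)
    finally show ?thesis using coord_of_coord[OF x] by auto
  qed
  show "equiv_ext G res_bd (res_fill x) = frag_of x - frag_of (coord ([], ed w))" if x: "x \<in> carrier G \<times> component 0" for x
  proof -
    have "cell_count (snd (of_coord x)) = 0" using of_coord_in[OF x] by (auto simp: cover_cubes_def)
    then have "cover_bd 0 (fst (of_coord x)) (snd (of_coord x)) = 0"
      by (metis cell_count_0 cover_bd_ed append_Nil2 cover_bd.simps(1) prefix_lin(1))
    then show ?thesis using main[OF x] by simp
  qed
  show "equiv_ext G res_bd (res_fill x) + frag_extend res_fill (equiv_ext G res_bd (frag_of x)) = frag_of x"
    if x: "x \<in> carrier G \<times> component (Suc n)" for x n
  proof -
    have u: "of_coord x \<in> cover_cubes (Suc n)" by (rule of_coord_in[OF x])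
    have "equiv_ext G res_bd (frag_of x) = equiv_ext G res_bd (coord_chain (frag_of (of_coord x)))" using coord_of_coord[OF x] by simp
    also have "\<dots> = coord_chain (cover_bd 0 (fst (of_coord x)) (snd (of_coord x)))"
      using equiv_ext_res_bd_coord_chain[of "frag_of (of_coord x)" n] u by simp
    finally show ?thesis using main[OF x] ext_res_fill_coord_chain[OF cover_bd_in[OF u]] by simp
  qed
qed

end

section \<open>Collapsing the Squier complex onto its essential cubes\<close>

text \<open>The bilinear extension of concatenation.\<close>

definition cmul :: "('a list \<Rightarrow>\<^sub>0 int) \<Rightarrow> ('a list \<Rightarrow>\<^sub>0 int) \<Rightarrow> ('a list \<Rightarrow>\<^sub>0 int)" (infixl "\<star>" 70) where
  "x \<star> y = frag_extend (\<lambda>a. frag_extend (\<lambda>b. frag_of (a @ b)) y) x"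

lemma cmul_lin [simp]:
  "0 \<star> y = 0" "(x + x') \<star> y = x \<star> y + x' \<star> y" "(x - x') \<star> y = x \<star> y - x' \<star> y" "(- x) \<star> y = - (x \<star> y)"
  "x \<star> 0 = 0" "x \<star> (y + y') = x \<star> y + x \<star> y'" "x \<star> (y - y') = x \<star> y - x \<star> y'" "x \<star> (- y) = - (x \<star> y)"
  by (simp_all add: cmul_def lin lin_fun)

lemma cmul_of [simp]: "frag_of a \<star> frag_of b = frag_of (a @ b)"
  by (simp add: cmul_def)

lemma of_cmul: "frag_of a \<star> y = frag_extend (\<lambda>b. frag_of (a @ b)) y"
  by (simp add: cmul_def)

lemma cmul_assoc: "x \<star> y \<star> z = x \<star> (y \<star> z)"
  by (simp add: cmul_def frag_extend_frag_extend)

lemma Nil_cmul [simp]: "frag_of [] \<star> y = y"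
  by (simp add: cmul_def)

lemma frag_extend_of_cmul: "frag_extend f (frag_of a \<star> y) = frag_extend (\<lambda>b. f (a @ b)) y"
  by (simp add: cmul_def frag_extend_frag_extend)

lemma frag_extend_cmul2: "frag_extend f (x \<star> y) = frag_extend (\<lambda>a. frag_extend (\<lambda>b. f (a @ b)) y) x"
  by (simp add: cmul_def frag_extend_frag_extend)

lemma cmul_frag_extend: "x \<star> frag_extend f y = frag_extend (\<lambda>b. x \<star> f b) y"
  by (induction y rule: frag_induction[OF subset_UNIV]) (auto simp: frag_extend_diff)

lemma frag_extend_cmul_left: "frag_extend f x \<star> y = frag_extend (\<lambda>a. f a \<star> y) x"
  by (induction x rule: frag_induction[OF subset_UNIV]) (auto simp: frag_extend_diff)

lemma cell_count_eq_0: "cell_count c = 0 \<Longrightarrow> \<exists>p. c = ed p"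
  using cube_split[of c] by auto

lemma cell_count_eq_1: "cell_count c = Suc 0 \<Longrightarrow> \<exists>p f q. c = ed p @ Inr f # ed q"
proof -
  assume c: "cell_count c = Suc 0"
  obtain p c' where p: "c = ed p @ c'" "c' = [] \<or> (\<exists>f r. c' = Inr f # r)" using cube_split by blast
  with c obtain f r where r: "c' = Inr f # r" by auto
  then obtain q where "r = ed q" using c p cell_count_eq_0[of r] by auto
  then show ?thesis using p r by blast
qed

context cell_system
begin

fun cube_bd :: "('e + 'f) list \<Rightarrow> (('e + 'f) list \<Rightarrow>\<^sub>0 int)" where
  "cube_bd [] = 0"
| "cube_bd (Inl e # c) = frag_of [Inl e] \<star> cube_bd c"
| "cube_bd (Inr f # c) = frag_of (ed (tp f) @ c) - frag_of (ed (bt f) @ c) - frag_of [Inr f] \<star> cube_bd c"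

abbreviation "ext_cube_bd \<equiv> frag_extend cube_bd"

lemma cube_bd_ed: "cube_bd (ed p @ c) = frag_of (ed p) \<star> cube_bd c"
proof (induction p)
  case (Cons e p)
  then show ?case using cmul_assoc[of "frag_of [Inl e]" "frag_of (ed p)" "cube_bd c"] by simp
qed simp

lemma cube_bd_ed_Nil [simp]: "cube_bd (ed p) = 0"
  using cube_bd_ed[of p "[]"] by simp

definition comp_cubes :: "'e list \<Rightarrow> nat \<Rightarrow> ('e + 'f) list set" where
  "comp_cubes u n = {c. conn u (cube_top c) \<and> cell_set c \<subseteq> N \<and> cell_count c = n}"

lemma conn_append: "conn u v \<Longrightarrow> conn u' v' \<Longrightarrow> conn (u @ u') (v @ v')"
  using conn_ctxt[of u v "[]" u'] conn_ctxt[of u' v' v "[]"] conn_trans by simp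

lemma comp_cubes_conn: "conn u v \<Longrightarrow> comp_cubes v n = comp_cubes u n"
  using conn_trans conn_sym unfolding comp_cubes_def by blast

lemma comp_cubes_append: "a \<in> comp_cubes u m \<Longrightarrow> b \<in> comp_cubes v n \<Longrightarrow> a @ b \<in> comp_cubes (u @ v) (m + n)"
  by (auto simp: comp_cubes_def intro: conn_append)

lemma cmul_in: "x \<in> chains A \<Longrightarrow> y \<in> chains B \<Longrightarrow> (\<And>a b. a \<in> A \<Longrightarrow> b \<in> B \<Longrightarrow> a @ b \<in> C) \<Longrightarrow> x \<star> y \<in> chains C"
  unfolding cmul_def by (intro frag_extend_in_chains[of _ A] frag_extend_in_chains[of y B]) auto

lemma cmul_comp_cubes: "x \<in> chains (comp_cubes u m) \<Longrightarrow> y \<in> chains (comp_cubes v n) \<Longrightarrow> x \<star> y \<in> chains (comp_cubes (u @ v) (m + n))"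
  by (erule (1) cmul_in) (rule comp_cubes_append)

text \<open>The general sign is \<open>(-1)\<close> to the number of cells in the left factor, here a single one.\<close>

lemma Leibniz:
  assumes "x \<in> chains (comp_cubes u (Suc 0))"
  shows "ext_cube_bd (x \<star> y) = ext_cube_bd x \<star> y - x \<star> ext_cube_bd y"
proof -
  have *: "cube_bd (a @ b) = cube_bd a \<star> frag_of b - frag_of a \<star> cube_bd b" if aQ: "a \<in> comp_cubes u (Suc 0)" for a b
  proof -
    obtain p f q where a: "a = ed p @ Inr f # ed q" using aQ cell_count_eq_1[of a] by (auto simp: comp_cubes_def)
    show ?thesis unfolding a by (simp add: cube_bd_ed cmul_assoc[symmetric])
  qed
  have "ext_cube_bd (x \<star> y) = frag_extend (\<lambda>a. frag_extend (\<lambda>b. cube_bd (a @ b)) y) x"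
    by (rule frag_extend_cmul2)
  also have "\<dots> = frag_extend (\<lambda>a. frag_extend (\<lambda>b. cube_bd a \<star> frag_of b - frag_of a \<star> cube_bd b) y) x"
    by (rule frag_extend_cong_on[OF assms]) (simp add: *)
  also have "\<dots> = ext_cube_bd x \<star> y - x \<star> ext_cube_bd y"
    by (simp add: lin_fun cmul_frag_extend[symmetric] frag_extend_cmul_left[symmetric])
  finally show ?thesis .
qed

end

text \<open>What the collapse uses of a left forest. \<open>ok\<close> holds for the edge lists of 1-paths, \<open>red u\<close> is the
  irreducible form of \<open>u\<close>, the pairs \<open>(p, f)\<close> with \<open>(p, f, *)\<close> in the forest make up \<open>T\<close>, and
  \<open>tree_chain u\<close> is the chain of the path in the forest from \<open>u\<close> to \<open>red u\<close>.\<close>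

locale left_normal = cell_system F N tp bt iv for F N :: "'f set" and tp bt :: "'f \<Rightarrow> 'e list" and iv +
  fixes ok :: "'e list \<Rightarrow> bool" and red :: "'e list \<Rightarrow> 'e list" and T :: "('e list \<times> 'f) set"
    and tree_chain :: "'e list \<Rightarrow> (('e + 'f) list \<Rightarrow>\<^sub>0 int)"
  assumes ok_factor: "ok (p @ u @ q) \<Longrightarrow> ok u"
    and ok_tp_bt: "f \<in> F \<Longrightarrow> ok (p @ tp f @ q) \<longleftrightarrow> ok (p @ bt f @ q)"
    and red_conn: "ok u \<Longrightarrow> conn u (red u)"
    and red_eq: "ok u \<Longrightarrow> conn u v \<Longrightarrow> red u = red v"
    and tree_chain_d: "ok u \<Longrightarrow> ext_cube_bd (tree_chain u) = frag_of (ed u) - frag_of (ed (red u))"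
    and tree_chain_append: "ok (a @ b) \<Longrightarrow> tree_chain (a @ b) = tree_chain a \<star> frag_of (ed b) + tree_chain (red a @ b)"
    and tree_chain_in: "ok u \<Longrightarrow> tree_chain u \<in> chains {ed p @ Inr f # ed q | p f q.
      f \<in> N \<and> (p, f) \<in> T \<and> red p = p \<and> conn u (p @ tp f @ q)}"
    and tree_chain_T: "(p, f) \<in> T \<Longrightarrow> f \<in> N \<Longrightarrow> ok (p @ tp f) \<Longrightarrow> red p = p \<Longrightarrow>
      frag_of (ed p @ [Inr f]) = tree_chain (p @ tp f) - tree_chain (p @ bt f)"
begin

lemma ok_prefix: "ok (p @ q) \<Longrightarrow> ok p" and ok_suffix: "ok (p @ q) \<Longrightarrow> ok q"
  using ok_factor[of "[]" p q] ok_factor[of p q "[]"] by auto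

lemma ok_conn: "conn u v \<Longrightarrow> ok u \<longleftrightarrow> ok v"
proof -
  have "runs u V v \<Longrightarrow> snd ` set V \<subseteq> F \<Longrightarrow> ok u \<longleftrightarrow> ok v" for V
  proof (induction V arbitrary: v)
    case (Cons a V)
    then obtain p q where "runs u V (p @ tp (snd a) @ q)" "v = p @ bt (snd a) @ q"
      by (auto simp: step_def)
    then show ?case using Cons.IH Cons.prems(2) ok_tp_bt[of "snd a" p q] by simp
  qed simp
  then show "conn u v \<Longrightarrow> ?thesis" unfolding conn_def using normal_word_cells by blast
qed

lemma red_red: "ok u \<Longrightarrow> red (red u) = red u"
  using red_eq[OF _ red_conn] by simp

lemma red_append: "ok (a @ b) \<Longrightarrow> red (red a @ b) = red (a @ b)"
  using red_eq[of "a @ b" "red a @ b"] conn_append[OF red_conn conn_refl] ok_prefix by metis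

lemma ok_red_append: "ok (a @ b) \<Longrightarrow> ok (red a @ b)"
  using ok_conn[OF conn_append[OF red_conn conn_refl]] ok_prefix by blast

lemma red_tp_bt: "f \<in> F \<Longrightarrow> ok (p @ tp f @ q) \<Longrightarrow> red (p @ tp f @ q) = red (p @ bt f @ q)"
  using red_eq conn_step by blast

lemma tree_chain_comp_cubes: "ok u \<Longrightarrow> tree_chain u \<in> chains (comp_cubes u (Suc 0))"
proof -
  assume "ok u"
  moreover have "{ed p @ Inr f # ed q | p f q. f \<in> N \<and> (p, f) \<in> T \<and> red p = p \<and> conn u (p @ tp f @ q)} \<subseteq> comp_cubes u (Suc 0)"
    by (auto simp: comp_cubes_def)
  ultimately show ?thesis using tree_chain_in[of u] unfolding chains_iff by blast
qed

text \<open>The edge \<open>(p, f)\<close> closed up to a cycle by the tree chains of its ends.\<close>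

definition loop :: "'e list \<Rightarrow> 'f \<Rightarrow> (('e + 'f) list \<Rightarrow>\<^sub>0 int)" where
  "loop p f = frag_of (ed p @ [Inr f]) - tree_chain (p @ tp f) + tree_chain (p @ bt f)"

lemma loop_comp_cubes:
  assumes "ok (p @ tp f)" "f \<in> N" shows "loop p f \<in> chains (comp_cubes (p @ tp f) (Suc 0))"
proof -
  have f: "f \<in> F" using assms N_F by auto
  have ob: "ok (p @ bt f)" using ok_tp_bt[OF f, of p "[]"] assms by simp
  have c: "conn (p @ tp f) (p @ bt f)" using conn_step[OF f, of p "[]"] by simp
  have "tree_chain (p @ bt f) \<in> chains (comp_cubes (p @ tp f) (Suc 0))"
    using tree_chain_comp_cubes[OF ob] comp_cubes_conn[OF c] by simp
  moreover have "frag_of (ed p @ [Inr f]) \<in> chains (comp_cubes (p @ tp f) (Suc 0))"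
    using assms by (simp add: comp_cubes_def)
  ultimately show ?thesis unfolding loop_def using tree_chain_comp_cubes[OF assms(1)] by (intro chains_simps)
qed

lemma ext_cube_bd_loop:
  assumes "ok (p @ tp f)" "f \<in> N"
  shows "ext_cube_bd (loop p f) = 0"
proof -
  have f: "f \<in> F" using assms N_F by auto
  have ob: "ok (p @ bt f)" using ok_tp_bt[OF f, of p "[]"] assms by simp
  have "red (p @ tp f) = red (p @ bt f)" using red_tp_bt[OF f, of p "[]"] assms by simp
  then show ?thesis using tree_chain_d[OF assms(1)] tree_chain_d[OF ob]
    by (simp add: loop_def lin cube_bd_ed)
qed

lemma loop_T: "(p, f) \<in> T \<Longrightarrow> f \<in> N \<Longrightarrow> ok (p @ tp f) \<Longrightarrow> red p = p \<Longrightarrow> loop p f = 0"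
  by (simp add: loop_def tree_chain_T)

text \<open>These functions read a cube from the left and keep the edges since the last cell in \<open>acc\<close>;
  the cube as such is treated with empty \<open>acc\<close>. Essential words are those that \<open>collapse_map\<close>
  leaves unchanged, \<open>cycle_of\<close> turns them into cycles, and \<open>proj\<close> will turn out to be
  \<open>collapse_map\<close> followed by \<open>cycle_of\<close>, to which \<open>contract\<close> is a homotopy from the identity.\<close>

fun collapse_map :: "'e list \<Rightarrow> ('e + 'f) list \<Rightarrow> (('e + 'f) list \<Rightarrow>\<^sub>0 int)" where
  "collapse_map acc [] = frag_of (ed (red acc))"
| "collapse_map acc (Inl e # c) = collapse_map (acc @ [e]) c"
| "collapse_map acc (Inr f # c) = (if (red acc, f) \<in> T then 0 else frag_of (ed (red acc) @ [Inr f]) \<star> collapse_map [] c)"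

fun cycle_of :: "'e list \<Rightarrow> ('e + 'f) list \<Rightarrow> (('e + 'f) list \<Rightarrow>\<^sub>0 int)" where
  "cycle_of acc [] = frag_of (ed acc)"
| "cycle_of acc (Inl e # c) = cycle_of (acc @ [e]) c"
| "cycle_of acc (Inr f # c) = loop acc f \<star> cycle_of [] c"

fun proj :: "'e list \<Rightarrow> ('e + 'f) list \<Rightarrow> (('e + 'f) list \<Rightarrow>\<^sub>0 int)" where
  "proj acc [] = frag_of (ed (red acc))"
| "proj acc (Inl e # c) = proj (acc @ [e]) c"
| "proj acc (Inr f # c) = loop (red acc) f \<star> proj [] c"

fun contract :: "'e list \<Rightarrow> ('e + 'f) list \<Rightarrow> (('e + 'f) list \<Rightarrow>\<^sub>0 int)" where
  "contract acc [] = tree_chain acc"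
| "contract acc (Inl e # c) = contract (acc @ [e]) c"
| "contract acc (Inr f # c) = tree_chain acc \<star> frag_of (Inr f # c) - loop (red acc) f \<star> contract [] c"

fun ess_word :: "'e list \<Rightarrow> ('e + 'f) list \<Rightarrow> bool" where
  "ess_word acc [] \<longleftrightarrow> red acc = acc"
| "ess_word acc (Inl e # c) \<longleftrightarrow> ess_word (acc @ [e]) c"
| "ess_word acc (Inr f # c) \<longleftrightarrow> red acc = acc \<and> (acc, f) \<notin> T \<and> ess_word [] c"

lemma collapse_map_ed: "collapse_map acc (ed p @ c) = collapse_map (acc @ p) c"
  and cycle_of_ed: "cycle_of acc (ed p @ c) = cycle_of (acc @ p) c"
  and contract_ed: "contract acc (ed p @ c) = contract (acc @ p) c"
  and ess_word_ed: "ess_word acc (ed p @ c) = ess_word (acc @ p) c"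
  by (induction p arbitrary: acc) auto

text \<open>The first edges \<open>a\<close> of the cube may be brought to irreducible form first, at the price of the
  tree chain of \<open>a\<close>.\<close>

lemma contract_append: "ok (a @ b @ cube_top c) \<Longrightarrow> contract (a @ b) c = tree_chain a \<star> frag_of (ed b @ c) + contract (red a @ b) c"
proof (induction c arbitrary: b rule: cube_top.induct)
  case 1
  then show ?case using tree_chain_append[of a b] by simp
next
  case (2 e c)
  then show ?case using 2(1)[of "b @ [e]"] by simp
next
  case (3 f c)
  have "ok ((a @ b) @ tp f @ cube_top c)" using 3(2) by simp
  then have "ok (a @ b)" by (rule ok_prefix)
  then show ?case using tree_chain_append[of a b] red_append[of a b] by (simp add: cmul_assoc)
qed

lemma collapse_map_append: "ok (a @ b @ cube_top c) \<Longrightarrow> collapse_map (a @ b) c = collapse_map (red a @ b) c"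
proof (induction c arbitrary: b rule: cube_top.induct)
  case 1
  then show ?case using red_append[of a b] by simp
next
  case (2 e c)
  then show ?case using 2(1)[of "b @ [e]"] by simp
next
  case (3 f c)
  have "ok ((a @ b) @ tp f @ cube_top c)" using 3(2) by simp
  then have "ok (a @ b)" by (rule ok_prefix)
  then show ?case using red_append[of a b] by simp
qed

text \<open>Where \<open>collapse_map\<close> returns \<open>0\<close> because of an edge of the forest, the loop of that edge is
  \<open>0\<close> as well.\<close>

lemma cycle_of_collapse_map: "ok (acc @ cube_top c) \<Longrightarrow> cell_set c \<subseteq> N \<Longrightarrow> frag_extend (cycle_of []) (collapse_map acc c) = proj acc c"
proof (induction c arbitrary: acc rule: cube_top.induct)
  case 1
  then show ?case using cycle_of_ed[of "[]" _ "[]"] by simp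
next
  case (3 f c)
  have o: "ok (acc @ tp f)" "ok acc" "ok (cube_top c)" 
    using 3(2) ok_factor[of "[]" "acc @ tp f" "cube_top c"] ok_factor[of "[]" acc "tp f @ cube_top c"]
      ok_factor[of "acc @ tp f" "cube_top c" "[]"] by auto
  have f: "f \<in> N" using 3 by simp
  show ?case
  proof (cases "(red acc, f) \<in> T")
    case True
    then show ?thesis using loop_T[OF True f ok_red_append[OF o(1)] red_red[OF o(2)]] by simp
  next
    case False
    have "cycle_of [] (ed (red acc) @ Inr f # b) = loop (red acc) f \<star> cycle_of [] b" for b
      by (simp add: cycle_of_ed)
    then have "frag_extend (cycle_of []) (collapse_map acc (Inr f # c)) = loop (red acc) f \<star> frag_extend (cycle_of []) (collapse_map [] c)"
      using False by (simp add: frag_extend_of_cmul cmul_frag_extend)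
    then show ?thesis using 3(1)[of "[]"] o 3(3) by simp
  qed
qed auto

text \<open>The two faces that collapse the leftmost cell have the same image, since the top and the bottom
  of a cell have the same irreducible form in every context.\<close>

lemma collapse_map_cube_bd: "ok (acc @ cube_top c) \<Longrightarrow> cell_set c \<subseteq> N \<Longrightarrow> frag_extend (collapse_map acc) (cube_bd c) = 0"
proof (induction c arbitrary: acc rule: cube_top.induct)
  case (2 e c)
  then show ?case using 2(1)[of "acc @ [e]"] by (simp add: frag_extend_of_cmul)
next
  case (3 f c)
  have f: "f \<in> F" using 3 N_F by auto
  have o: "ok (acc @ tp f)" "ok (cube_top c)" 
    using 3(2) ok_factor[of "[]" "acc @ tp f" "cube_top c"] ok_factor[of "acc @ tp f" "cube_top c" "[]"] by auto
  have o': "ok ((acc @ bt f) @ cube_top c)" using 3(2) ok_tp_bt[OF f, of acc "cube_top c"] by simp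
  have "red (acc @ tp f) = red (acc @ bt f)" using red_tp_bt[OF f, of acc "[]"] o by simp
  then have "collapse_map (acc @ tp f) c = collapse_map (acc @ bt f) c"
    using collapse_map_append[of "acc @ tp f" "[]" c] collapse_map_append[of "acc @ bt f" "[]" c] 3(2) o' by simp
  then have 1: "collapse_map acc (ed (tp f) @ c) = collapse_map acc (ed (bt f) @ c)" by (simp add: collapse_map_ed)
  have "frag_extend (collapse_map acc) (frag_of [Inr f] \<star> cube_bd c) = 0"
    using 3(1)[of "[]"] o 3(3)
    by (cases "(red acc, f) \<in> T") (simp_all add: frag_extend_of_cmul cmul_frag_extend[symmetric])
  then show ?case using 1 by (simp add: lin)
qed auto

text \<open>The heart of the collapse. In the cube \<open>acc f c\<close> the edges \<open>acc\<close> are first brought to their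
  irreducible form \<open>p\<close> and then \<open>p f\<close> is replaced by \<open>loop p f\<close>; the remaining cube \<open>c\<close> is
  treated by the induction hypothesis, multiplied by that loop. All other terms cancel in pairs.\<close>

lemma contract_homotopy:
  "ok (acc @ cube_top c) \<Longrightarrow> cell_set c \<subseteq> N \<Longrightarrow>
    ext_cube_bd (contract acc c) + frag_extend (contract acc) (cube_bd c) = frag_of (ed acc @ c) - proj acc c"
proof (induction c arbitrary: acc rule: cube_top.induct)
  case 1
  then show ?case using tree_chain_d by simp
next
  case (2 e c)
  then show ?case using 2(1)[of "acc @ [e]"] by (simp add: frag_extend_of_cmul)
next
  case (3 f c)
  have f: "f \<in> N" "f \<in> F" using 3 N_F by auto
  have ok1: "ok (acc @ tp f @ cube_top c)" using 3(2) by simp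
  have ok2: "ok (acc @ bt f @ cube_top c)" using ok1 ok_tp_bt[OF f(2)] by blast
  have o: "ok (acc @ tp f)" "ok acc" "ok (cube_top c)" "ok (acc @ bt f)"
    using ok1 ok2 ok_factor[of "[]" "acc @ tp f" "cube_top c"] ok_factor[of "[]" acc "tp f @ cube_top c"]
      ok_factor[of "acc @ tp f" "cube_top c" "[]"] ok_factor[of "[]" "acc @ bt f" "cube_top c"] by auto
  let ?p = "red acc" and ?c = "frag_of c" and ?f = "frag_of [Inr f]"
  let ?y = "loop ?p f"
  have okp: "ok (?p @ tp f)" using ok_red_append[OF o(1)] .
  have IH: "ext_cube_bd (contract [] c) + frag_extend (contract []) (cube_bd c) = frag_of c - proj [] c"
    using 3(1)[of "[]"] o 3(3) by simp
  have red: "red (acc @ tp f) = red (acc @ bt f)" using red_tp_bt[OF f(2), of acc "[]"] o by simp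
  have "contract acc (ed (tp f) @ c) - contract acc (ed (bt f) @ c)
      = (tree_chain (acc @ tp f) - tree_chain (acc @ bt f)) \<star> ?c"
    using contract_append[of "acc @ tp f" "[]" c] contract_append[of "acc @ bt f" "[]" c] ok1 ok2 red
    by (simp add: contract_ed)
  also have "tree_chain (acc @ tp f) - tree_chain (acc @ bt f) = tree_chain acc \<star> (frag_of (ed (tp f)) - frag_of (ed (bt f)))
      + (frag_of (ed ?p @ [Inr f]) - ?y)"
    using tree_chain_append[OF o(1)] tree_chain_append[OF o(4)] by (simp add: loop_def)
  \<comment> \<open>the homotopies of the two faces that collapse \<open>f\<close> differ only in their tree chains\<close>
  finally have 1: "contract acc (ed (tp f) @ c) - contract acc (ed (bt f) @ c)
      = tree_chain acc \<star> (frag_of (ed (tp f) @ c) - frag_of (ed (bt f) @ c)) + frag_of (ed ?p @ Inr f # c) - ?y \<star> ?c"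
    by (simp add: cmul_assoc)
  have 2: "frag_extend (contract acc) (?f \<star> cube_bd c) = tree_chain acc \<star> (?f \<star> cube_bd c) - ?y \<star> frag_extend (contract []) (cube_bd c)"
    by (simp add: frag_extend_of_cmul lin_fun cmul_frag_extend[symmetric]) (simp add: of_cmul)
  have 3: "ext_cube_bd (tree_chain acc \<star> frag_of (Inr f # c)) = frag_of (ed acc @ Inr f # c) - frag_of (ed ?p @ Inr f # c)
      - tree_chain acc \<star> (frag_of (ed (tp f) @ c) - frag_of (ed (bt f) @ c) - ?f \<star> cube_bd c)"
    using Leibniz[OF tree_chain_comp_cubes[OF o(2)], of "frag_of (Inr f # c)"] tree_chain_d[OF o(2)] by simp
  have 4: "ext_cube_bd (?y \<star> contract [] c) = - (?y \<star> ext_cube_bd (contract [] c))"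
    using Leibniz[OF loop_comp_cubes[OF okp f(1)]] ext_cube_bd_loop[OF okp f(1)] by simp
  have IH': "?y \<star> ext_cube_bd (contract [] c) = ?y \<star> ?c - ?y \<star> proj [] c - ?y \<star> frag_extend (contract []) (cube_bd c)"
  proof -
    have "ext_cube_bd (contract [] c) = frag_of c - proj [] c - frag_extend (contract []) (cube_bd c)" using IH by (simp add: eq_diff_eq)
    then show ?thesis by simp
  qed
  have "ext_cube_bd (contract acc (Inr f # c)) + frag_extend (contract acc) (cube_bd (Inr f # c))
     = ext_cube_bd (tree_chain acc \<star> frag_of (Inr f # c)) - ext_cube_bd (?y \<star> contract [] c)
       + (contract acc (ed (tp f) @ c) - contract acc (ed (bt f) @ c)) - frag_extend (contract acc) (?f \<star> cube_bd c)"
    by (simp add: lin)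
  also have "\<dots> = frag_of (ed acc @ Inr f # c) - ?y \<star> proj [] c"
    unfolding 1 2 3 4 IH' by (simp add: algebra_simps)
  finally show ?case by simp
qed

lemma contract_comp_cubes: "ok (acc @ cube_top c) \<Longrightarrow> cell_set c \<subseteq> N \<Longrightarrow> contract acc c \<in> chains (comp_cubes (acc @ cube_top c) (Suc (cell_count c)))"
proof (induction c arbitrary: acc rule: cube_top.induct)
  case 1
  then show ?case using tree_chain_comp_cubes by simp
next
  case (2 e c)
  then show ?case using 2(1)[of "acc @ [e]"] by simp
next
  case (3 f c)
  have f: "f \<in> N" "f \<in> F" using 3 N_F by auto
  have ok1: "ok (acc @ tp f @ cube_top c)" using 3(2) by simp
  have o: "ok (acc @ tp f)" "ok acc" "ok (cube_top c)"
    using ok1 ok_factor[of "[]" "acc @ tp f" "cube_top c"] ok_factor[of "[]" acc "tp f @ cube_top c"]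
      ok_factor[of "acc @ tp f" "cube_top c" "[]"] by auto
  have okp: "ok (red acc @ tp f)" using ok_red_append[OF o(1)] .
  have "frag_of (Inr f # c) \<in> chains (comp_cubes (tp f @ cube_top c) (Suc (cell_count c)))"
    using 3(3) by (simp add: comp_cubes_def)
  then have 1: "tree_chain acc \<star> frag_of (Inr f # c) \<in> chains (comp_cubes (acc @ tp f @ cube_top c) (Suc (Suc (cell_count c))))"
    using cmul_comp_cubes[OF tree_chain_comp_cubes[OF o(2)], of "frag_of (Inr f # c)"] by simp
  have "loop (red acc) f \<star> contract [] c \<in> chains (comp_cubes ((red acc @ tp f) @ cube_top c) (Suc 0 + Suc (cell_count c)))"
    using 3 o by (intro cmul_comp_cubes loop_comp_cubes okp f) (use 3(1)[of "[]"] in auto)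
  moreover have "conn (acc @ tp f @ cube_top c) ((red acc @ tp f) @ cube_top c)"
    using conn_append[OF red_conn[OF o(2)] conn_refl[of "tp f @ cube_top c"]] by simp
  ultimately have "loop (red acc) f \<star> contract [] c \<in> chains (comp_cubes (acc @ tp f @ cube_top c) (Suc (Suc (cell_count c))))"
    using comp_cubes_conn by simp
  then show ?case using 1 by simp
qed

text \<open>This and the two neighbouring lemmas keep track of the component and the dimension.\<close>

lemma cycle_of_comp_cubes: "ok (acc @ cube_top c) \<Longrightarrow> cell_set c \<subseteq> N \<Longrightarrow> cycle_of acc c \<in> chains (comp_cubes (acc @ cube_top c) (cell_count c))"
proof (induction c arbitrary: acc rule: cube_top.induct)
  case 1
  then show ?case by (simp add: comp_cubes_def)
next
  case (2 e c)
  then show ?case using 2(1)[of "acc @ [e]"] by simp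
next
  case (3 f c)
  have ok1: "ok (acc @ tp f @ cube_top c)" using 3(2) by simp
  have o: "ok (acc @ tp f)" "ok (cube_top c)"
    using ok1 ok_factor[of "[]" "acc @ tp f" "cube_top c"] ok_factor[of "acc @ tp f" "cube_top c" "[]"] by auto
  have "loop acc f \<star> cycle_of [] c \<in> chains (comp_cubes ((acc @ tp f) @ cube_top c) (Suc 0 + cell_count c))"
    using 3 o by (intro cmul_comp_cubes loop_comp_cubes o) (use 3(1)[of "[]"] in auto)
  then show ?case by simp
qed

lemma collapse_map_in: "ok (acc @ cube_top c) \<Longrightarrow> cell_set c \<subseteq> N \<Longrightarrow>
  collapse_map acc c \<in> chains {x \<in> comp_cubes (acc @ cube_top c) (cell_count c). ess_word [] x}"
proof (induction c arbitrary: acc rule: cube_top.induct)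
  case 1
  then show ?case using red_red red_conn ess_word_ed[of "[]" _ "[]"] by (simp add: comp_cubes_def)
next
  case (2 e c)
  then show ?case using 2(1)[of "acc @ [e]"] by simp
next
  case (3 f c)
  have ok1: "ok (acc @ tp f @ cube_top c)" using 3(2) by simp
  have o: "ok acc" "ok (cube_top c)"
    using ok1 ok_factor[of "[]" acc "tp f @ cube_top c"] ok_factor[of "acc @ tp f" "cube_top c" "[]"] by auto
  show ?case
  proof (cases "(red acc, f) \<in> T")
    case False
    have "frag_of (ed (red acc) @ [Inr f]) \<in> chains {ed (red acc) @ [Inr f]}" by simp
    then have "frag_of (ed (red acc) @ [Inr f]) \<star> collapse_map [] c
      \<in> chains {x \<in> comp_cubes (acc @ cube_top (Inr f # c)) (cell_count (Inr f # c)). ess_word [] x}"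
    proof (rule cmul_in)
      show "collapse_map [] c \<in> chains {x \<in> comp_cubes ([] @ cube_top c) (cell_count c). ess_word [] x}"
        using 3 o by (intro 3(1)) auto
      fix a b assume a: "a \<in> {ed (red acc) @ [Inr f]}" and b: "b \<in> {x \<in> comp_cubes ([] @ cube_top c) (cell_count c). ess_word [] x}"
      have "conn (acc @ tp f @ cube_top c) (red acc @ tp f @ cube_top b)"
        using b conn_append[OF red_conn[OF o(1)] conn_append[OF conn_refl[of "tp f"], of "cube_top c" "cube_top b"]]
        by (simp add: comp_cubes_def)
      then show "a @ b \<in> {x \<in> comp_cubes (acc @ cube_top (Inr f # c)) (cell_count (Inr f # c)). ess_word [] x}"
        using a b False 3(3) red_red[OF o(1)] by (auto simp: comp_cubes_def ess_word_ed)
    qed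
    then show ?thesis using False by simp
  qed simp
qed

lemma ext_cube_bd_cycle_of: "ok (acc @ cube_top c) \<Longrightarrow> cell_set c \<subseteq> N \<Longrightarrow> ext_cube_bd (cycle_of acc c) = 0"
proof (induction c arbitrary: acc rule: cube_top.induct)
  case (2 e c)
  then show ?case using 2(1)[of "acc @ [e]"] by simp
next
  case (3 f c)
  have ok1: "ok (acc @ tp f @ cube_top c)" using 3(2) by simp
  have o: "ok (acc @ tp f)" "ok (cube_top c)"
    using ok1 ok_factor[of "[]" "acc @ tp f" "cube_top c"] ok_factor[of "acc @ tp f" "cube_top c" "[]"] by auto
  have f: "f \<in> N" using 3 by simp
  show ?case using Leibniz[OF loop_comp_cubes[OF o(1) f], of "cycle_of [] c"] ext_cube_bd_loop[OF o(1) f] 3(1)[of "[]"] o 3(3) by simp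
qed auto

text \<open>The tree chains that occur in a loop consist of edges of the forest with irreducible left part,
  so \<open>collapse_map\<close> kills every product that starts with them, and only \<open>acc f\<close> survives.\<close>

lemma collapse_map_cycle_of: "ok (acc @ cube_top c) \<Longrightarrow> cell_set c \<subseteq> N \<Longrightarrow> ess_word acc c \<Longrightarrow> frag_extend (collapse_map []) (cycle_of acc c) = frag_of (ed acc @ c)"
proof (induction c arbitrary: acc rule: cube_top.induct)
  case 1
  then show ?case using collapse_map_ed[of "[]" acc "[]"] by simp
next
  case (2 e c)
  then show ?case using 2(1)[of "acc @ [e]"] by simp
next
  case (3 f c)
  have f: "f \<in> N" "f \<in> F" using 3 N_F by auto
  have ok1: "ok (acc @ tp f @ cube_top c)" using 3(2) by simp
  have ok2: "ok (acc @ bt f @ cube_top c)" using ok1 ok_tp_bt[OF f(2)] by blast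
  have o: "ok (acc @ tp f)" "ok (cube_top c)" "ok (acc @ bt f)"
    using ok1 ok2 ok_factor[of "[]" "acc @ tp f" "cube_top c"] ok_factor[of "acc @ tp f" "cube_top c" "[]"]
      ok_factor[of "[]" "acc @ bt f" "cube_top c"] by auto
  have h0: "frag_extend (collapse_map []) (tree_chain u \<star> x) = 0" if "ok u" for u x
  proof -
    have "frag_extend (collapse_map []) (tree_chain u \<star> x) = frag_extend (\<lambda>a. 0) (tree_chain u)"
      unfolding frag_extend_cmul2
      by (rule frag_extend_cong_on[OF tree_chain_in[OF that]]) (auto simp: collapse_map_ed)
    then show ?thesis by simp
  qed
  have "frag_extend (collapse_map []) (cycle_of acc (Inr f # c))
      = frag_extend (collapse_map []) (frag_of (ed acc @ [Inr f]) \<star> cycle_of [] c)"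
    using h0[OF o(1)] h0[OF o(3)] by (simp add: loop_def lin)
  also have "\<dots> = frag_of (ed acc @ [Inr f]) \<star> frag_extend (collapse_map []) (cycle_of [] c)"
    using 3(4) by (simp add: frag_extend_of_cmul collapse_map_ed cmul_frag_extend)
  also have "\<dots> = frag_of (ed acc @ [Inr f]) \<star> frag_of c"
    using 3(1)[of "[]"] 3(3,4) o by simp
  finally show ?case by simp
qed

theorem cubes_collapse:
  assumes w: "ok w"
  shows "collapses (comp_cubes w) (\<lambda>_. ext_cube_bd) n {x \<in> comp_cubes w n. ess_word [] x} (collapse_map [])"
proof -
  have okc: "ok (cube_top c)" "cell_set c \<subseteq> N" "cell_count c = n" if "c \<in> comp_cubes w n" for c n
    using that ok_conn w by (auto simp: comp_cubes_def)
  have comp_cubes: "comp_cubes (cube_top c) m = comp_cubes w m" if "c \<in> comp_cubes w n" for c n m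
    using that by (intro comp_cubes_conn) (simp add: comp_cubes_def)
  show ?thesis
    unfolding collapses_def
  proof (intro conjI ballI impI)
    fix b assume b: "b \<in> comp_cubes w n"
    show "collapse_map [] b \<in> chains {x \<in> comp_cubes w n. ess_word [] x}"
      using collapse_map_in[of "[]" b] okc[OF b] comp_cubes[OF b] by simp
  next
    fix x assume x: "x \<in> chains (comp_cubes w (Suc n))"
    have "frag_extend (collapse_map []) (ext_cube_bd x) = frag_extend (\<lambda>c. 0) x"
      unfolding frag_extend_frag_extend
      by (rule frag_extend_cong_on[OF x]) (use collapse_map_cube_bd[of "[]"] okc in auto)
    then show "frag_extend (collapse_map []) (ext_cube_bd x) = 0" by simp
  next
    fix e assume e: "e \<in> {x \<in> comp_cubes w n. ess_word [] x}"
    then have e': "e \<in> comp_cubes w n" and ee: "ess_word [] e" by simp_all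
    have o: "ok ([] @ cube_top e)" using okc[OF e'] by simp
    have "cycle_of [] e \<in> chains (comp_cubes w n)" using cycle_of_comp_cubes[OF o okc(2)[OF e']] okc(3)[OF e'] comp_cubes[OF e'] by simp
    then show "\<exists>x \<in> chains (comp_cubes w n). (n > 0 \<longrightarrow> ext_cube_bd x = 0) \<and> frag_extend (collapse_map []) x = frag_of e"
      using ext_cube_bd_cycle_of[OF o okc(2)[OF e']] collapse_map_cycle_of[OF o okc(2)[OF e'] ee] by (intro bexI[of _ "cycle_of [] e"]) simp_all
  next
    fix x assume x: "x \<in> chains (comp_cubes w n)" and d: "n > 0 \<longrightarrow> ext_cube_bd x = 0" and p: "frag_extend (collapse_map []) x = 0"
    have "ext_cube_bd x = 0"
    proof (cases "n = 0")
      case True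
      have "ext_cube_bd x = frag_extend (\<lambda>_. 0) x"
        by (rule frag_extend_cong_on[OF x]) (use True cell_count_eq_0 okc(3) cube_bd_ed_Nil in metis)
      then show ?thesis by simp
    qed (use d in simp)
    then have s0: "frag_extend (contract []) (ext_cube_bd x) = 0" by simp
    have "frag_extend (proj []) x = frag_extend (cycle_of []) (frag_extend (collapse_map []) x)"
      unfolding frag_extend_frag_extend
      by (rule frag_extend_cong_on[OF x]) (use cycle_of_collapse_map[of "[]"] okc in auto)
    then have P0: "frag_extend (proj []) x = 0" using p by simp
    have "ext_cube_bd (frag_extend (contract []) x) + frag_extend (contract []) (ext_cube_bd x)
        = frag_extend (\<lambda>c. ext_cube_bd (contract [] c) + frag_extend (contract []) (cube_bd c)) x"
      by (simp add: frag_extend_frag_extend lin_fun)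
    also have "\<dots> = frag_extend (\<lambda>c. frag_of c - proj [] c) x"
      by (rule frag_extend_cong_on[OF x]) (use contract_homotopy[of "[]"] okc in auto)
    also have "\<dots> = x" using P0 by (simp add: lin_fun)
    finally have "ext_cube_bd (frag_extend (contract []) x) = x" using s0 by simp
    moreover have "frag_extend (contract []) x \<in> chains (comp_cubes w (Suc n))"
    proof (rule frag_extend_in_chains[OF x])
      fix c assume c: "c \<in> comp_cubes w n"
      show "contract [] c \<in> chains (comp_cubes w (Suc n))"
        using contract_comp_cubes[of "[]" c] okc[OF c] comp_cubes[OF c] by simp
    qed
    ultimately show "\<exists>y \<in> chains (comp_cubes w (Suc n)). ext_cube_bd y = x" by blast
  qed
qed

end

section \<open>Group homology from a collapse\<close>

context free_resolution
begin

lemma orbit_map_DD: "x \<in> chains (B (Suc (Suc n))) \<Longrightarrow> orbit_map D (orbit_map D x) = 0"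
proof -
  assume x: "x \<in> chains (B (Suc (Suc n)))"
  have "orbit_map D (orbit_map D x) = frag_extend (\<lambda>b. orbits (equiv_ext G D (D b))) x"
    by (simp add: orbit_map_def orbits_equiv_ext frag_extend_frag_extend)
  also have "\<dots> = frag_extend (\<lambda>b. 0) x"
    by (rule frag_extend_cong_on[OF x]) (simp add: DD orbits_lin)
  finally show ?thesis by simp
qed

end

context group
begin

text \<open>On cycles, \<open>\<psi>\<close> is a surjective homomorphism whose kernel consists of the boundaries.\<close>

lemma homology_of_collapse:
  assumes col: "collapses bar_basis (\<lambda>_. orbit_map bar_bd) n E \<psi>"
  shows "group_homology n G \<cong> free_Abelian_group E"
proof -
  interpret R: free_resolution G bar_basis bar_bd bar_fill "(\<one>, [])" by (rule bar_free_resolution)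
  let ?C = "bar_chain_group n G" and ?Z = "bar_cycles n G" and ?h = "frag_extend \<psi>"
  let ?S = "subgroup_generated ?C ?Z" and ?F = "free_Abelian_group E"
  have C: "?C = free_Abelian_group (bar_basis n)" by (simp add: bar_chain_group_def bar_basis_def)
  have carC: "carrier (bar_chain_group m G) = chains (bar_basis m)" for m
    by (auto simp: bar_chain_group_def bar_basis_def chains_iff)
  have Zc: "?Z = {x \<in> chains (bar_basis n). n > 0 \<longrightarrow> orbit_map bar_bd x = 0}"
  proof (cases n)
    case 0
    then show ?thesis by (auto simp: bar_cycles_def bar_boundary_def carC)
  next
    case (Suc m)
    then show ?thesis using bar_boundary_orbit_map[of _ m] by (auto simp: bar_cycles_def carC)
  qed
  interpret C: comm_group ?C unfolding C by (rule abelian_free_Abelian_group)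
  have sub: "subgroup ?Z ?C"
  proof
    show "?Z \<subseteq> carrier ?C" by (auto simp: Zc carC)
    show "x \<otimes>\<^bsub>?C\<^esub> y \<in> ?Z" if "x \<in> ?Z" "y \<in> ?Z" for x y
      using that by (auto simp: Zc C orbit_map_lin)
    show "\<one>\<^bsub>?C\<^esub> \<in> ?Z" by (simp add: Zc C orbit_map_lin)
    show "inv\<^bsub>?C\<^esub> x \<in> ?Z" if "x \<in> ?Z" for x
      using that by (auto simp: Zc C orbit_map_lin chains_iff)
  qed
  have carS: "carrier ?S = {x \<in> chains (bar_basis n). n > 0 \<longrightarrow> orbit_map bar_bd x = 0}"
    using subgroup.carrier_subgroup_generated_subgroup[OF sub] Zc by (rule HOL.trans)
  have h: "?h \<in> hom ?S ?F"
  proof (rule homI)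
    fix x y assume xy: "x \<in> carrier ?S" "y \<in> carrier ?S"
    have "x \<in> chains (bar_basis n)" using xy(1)[unfolded carS] by simp
    then have "?h x \<in> chains E"
      by (rule frag_extend_in_chains) (use col in \<open>simp add: collapses_def\<close>)
    then show "?h x \<in> carrier ?F" by (simp add: chains_iff)
    show "?h (x \<otimes>\<^bsub>?S\<^esub> y) = ?h x \<otimes>\<^bsub>?F\<^esub> ?h y"
      by (simp add: C lin)
  qed
  interpret h: group_hom ?S ?F ?h
    by (intro group_hom.intro group_hom_axioms.intro C.group_subgroup_generated h) simp
  have "?h ` carrier ?S = carrier ?F"
  proof
    show "?h ` carrier ?S \<subseteq> carrier ?F" using h.hom_closed by blast
    have "y \<in> ?h ` carrier ?S" if "Poly_Mapping.keys y \<subseteq> E" for y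
      using that
    proof (induction y rule: frag_induction)
      case zero
      show ?case unfolding carS by (rule image_eqI[of _ _ 0]) (simp_all add: orbit_map_lin)
    next
      case (one e)
      then obtain x where "x \<in> chains (bar_basis n)" "n > 0 \<longrightarrow> orbit_map bar_bd x = 0" "?h x = frag_of e"
        using col unfolding collapses_def by blast
      then show ?case unfolding carS by (intro image_eqI[of _ _ x]) simp_all
    next
      case (diff a b)
      then obtain x y where xy: "a = ?h x" "b = ?h y" "x \<in> carrier ?S" "y \<in> carrier ?S" by auto
      have "x - y \<in> carrier ?S" using xy(3,4) unfolding carS by (auto simp: orbit_map_lin)
      then show ?case using xy by (intro image_eqI[of _ _ "x - y"]) (simp_all add: lin)
    qed
    then show "carrier ?F \<subseteq> ?h ` carrier ?S" by auto
  qed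
  moreover have "kernel ?S ?F ?h = bar_boundaries n G"
  proof -
    have b: "bar_boundaries n G = orbit_map bar_bd ` chains (bar_basis (Suc n))"
      using bar_boundary_orbit_map[of _ n]
      by (force simp: bar_boundaries_def bar_chain_group_def bar_basis_def[symmetric] chains_def free_Abelian_group_def)
    show ?thesis
    proof
      show "kernel ?S ?F ?h \<subseteq> bar_boundaries n G"
        using col unfolding collapses_def b kernel_def carS by fastforce
      show "bar_boundaries n G \<subseteq> kernel ?S ?F ?h"
      proof
        fix x assume "x \<in> bar_boundaries n G"
        then obtain y where y: "y \<in> chains (bar_basis (Suc n))" "x = orbit_map bar_bd y" unfolding b by blast
        have "?h x = 0" using col y unfolding collapses_def by blast
        moreover have "n > 0 \<longrightarrow> orbit_map bar_bd x = 0"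
          using R.orbit_map_DD[of y "n - 1"] y by (cases n) auto
        moreover have "x \<in> chains (bar_basis n)"
          unfolding y(2) by (rule orbit_map_in_chains[OF y(1) bar_bd_in])
        ultimately show "x \<in> kernel ?S ?F ?h" unfolding kernel_def carS by simp
      qed
    qed
  qed
  ultimately show ?thesis using h.FactGroup_iso unfolding group_homology_def by simp
qed

end

context diagram_cells
begin

lemma component_comp_cubes: "component = comp_cubes w"
  by (auto simp: component_def comp_cubes_def fun_eq_iff)

lemma orbit_map_res_bd: "orbit_map res_bd x = ext_cube_bd x"
proof -
  have "orbits (coord_chain x) = frag_extend (\<lambda>q. frag_of (snd q)) x" for x
    by (simp add: orbits_def coord_chain_def frag_extend_frag_extend coord_def)
  moreover have "frag_extend (\<lambda>q. frag_of (snd q)) (cover_bd k V c) = cube_bd c" for k V c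
  proof -
    have prefix: "frag_extend (\<lambda>q. frag_of (snd q)) (prefix a x)
        = frag_of a \<star> frag_extend (\<lambda>q. frag_of (snd q)) x" for a and x :: "(nat \<times> 'f) list \<times> ('e + 'f) list \<Rightarrow>\<^sub>0 int"
      unfolding frag_extend_prefix of_cmul frag_extend_frag_extend by simp
    show ?thesis by (induction k V c rule: cover_bd.induct) (simp_all add: lin prefix)
  qed
  ultimately have "orbits (res_bd c) = cube_bd c" for c by (simp add: res_bd_def)
  then show ?thesis by (simp add: orbit_map_def)
qed

theorem diagram_group_homology:
  assumes "collapses (comp_cubes w) (\<lambda>_. ext_cube_bd) n E \<phi>"
  shows "group_homology n G \<cong> free_Abelian_group E"
proof -
  have "orbit_map res_bd = ext_cube_bd" by (rule ext) (rule orbit_map_res_bd)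
  then have "collapses component (\<lambda>_. orbit_map res_bd) n E \<phi>"
    using assms by (simp add: component_comp_cubes)
  then show ?thesis
    using collapses_transfer[OF bar_free_resolution cover_free_resolution] homology_of_collapse by blast
qed

end

section \<open>1-paths and 2-paths as words\<close>

context directed_2_complex
begin

sublocale base: wf_digraph "base K" by (rule base_wf)

abbreviation "tp f \<equiv> snd (ctop K f)"
abbreviation "bt f \<equiv> snd (cbot K f)"
abbreviation "cell_end f \<equiv> path1_end K (ctop K f)"

lemma pos_cell: "f \<in> pos_cells K \<Longrightarrow> f \<in> cells K" and neg_cell: "f \<in> neg_cells K \<Longrightarrow> f \<in> cells K"
  using orientation_cover by auto

lemma cinv_neg: "f \<in> cells K \<Longrightarrow> cinv K f \<in> neg_cells K \<longleftrightarrow> f \<notin> neg_cells K"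
proof
  assume f: "f \<in> cells K" "cinv K f \<in> neg_cells K"
  then obtain g where "g \<in> pos_cells K" "cinv K f = cinv K g" by (auto simp: neg_cells_def)
  then have "f \<in> pos_cells K" using cinv_invol f pos_cell by metis
  then show "f \<notin> neg_cells K" using orientation_disjoint by auto
qed (use orientation_cover in \<open>auto simp: neg_cells_def\<close>)

sublocale cell_system "cells K" "neg_cells K" "\<lambda>f. snd (ctop K f)" "\<lambda>f. snd (cbot K f)" "cinv K"
  by unfold_locales
     (use cinv_cell cinv_invol top_cinv bot_cinv top_nonempty bot_nonempty neg_cell cinv_neg in auto)

lemma path1_iff: "path1 K (v, u) \<longleftrightarrow> base.awalk v u (base.awlast v u)"
  by (auto simp: path1_def is_walk_def)

lemma path1_end_eq: "path1_end K (v, u) = base.awlast v u"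
  by (simp add: walk_end_def)

lemma path1_append: "path1 K (v, a @ b) \<longleftrightarrow> path1 K (v, a) \<and> path1 K (base.awlast v a, b)"
  by (simp add: path1_iff base.awlast_append)

lemma path1_hd: "path1 K (v, u) \<Longrightarrow> u \<noteq> [] \<Longrightarrow> v = tail (base K) (hd u)"
  by (cases u) (auto simp: path1_iff base.awalk_simps)

lemma path1_same_start: "path1 K (v, u) \<Longrightarrow> path1 K (v', u) \<Longrightarrow> u \<noteq> [] \<Longrightarrow> v = v'"
  using path1_hd by metis

lemma cell_paths:
  assumes "f \<in> cells K"
  shows "path1 K (fst (ctop K f), tp f)" "path1 K (fst (ctop K f), bt f)"
    "base.awlast v (tp f) = cell_end f" "base.awlast v (bt f) = cell_end f"
proof -
  show "path1 K (fst (ctop K f), tp f)" using top_path[OF assms] by simp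
  show "path1 K (fst (ctop K f), bt f)" using bot_path[OF assms] same_start[OF assms] by simp
  have "base.awlast v (tp f) = base.awlast (fst (ctop K f)) (tp f)"
    using base.awalk_verts_ne_eq[OF top_nonempty[OF assms]] by metis
  then show "base.awlast v (tp f) = cell_end f" by (simp add: walk_end_def)
  have "base.awlast v (bt f) = base.awlast (fst (cbot K f)) (bt f)"
    using base.awalk_verts_ne_eq[OF bot_nonempty[OF assms]] by metis
  then show "base.awlast v (bt f) = cell_end f" using same_end[OF assms] by (simp add: walk_end_def)
qed

text \<open>A cell fits into a 1-path at a place that is determined by vertices, and its top and its bottom
  have the same end vertices.\<close>

lemma path1_cell_iff:
  assumes "f \<in> cells K"
  shows "path1 K (v, a @ tp f @ b) \<longleftrightarrow> path1 K (v, a) \<and> base.awlast v a = fst (ctop K f) \<and> path1 K (cell_end f, b)"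
    "path1 K (v, a @ bt f @ b) \<longleftrightarrow> path1 K (v, a) \<and> base.awlast v a = fst (ctop K f) \<and> path1 K (cell_end f, b)"
proof -
  have "path1 K (x, tp f) \<longleftrightarrow> x = fst (ctop K f)" for x
    using path1_same_start[OF _ cell_paths(1)[OF assms] top_nonempty[OF assms]] cell_paths(1)[OF assms] by metis
  then show "path1 K (v, a @ tp f @ b) \<longleftrightarrow> path1 K (v, a) \<and> base.awlast v a = fst (ctop K f) \<and> path1 K (cell_end f, b)"
    unfolding path1_append cell_paths(3)[OF assms] by simp
  have "path1 K (x, bt f) \<longleftrightarrow> x = fst (ctop K f)" for x
    using path1_same_start[OF _ cell_paths(2)[OF assms] bot_nonempty[OF assms]] cell_paths(2)[OF assms] by metis
  then show "path1 K (v, a @ bt f @ b) \<longleftrightarrow> path1 K (v, a) \<and> base.awlast v a = fst (ctop K f) \<and> path1 K (cell_end f, b)"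
    unfolding path1_append cell_paths(4)[OF assms] by simp
qed

text \<open>The right part of an atomic 2-path starts where the cell ends.\<close>

definition atom_at :: "'v \<Rightarrow> 'e list \<Rightarrow> 'f \<Rightarrow> 'e list \<Rightarrow> ('v, 'e, 'f) atom" where
  "atom_at v a f b = ((v, a), f, (cell_end f, b))"

lemma is_atom_atom_at: "is_atom K (atom_at v a f b) \<longleftrightarrow> f \<in> cells K \<and> path1 K (v, a @ tp f @ b)"
  using path1_cell_iff(1)[of f v a b] by (auto simp: atom_at_def path1_end_eq)

lemma is_atom_iff: "is_atom K x \<longleftrightarrow> (\<exists>v a f b. x = atom_at v a f b \<and> f \<in> cells K \<and> path1 K (v, a @ tp f @ b))"
proof
  assume x: "is_atom K x"
  obtain v a f v' b where xx: "x = ((v, a), f, (v', b))" by (metis prod.collapse)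
  then have "x = atom_at v a f b" using x by (simp add: atom_at_def)
  then show "\<exists>v a f b. x = atom_at v a f b \<and> f \<in> cells K \<and> path1 K (v, a @ tp f @ b)"
    using x is_atom_atom_at by blast
qed (auto simp: is_atom_atom_at)

lemma atom_at_simps [simp]: "atom_top K (atom_at v a f b) = (v, a @ tp f @ b)" "atom_bot K (atom_at v a f b) = (v, a @ bt f @ b)"
  by (simp_all add: atom_at_def walk_append_def)

lemma atom_at_inv: "f \<in> cells K \<Longrightarrow> atom_inv K (atom_at v a f b) = atom_at v a (cinv K f) b"
  using same_end[of f] top_cinv[of f] by (simp add: atom_at_def)

sublocale sq: wf_digraph "squier_graph K"
proof
  fix e assume "e \<in> arcs (squier_graph K)"
  then obtain v a f b where e: "e = atom_at v a f b" "f \<in> cells K" "path1 K (v, a @ tp f @ b)"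
    by (auto simp: squier_graph_def is_atom_iff)
  show "tail (squier_graph K) e \<in> verts (squier_graph K)" "head (squier_graph K) e \<in> verts (squier_graph K)"
    using e path1_cell_iff[OF e(2)] by (simp_all add: squier_graph_def)
qed

lemma squier_sel [simp]: "verts (squier_graph K) = Collect (path1 K)" "arcs (squier_graph K) = Collect (is_atom K)"
  "tail (squier_graph K) = atom_top K" "head (squier_graph K) = atom_bot K"
  by (simp_all add: squier_graph_def)

lemma sq_last: "sq.awalk x es y \<Longrightarrow> sq.awlast x es = y"
  by (auto elim: sq.awalkE')

lemma path2_iff: "path2 K (x, es) \<longleftrightarrow> sq.awalk x es (sq.awlast x es)"
  unfolding path2_def is_walk_def fst_conv snd_conv using sq_last by metis

lemma path2_bot_eq: "path2_bot K (x, es) = sq.awlast x es"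
  by (simp add: path2_bot_def walk_end_def)

definition word_of :: "('v, 'e, 'f) atom list \<Rightarrow> (nat \<times> 'f) list" where
  "word_of es = rev (map (\<lambda>(p, f, q). (length (snd p), f)) es)"

lemma word_of_simps [simp]: "word_of [] = []" "word_of (es @ es') = word_of es' @ word_of es" "word_of (atom_at v a f b # es) = word_of es @ [(length a, f)]"
  by (simp_all add: word_of_def atom_at_def)

lemma word_of_cells: "sq.awalk x es y \<Longrightarrow> snd ` set (word_of es) \<subseteq> cells K"
proof (induction es arbitrary: x)
  case (Cons e es)
  have w: "sq.awalk (atom_bot K e) es y" and e: "is_atom K e"
    using Cons.prems by (simp_all add: sq.awalk_simps)
  obtain v a f b where "e = atom_at v a f b" "f \<in> cells K" using e is_atom_iff by blast
  then show ?case using Cons.IH[OF w] by simp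
qed simp

lemma runs_word_of: "sq.awalk (v, u) es y \<Longrightarrow> fst y = v \<and> runs u (word_of es) (snd y)"
proof (induction es arbitrary: u)
  case Nil
  then show ?case by (auto simp: sq.awalk_simps)
next
  case (Cons e es)
  then obtain v' a f b where e: "e = atom_at v' a f b" "f \<in> cells K"
    by (auto simp: sq.awalk_simps is_atom_iff)
  then have vv: "v' = v" "u = a @ tp f @ b" and w: "sq.awalk (v, a @ bt f @ b) es y"
    using Cons.prems by (auto simp: sq.awalk_simps)
  have "step u (length a, f) (a @ bt f @ b)" by (auto simp: step_def vv)
  then show ?case using Cons.IH[OF w] e by (auto simp: runs_append)
qed

lemma walk_of_word:
  "runs u V u' \<Longrightarrow> snd ` set V \<subseteq> cells K \<Longrightarrow> path1 K (v, u) \<Longrightarrow> \<exists>es. sq.awalk (v, u) es (v, u') \<and> word_of es = V"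
proof (induction V arbitrary: u')
  case Nil
  then show ?case by (intro exI[of _ "[]"]) (simp add: sq.awalk_simps)
next
  case (Cons x V)
  then obtain u1 where u1: "runs u V u1" "step u1 x u'" by auto
  then obtain es where es: "sq.awalk (v, u) es (v, u1)" "word_of es = V"
    using Cons.IH[OF u1(1)] Cons.prems by auto
  obtain p q where pq: "u1 = p @ tp (snd x) @ q" "length p = fst x" "u' = p @ bt (snd x) @ q"
    using u1 by (auto simp: step_def)
  have x: "snd x \<in> cells K" using Cons by auto
  have "path1 K (v, u1)" using es(1) by auto
  then have "sq.awalk (v, u1) [atom_at v p (snd x) q] (v, u')"
    using pq x path1_cell_iff[OF x] by (simp add: sq.awalk_simps is_atom_atom_at)
  then have "sq.awalk (v, u) (es @ [atom_at v p (snd x) q]) (v, u')"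
    using es(1) by (intro sq.awalk_appendI)
  moreover have "word_of (es @ [atom_at v p (snd x) q]) = x # V" using es(2) pq by (cases x) simp
  ultimately show ?case by blast
qed

lemma word_of_inj: "sq.awalk x es y \<Longrightarrow> sq.awalk x es' y' \<Longrightarrow> word_of es = word_of es' \<Longrightarrow> es = es'"
proof (induction es arbitrary: x es')
  case Nil
  then show ?case by (simp add: word_of_def)
next
  case (Cons e es)
  then obtain e' es'' where es': "es' = e' # es''" by (cases es') (auto simp: word_of_def)
  obtain v a f b where e: "e = atom_at v a f b" using Cons by (auto simp: sq.awalk_simps is_atom_iff)
  obtain v' a' f' b' where e': "e' = atom_at v' a' f' b'" using Cons es' by (auto simp: sq.awalk_simps is_atom_iff)
  have "word_of es = word_of es''" "length a = length a'" "f = f'"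
    using Cons.prems(3) by (simp_all add: e e' es')
  moreover have "(v, a @ tp f @ b) = (v', a' @ tp f' @ b')"
    using Cons.prems(1,2) by (auto simp: e e' es' sq.awalk_simps)
  ultimately have "e = e'" "word_of es = word_of es''" by (auto simp: e e')
  moreover have "sq.awalk (atom_bot K e) es y" "sq.awalk (atom_bot K e') es'' y'"
    using Cons.prems es' by (simp_all add: sq.awalk_simps)
  ultimately show ?case using Cons.IH es' by metis
qed

lemma path1_cat:
  assumes "path1 K p" "path1 K q" "path1_end K p = fst q"
  shows "path1 K (p \<cdot> q)" "path1_end K (p \<cdot> q) = path1_end K q"
  using assms path1_append[of "fst p" "snd p" "snd q"]
  by (auto simp: walk_append_def walk_end_def base.awlast_append)

lemma mul_nf: "normal_word V \<Longrightarrow> snd ` set U \<subseteq> cells K \<Longrightarrow> mul V (mul [] U) = mul V U"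
  using mul_mul[of V "[]" U] by simp

text \<open>One half of the solution of the word problem: the normal form is an invariant of homotopy.\<close>

lemma homotopic_nf:
  "homotopic K \<delta> \<epsilon> \<Longrightarrow> fst \<delta> = fst \<epsilon> \<and> (\<exists>y. sq.awalk (fst \<delta>) (snd \<delta>) y \<and> sq.awalk (fst \<epsilon>) (snd \<epsilon>) y)
    \<and> mul [] (word_of (snd \<delta>)) = mul [] (word_of (snd \<epsilon>))"
proof (induction rule: homotopic.induct)
  case (refl \<delta>)
  then show ?case by (auto simp: path2_def is_walk_def)
next
  case (trans \<delta> \<epsilon> \<zeta>)
  then obtain y z where "sq.awalk (fst \<delta>) (snd \<delta>) y" "sq.awalk (fst \<epsilon>) (snd \<epsilon>) y"
    "sq.awalk (fst \<epsilon>) (snd \<epsilon>) z" "sq.awalk (fst \<zeta>) (snd \<zeta>) z" by auto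
  moreover then have "y = z" using sq_last by metis
  ultimately show ?case using trans.IH by metis
next
  case (append_left \<delta> \<epsilon> \<zeta>)
  have z: "sq.awalk (fst \<zeta>) (snd \<zeta>) (fst \<delta>)"
    using append_left path2_iff[of "fst \<zeta>" "snd \<zeta>"] path2_bot_eq[of "fst \<zeta>" "snd \<zeta>"] by simp
  obtain y where y: "sq.awalk (fst \<delta>) (snd \<delta>) y" "sq.awalk (fst \<epsilon>) (snd \<epsilon>) y" using append_left by auto
  have n: "normal_word (mul [] (word_of (snd \<zeta>)))" using word_of_cells[OF z] by (intro normal_word_mul) auto
  have "mul [] (word_of (snd \<zeta> @ snd \<delta>)) = mul (mul [] (word_of (snd \<zeta>))) (mul [] (word_of (snd \<delta>)))"
    using mul_nf[OF n word_of_cells[OF y(1)]] by simp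
  moreover have "mul [] (word_of (snd \<zeta> @ snd \<epsilon>)) = mul (mul [] (word_of (snd \<zeta>))) (mul [] (word_of (snd \<epsilon>)))"
    using mul_nf[OF n word_of_cells[OF y(2)]] by simp
  ultimately have "mul [] (word_of (snd \<zeta> @ snd \<delta>)) = mul [] (word_of (snd \<zeta> @ snd \<epsilon>))" using append_left by simp
  moreover have "sq.awalk (fst \<zeta>) (snd \<zeta> @ snd \<delta>) y" "sq.awalk (fst \<zeta>) (snd \<zeta> @ snd \<epsilon>) y"
    using sq.awalk_appendI z y append_left.IH by metis+
  ultimately show ?case unfolding walk_append_def fst_conv snd_conv by blast
next
  case (append_right \<delta> \<epsilon> \<zeta>)
  obtain y where y: "sq.awalk (fst \<delta>) (snd \<delta>) y" "sq.awalk (fst \<epsilon>) (snd \<epsilon>) y" using append_right by auto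
  then have "y = path2_bot K \<delta>" by (auto simp: path2_bot_def walk_end_def)
  then obtain z where z: "sq.awalk y (snd \<zeta>) z" using append_right by (auto simp: path2_def is_walk_def)
  have "sq.awalk (fst \<delta>) (snd \<delta> @ snd \<zeta>) z" "sq.awalk (fst \<epsilon>) (snd \<epsilon> @ snd \<zeta>) z"
    using sq.awalk_appendI[OF _ z] y by blast+
  moreover have "mul [] (word_of (snd \<delta> @ snd \<zeta>)) = mul [] (word_of (snd \<epsilon> @ snd \<zeta>))"
    using append_right.IH by simp
  ultimately show ?case using append_right.IH unfolding walk_append_def fst_conv snd_conv by blast
next
  case (cancel a)
  then obtain v p f q where a: "a = atom_at v p f q" "f \<in> cells K" "path1 K (v, p @ tp f @ q)"
    by (auto simp: is_atom_iff)
  have "sq.awalk (v, p @ tp f @ q) [a, atom_inv K a] (v, p @ tp f @ q)"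
    using a path1_cell_iff[OF a(2), of v p q] cinv_cell[OF a(2)] top_cinv bot_cinv
    by (simp add: sq.awalk_simps atom_at_inv is_atom_atom_at)
  moreover have "sq.awalk (v, p @ tp f @ q) [] (v, p @ tp f @ q)" using a by (simp add: sq.awalk_simps)
  moreover have "mul [] (word_of [a, atom_inv K a]) = []"
    using a push_inv[of "[]" f "length p"] by (simp add: atom_at_inv del: push.simps(2))
  ultimately show ?case using a by auto
next
  case (exchange p f q g r)
  obtain v P where p: "p = (v, P)" by (cases p)
  obtain Q' where q: "q = (cell_end f, Q')" using exchange(7) by (cases q) simp
  obtain R where r: "r = (cell_end g, R)" using exchange(9) by (cases r) simp
  have top: "path1 K (v, P @ tp f @ Q' @ tp g @ R)"
    using exchange(1-6,8) path1_cell_iff(1)[of f v P "Q' @ tp g @ R"] path1_cell_iff(1)[of g "cell_end f" Q' R]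
    by (simp add: p q r path1_end_eq)
  have 1: "(p, f, q \<cdot> ctop K g \<cdot> r) = atom_at v P f (Q' @ tp g @ R)" "(p \<cdot> cbot K f \<cdot> q, g, r) = atom_at v (P @ bt f @ Q') g R"
    "(p \<cdot> ctop K f \<cdot> q, g, r) = atom_at v (P @ tp f @ Q') g R" "(p, f, q \<cdot> cbot K g \<cdot> r) = atom_at v P f (Q' @ bt g @ R)"
    "p \<cdot> ctop K f \<cdot> q \<cdot> ctop K g \<cdot> r = (v, P @ tp f @ Q' @ tp g @ R)"
    by (simp_all add: atom_at_def walk_append_def p q r)
  have top2: "path1 K (v, P @ bt f @ Q' @ tp g @ R)" "path1 K (v, P @ tp f @ Q' @ bt g @ R)"
     "path1 K (v, P @ bt f @ Q' @ bt g @ R)"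
    using top path1_cell_iff[OF exchange(2), of v P "Q' @ tp g @ R"] path1_cell_iff[OF exchange(2), of v P "Q' @ bt g @ R"]
      path1_cell_iff[OF exchange(4), of v "P @ tp f @ Q'" R] by auto
  have "sq.awalk (v, P @ tp f @ Q' @ tp g @ R) [atom_at v P f (Q' @ tp g @ R), atom_at v (P @ bt f @ Q') g R] (v, P @ bt f @ Q' @ bt g @ R)"
   "sq.awalk (v, P @ tp f @ Q' @ tp g @ R) [atom_at v (P @ tp f @ Q') g R, atom_at v P f (Q' @ bt g @ R)] (v, P @ bt f @ Q' @ bt g @ R)"
    using exchange(2,4) top top2 by (simp_all add: sq.awalk_simps is_atom_atom_at)
  moreover have "length P + length (bt f) + length Q' - length (bt f) + length (tp f)
      = length P + length (tp f) + length Q'" by simp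
  then have "push (length P + length (bt f) + length Q', g) (push (length P, f) [])
     = push (length P, f) (push (length P + length (tp f) + length Q', g) [])"
    using push_exchange[of "[]" f g "length P" "length P + length (bt f) + length Q'"] exchange(2,4)
    by (simp del: push.simps) (simp only: ac_simps)
  ultimately show ?case unfolding 1 by (auto simp: add.assoc simp del: push.simps)
qed metis

end

text \<open>1-paths and 2-paths are pairs that are better left unsplit in quantified formulas.\<close>

declare split_paired_All [simp del] split_paired_Ex [simp del]

section \<open>The diagram group as a group of normal words\<close>

context directed_2_complex
begin

lemma homotopic_refl: "sq.awalk x es y \<Longrightarrow> homotopic K (x, es) (x, es)"
  by (rule homotopic.refl) (unfold path2_def is_walk_def fst_conv snd_conv, rule exI)

lemma homotopic_append_left:
  assumes "homotopic K (y, es) (y, es')" "sq.awalk x fs y"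
  shows "homotopic K (x, fs @ es) (x, fs @ es')"
  using homotopic.append_left[OF assms(1), of "(x, fs)"] assms(2) path2_iff[of x fs] path2_bot_eq[of x fs] sq_last[OF assms(2)]
  by (simp add: walk_append_def)

lemma homotopic_append_right:
  assumes "homotopic K (x, es) (x, es')" "sq.awalk x es y" "sq.awalk y fs z"
  shows "homotopic K (x, es @ fs) (x, es' @ fs)"
  using homotopic.append_right[OF assms(1), of "(y, fs)"] assms(2,3) path2_iff[of y fs] path2_bot_eq[of x es] sq_last[OF assms(2)] sq_last[OF assms(3)]
  by (simp add: walk_append_def)

lemma homotopic_walks:
  assumes "homotopic K (x, es) (x, es')" "sq.awalk x es y"
  shows "sq.awalk x es' y"
  using homotopic_nf[OF assms(1)] assms(2) sq_last by (metis fst_conv snd_conv)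

lemma homotopic_exchange:
  assumes f: "f \<in> cells K" and g: "g \<in> cells K" and path: "path1 K (v, p @ tp f @ r @ tp g @ q)"
  shows "homotopic K
    ((v, p @ tp f @ r @ tp g @ q), [atom_at v p f (r @ tp g @ q), atom_at v (p @ bt f @ r) g q])
    ((v, p @ tp f @ r @ tp g @ q), [atom_at v (p @ tp f @ r) g q, atom_at v p f (r @ bt g @ q)])"
proof -
  have 1: "path1 K (v, p)" "base.awlast v p = fst (ctop K f)" "path1 K (cell_end f, r @ tp g @ q)"
    using path1_cell_iff(1)[OF f, of v p "r @ tp g @ q"] path by auto
  then have 2: "path1 K (cell_end f, r)" "base.awlast (cell_end f) r = fst (ctop K g)" "path1 K (cell_end g, q)"
    using path1_cell_iff(1)[OF g, of "cell_end f" r q] by auto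
  have "homotopic K ((v, p) \<cdot> ctop K f \<cdot> (cell_end f, r) \<cdot> ctop K g \<cdot> (cell_end g, q),
      [((v, p), f, (cell_end f, r) \<cdot> ctop K g \<cdot> (cell_end g, q)), ((v, p) \<cdot> cbot K f \<cdot> (cell_end f, r), g, (cell_end g, q))])
    ((v, p) \<cdot> ctop K f \<cdot> (cell_end f, r) \<cdot> ctop K g \<cdot> (cell_end g, q),
      [((v, p) \<cdot> ctop K f \<cdot> (cell_end f, r), g, (cell_end g, q)), ((v, p), f, (cell_end f, r) \<cdot> cbot K g \<cdot> (cell_end g, q))])"
    by (rule homotopic.exchange) (use 1 2 f g in \<open>simp_all add: path1_end_eq\<close>)
  then show ?thesis by (simp add: walk_append_def atom_at_def)
qed

text \<open>The other half: each step of \<open>push\<close> is a homotopy.\<close>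

lemma walk_push:
  assumes "sq.awalk x es (atom_top K (atom_at v p f q))" "is_atom K (atom_at v p f q)"
  shows "\<exists>es'. homotopic K (x, es @ [atom_at v p f q]) (x, es') \<and> word_of es' = push (length p, f) (word_of es)"
  using assms
proof (induction es arbitrary: v p f q rule: rev_induct)
  case Nil
  then have "sq.awalk x [atom_at v p f q] (atom_bot K (atom_at v p f q))"
    using path1_cell_iff[of f v p q] by (simp add: sq.awalk_simps is_atom_atom_at)
  then show ?case
    by (intro exI[of _ "[atom_at v p f q]"]) (simp add: homotopic_refl)
next
  case (snoc b es)
  let ?a = "atom_at v p f q"
  have f: "f \<in> cells K" and pa: "path1 K (v, p @ tp f @ q)" using snoc.prems(2) by (simp_all add: is_atom_atom_at)
  have es: "sq.awalk x es (atom_top K b)" and b1: "sq.awalk (atom_top K b) [b] (atom_top K ?a)"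
    using snoc.prems(1) by (auto simp: sq.awalk_simps)
  then have "is_atom K b" "atom_bot K b = atom_top K ?a" by (auto simp: sq.awalk_simps)
  then obtain v' p' g q' where b: "b = atom_at v' p' g q'" and g: "g \<in> cells K"
    and pb: "path1 K (v', p' @ tp g @ q')" by (auto simp: is_atom_iff)
  have vv: "v' = v" and eq: "p' @ bt g @ q' = p @ tp f @ q"
    using \<open>atom_bot K b = atom_top K ?a\<close> by (simp_all add: b)
  have full: "sq.awalk x ((es @ [b]) @ [?a]) (atom_bot K ?a)"
    using snoc.prems path1_cell_iff[OF f, of v p q] by (intro sq.awalk_appendI[OF snoc.prems(1)]) (simp add: sq.awalk_simps is_atom_atom_at)
  consider (r) "length p \<ge> length p' + length (bt g)" | (c) "length p < length p' + length (bt g)" "length p = length p'" "g = cinv K f"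
    | (s) "length p < length p' + length (bt g)" "\<not> (length p = length p' \<and> g = cinv K f)" by linarith
  then show ?case
  proof cases
    case r
    have "(p' @ bt g) @ q' = p @ (tp f @ q)" "length (p' @ bt g) \<le> length p" using eq r by simp_all
    \<comment> \<open>the new cell lies to the right of the cell of \<open>b\<close> and already occurs in the top of \<open>b\<close>\<close>
    then obtain r0 where r0: "p = p' @ bt g @ r0" "q' = r0 @ tp f @ q"
      by (auto simp: append_eq_append_conv2)
    let ?a' = "atom_at v (p' @ tp g @ r0) f q" and ?b' = "atom_at v p' g (r0 @ bt f @ q)"
    have path: "path1 K (v, p' @ tp g @ r0 @ tp f @ q)" using pb r0 vv by simp
    have ba: "homotopic K (atom_top K b, [b, ?a]) (atom_top K b, [?a', ?b'])"
      using homotopic_exchange[OF g f path] by (simp add: b vv r0)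
    have a': "is_atom K ?a'" "sq.awalk x es (atom_top K ?a')"
      using path f es by (simp_all add: is_atom_atom_at b vv r0)
    have path2: "path1 K (v, p' @ tp g @ r0 @ bt f @ q)"
      using path path1_cell_iff[OF f, of v "p' @ tp g @ r0" q] by simp
    have path3: "path1 K (v, p' @ bt g @ r0 @ bt f @ q)"
      using path2 path1_cell_iff[OF g, of v "p'" "r0 @ bt f @ q"] by simp
    have wa: "sq.awalk x (es @ [?a']) (atom_top K ?b')"
      using a' path2 f by (intro sq.awalk_appendI[OF a'(2)]) (simp add: sq.awalk_simps is_atom_atom_at)
    have wb: "sq.awalk (atom_top K ?b') [?b'] (atom_bot K ?b')"
      using path2 path3 g by (simp add: sq.awalk_simps is_atom_atom_at)
    obtain es1 where es1: "homotopic K (x, es @ [?a']) (x, es1)"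
      "word_of es1 = push (length (p' @ tp g @ r0), f) (word_of es)"
      using snoc.IH[OF a'(2,1)] by blast
    have "homotopic K (x, es @ [b, ?a]) (x, es @ [?a', ?b'])"
      by (rule homotopic_append_left[OF ba es])
    moreover have "homotopic K (x, (es @ [?a']) @ [?b']) (x, es1 @ [?b'])"
      by (rule homotopic_append_right[OF es1(1) wa wb])
    ultimately have "homotopic K (x, (es @ [b]) @ [?a]) (x, es1 @ [?b'])"
      by (simp, blast intro: homotopic.trans)
    moreover have "word_of (es1 @ [?b']) = push (length p, f) (word_of (es @ [b]))"
      using es1(2) r by (simp add: b r0 algebra_simps)
    ultimately show ?thesis by blast
  next
    case c
    have bg: "bt g = tp f" using c(3) bot_cinv[OF f] by simp
    have pq: "p' = p" "q' = q" using eq c(2) bg by simp_all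
    have "cinv K g = f" using c(3) cinv_invol[OF f] by simp
    then have ab: "?a = atom_inv K b" unfolding b vv pq atom_at_inv[OF g] by simp
    have "homotopic K (atom_top K b, [b, ?a]) (atom_top K b, [])"
      unfolding ab by (rule homotopic.cancel[OF \<open>is_atom K b\<close>])
    then have "homotopic K (x, es @ [b, ?a]) (x, es @ [])" by (rule homotopic_append_left[OF _ es])
    moreover have "word_of es = push (length p, f) (word_of (es @ [b]))"
      using c(1) bt_ne[OF g] by (simp add: b pq c(3)[symmetric])
    ultimately show ?thesis by (intro exI[of _ es]) simp
  next
    case s
    have "word_of ((es @ [b]) @ [?a]) = push (length p, f) (word_of (es @ [b]))" using s by (auto simp: b)
    then show ?thesis using homotopic_refl[OF full] by blast
  qed
qed

lemma walk_normalize: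
  assumes "sq.awalk x es y"
  shows "\<exists>es'. homotopic K (x, es) (x, es') \<and> word_of es' = mul [] (word_of es)"
  using assms
proof (induction es arbitrary: y rule: rev_induct)
  case Nil
  then show ?case by (intro exI[of _ "[]"]) (simp add: homotopic_refl)
next
  case (snoc a es)
  have es: "sq.awalk x es (atom_top K a)" and a: "sq.awalk (atom_top K a) [a] y"
    using snoc.prems by (auto simp: sq.awalk_simps)
  then have "is_atom K a" by (simp add: sq.awalk_simps)
  then obtain v p f q where aa: "a = atom_at v p f q" by (auto simp: is_atom_iff)
  obtain es1 where es1: "homotopic K (x, es) (x, es1)" "word_of es1 = mul [] (word_of es)" using snoc.IH[OF es] by blast
  have "sq.awalk x es1 (atom_top K a)" by (rule homotopic_walks[OF es1(1) es])
  then obtain es2 where es2: "homotopic K (x, es1 @ [a]) (x, es2)" "word_of es2 = push (length p, f) (word_of es1)"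
    using walk_push \<open>is_atom K a\<close> unfolding aa by blast
  have "homotopic K (x, es @ [a]) (x, es1 @ [a])" by (rule homotopic_append_right[OF es1(1) es a])
  then have "homotopic K (x, es @ [a]) (x, es2)" using es2(1) by (rule homotopic.trans)
  then show ?case using es2(2) es1(2) by (auto simp: aa)
qed

lemma homotopic_of_nf:
  assumes "sq.awalk x es y" "sq.awalk x es' y'" "mul [] (word_of es) = mul [] (word_of es')"
  shows "homotopic K (x, es) (x, es')"
proof -
  obtain e1 where e1: "homotopic K (x, es) (x, e1)" "word_of e1 = mul [] (word_of es)"
    using walk_normalize[OF assms(1)] by blast
  obtain e2 where e2: "homotopic K (x, es') (x, e2)" "word_of e2 = mul [] (word_of es')"
    using walk_normalize[OF assms(2)] by blast
  have "e1 = e2"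
    using word_of_inj[OF homotopic_walks[OF e1(1) assms(1)] homotopic_walks[OF e2(1) assms(2)]] e1 e2 assms(3) by simp
  then show ?thesis using e1(1) homotopic.sym[OF e2(1)] by (simp only:) (rule homotopic.trans)
qed

definition hclass where "hclass \<delta> = homotopy K `` {\<delta>}"

lemma in_hclass: "\<epsilon> \<in> hclass \<delta> \<longleftrightarrow> homotopic K \<delta> \<epsilon>"
  by (simp add: hclass_def homotopy_def)

lemma hclass_eq: "homotopic K \<delta> \<epsilon> \<Longrightarrow> hclass \<delta> = hclass \<epsilon>"
  using homotopic.trans homotopic.sym in_hclass by blast

text \<open>The normal form of a homotopy class, computed from any representative.\<close>

definition \<theta> where "\<theta> A = mul [] (word_of (snd (SOME \<delta>. \<delta> \<in> A)))"

lemma \<theta>_hclass: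
  assumes "sq.awalk x es y"
  shows "\<theta> (hclass (x, es)) = mul [] (word_of es)"
proof -
  have "(x, es) \<in> hclass (x, es)" using homotopic_refl[OF assms] by (simp add: in_hclass)
  then have "(SOME \<delta>. \<delta> \<in> hclass (x, es)) \<in> hclass (x, es)" by (rule someI)
  then have h: "homotopic K (x, es) (SOME \<delta>. \<delta> \<in> hclass (x, es))" by (simp only: in_hclass)
  show ?thesis using conjunct2[OF conjunct2[OF homotopic_nf[OF h]]] by (simp add: \<theta>_def)
qed

context
  fixes w :: "('v, 'e) walk"
  assumes w: "path1 K w"
begin

abbreviation "DG \<equiv> diagram_group K w"

lemma carrier_DG: "A \<in> carrier DG \<longleftrightarrow> (\<exists>es. sq.awalk w es w \<and> A = hclass (w, es))"
proof -
  have "carrier DG = {\<delta>. path2 K \<delta> \<and> fst \<delta> = w \<and> path2_bot K \<delta> = w} // homotopy K"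
    by (simp add: diagram_group_def)
  then have "A \<in> carrier DG \<longleftrightarrow> (\<exists>\<delta>. path2 K \<delta> \<and> fst \<delta> = w \<and> path2_bot K \<delta> = w \<and> A = hclass \<delta>)"
    unfolding quotient_def hclass_def by blast
  moreover have "path2 K (w, es) \<and> path2_bot K (w, es) = w \<longleftrightarrow> sq.awalk w es w" for es
    using path2_iff path2_bot_eq sq_last by metis
  ultimately show ?thesis by (metis prod.collapse fst_conv)
qed

lemma mult_DG:
  assumes es: "sq.awalk w es w" and fs: "sq.awalk w fs w"
  shows "hclass (w, es) \<otimes>\<^bsub>DG\<^esub> hclass (w, fs) = hclass (w, es @ fs)"
proof -
  have "hclass (\<delta> \<cdot> \<epsilon>) = hclass (w, es @ fs)" if "\<delta> \<in> hclass (w, es)" "\<epsilon> \<in> hclass (w, fs)" for \<delta> \<epsilon>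
  proof -
    have hd: "homotopic K (w, es) \<delta>" and he: "homotopic K (w, fs) \<epsilon>" using that by (simp_all only: in_hclass)
    obtain es' where d: "\<delta> = (w, es')" "homotopic K (w, es) (w, es')"
      using homotopic_nf[OF hd] hd by (metis prod.collapse fst_conv)
    obtain fs' where e: "\<epsilon> = (w, fs')" "homotopic K (w, fs) (w, fs')"
      using homotopic_nf[OF he] he by (metis prod.collapse fst_conv)
    have "homotopic K (w, es @ fs) (w, es' @ fs)" by (rule homotopic_append_right[OF d(2) es fs])
    moreover have "homotopic K (w, es' @ fs) (w, es' @ fs')"
      by (rule homotopic_append_left[OF e(2) homotopic_walks[OF d(2) es]])
    ultimately have "homotopic K (w, es @ fs) (w, es' @ fs')" by (rule homotopic.trans)
    then show ?thesis using hclass_eq by (simp add: d e walk_append_def)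
  qed
  moreover have "(w, es) \<in> hclass (w, es)" "(w, fs) \<in> hclass (w, fs)" using homotopic_refl es fs by (simp_all add: in_hclass)
  moreover have "hclass (w, es) \<otimes>\<^bsub>DG\<^esub> hclass (w, fs) = (\<Union>\<delta>\<in>hclass (w, es). \<Union>\<epsilon>\<in>hclass (w, fs). hclass (\<delta> \<cdot> \<epsilon>))"
    by (simp add: diagram_group_def hclass_def)
  ultimately show ?thesis by auto
qed

lemma one_DG: "\<one>\<^bsub>DG\<^esub> = hclass (w, [])"
  by (simp add: diagram_group_def hclass_def)

lemma empty_walk: "sq.awalk w [] w"
  using w by (simp add: sq.awalk_simps)

lemma \<theta>_bij: "bij_betw \<theta> (carrier DG) {V. normal_word V \<and> runs (snd w) V (snd w)}"
proof (rule bij_betw_imageI)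
  show "inj_on \<theta> (carrier DG)"
  proof (rule inj_onI)
    fix A B assume "A \<in> carrier DG" "B \<in> carrier DG" and eq: "\<theta> A = \<theta> B"
    then obtain es fs where es: "sq.awalk w es w" "A = hclass (w, es)" and fs: "sq.awalk w fs w" "B = hclass (w, fs)"
      by (auto simp: carrier_DG)
    then show "A = B" using homotopic_of_nf[OF es(1) fs(1)] eq \<theta>_hclass hclass_eq by simp
  qed
  show "\<theta> ` carrier DG = {V. normal_word V \<and> runs (snd w) V (snd w)}"
  proof (rule equalityI; rule subsetI)
    fix V assume "V \<in> \<theta> ` carrier DG"
    then obtain es where es: "sq.awalk w es w" "V = mul [] (word_of es)" by (auto simp: carrier_DG \<theta>_hclass)
    have "runs (snd w) (word_of es) (snd w)" using runs_word_of[of "fst w" "snd w" es w] es by simp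
    then show "V \<in> {V. normal_word V \<and> runs (snd w) V (snd w)}"
      using es word_of_cells[OF es(1)] runs_mul[of "snd w" "[]" "snd w" "word_of es" "snd w"] normal_word_mul[of "[]" "word_of es"] by simp
  next
    fix V assume V: "V \<in> {V. normal_word V \<and> runs (snd w) V (snd w)}"
    then obtain es where es: "sq.awalk (fst w, snd w) es (fst w, snd w)" "word_of es = V"
      using walk_of_word[of "snd w" V "snd w" "fst w"] w normal_word_cells by auto
    then have "\<theta> (hclass (w, es)) = V" using V mul_Nil by (simp add: \<theta>_hclass)
    moreover have "hclass (w, es) \<in> carrier DG" using es by (auto simp: carrier_DG)
    ultimately show "V \<in> \<theta> ` carrier DG" by blast
  qed
qed

lemma mult_closed: "A \<in> carrier DG \<Longrightarrow> B \<in> carrier DG \<Longrightarrow> A \<otimes>\<^bsub>DG\<^esub> B \<in> carrier DG"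
proof -
  assume "A \<in> carrier DG" "B \<in> carrier DG"
  then obtain es fs where es: "sq.awalk w es w" "A = hclass (w, es)" and fs: "sq.awalk w fs w" "B = hclass (w, fs)"
    unfolding carrier_DG by blast
  have "A \<otimes>\<^bsub>DG\<^esub> B = hclass (w, es @ fs)" unfolding es(2) fs(2) by (rule mult_DG[OF es(1) fs(1)])
  then show ?thesis unfolding carrier_DG using sq.awalk_appendI[OF es(1) fs(1)] by blast
qed

lemma \<theta>_mult:
  assumes "A \<in> carrier DG" "B \<in> carrier DG"
  shows "\<theta> (A \<otimes>\<^bsub>DG\<^esub> B) = mul (\<theta> A) (\<theta> B)"
proof -
  obtain es fs where es: "sq.awalk w es w" "A = hclass (w, es)" and fs: "sq.awalk w fs w" "B = hclass (w, fs)"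
    using assms by (auto simp: carrier_DG)
  have n: "normal_word (mul [] (word_of es))" using word_of_cells[OF es(1)] by (intro normal_word_mul) auto
  have "\<theta> (A \<otimes>\<^bsub>DG\<^esub> B) = mul [] (word_of (es @ fs))"
    using es fs by (simp only: mult_DG \<theta>_hclass[OF sq.awalk_appendI[OF es(1) fs(1)]])
  also have "\<dots> = mul (mul [] (word_of es)) (mul [] (word_of fs))"
    using mul_nf[OF n word_of_cells[OF fs(1)]] by simp
  finally show ?thesis using es fs by (simp add: \<theta>_hclass)
qed

lemma one_closed: "\<one>\<^bsub>DG\<^esub> \<in> carrier DG"
  using empty_walk by (auto simp: one_DG carrier_DG)

lemma \<theta>_one: "\<theta> \<one>\<^bsub>DG\<^esub> = []"
  by (simp add: one_DG \<theta>_hclass[OF empty_walk])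

text \<open>The group laws are inherited from normal words along the injection \<open>\<theta>\<close>.\<close>

lemma group_DG: "group DG"
proof (rule groupI)
  have inj: "A = B" if "A \<in> carrier DG" "B \<in> carrier DG" "\<theta> A = \<theta> B" for A B
    using \<theta>_bij that by (auto simp: bij_betw_def inj_on_def)
  have n: "normal_word (\<theta> A)" "snd ` set (\<theta> A) \<subseteq> cells K" if "A \<in> carrier DG" for A
    using \<theta>_bij that normal_word_cells by (auto simp: bij_betw_def)
  fix x y z assume x: "x \<in> carrier DG"
  show "\<one>\<^bsub>DG\<^esub> \<otimes>\<^bsub>DG\<^esub> x = x"
  proof (rule inj[OF mult_closed[OF one_closed x] x])
    show "\<theta> (\<one>\<^bsub>DG\<^esub> \<otimes>\<^bsub>DG\<^esub> x) = \<theta> x"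
      unfolding \<theta>_mult[OF one_closed x] \<theta>_one by (rule mul_Nil[OF n(1)[OF x]])
  qed
  show "\<exists>y\<in>carrier DG. y \<otimes>\<^bsub>DG\<^esub> x = \<one>\<^bsub>DG\<^esub>"
  proof -
    let ?V = "mul [] (winv (\<theta> x))"
    have "runs (snd w) (\<theta> x) (snd w)" using \<theta>_bij x by (auto simp: bij_betw_def)
    then have r: "runs (snd w) (winv (\<theta> x)) (snd w)" using n[OF x] by (intro runs_winv)
    have c: "snd ` set (winv (\<theta> x)) \<subseteq> cells K" using n[OF x] by (intro winv_cells)
    have "runs (snd w) ?V (snd w)"
      by (rule runs_mul[OF _ r _ c]) simp_all
    moreover have "normal_word ?V" using c by (intro normal_word_mul) simp_all
    ultimately have "?V \<in> \<theta> ` carrier DG" using \<theta>_bij by (simp add: bij_betw_def)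
    then obtain y where y: "y \<in> carrier DG" "\<theta> y = ?V" by auto
    have "\<theta> (y \<otimes>\<^bsub>DG\<^esub> x) = []"
      using y x n[OF x] mul_winv'[of "[]" "\<theta> x"] by (simp add: \<theta>_mult)
    then show ?thesis using inj[OF mult_closed[OF y(1) x] one_closed] \<theta>_one y(1) by auto
  qed
  assume y: "y \<in> carrier DG"
  show "x \<otimes>\<^bsub>DG\<^esub> y \<in> carrier DG" by (rule mult_closed[OF x y])
  assume z: "z \<in> carrier DG"
  show "x \<otimes>\<^bsub>DG\<^esub> y \<otimes>\<^bsub>DG\<^esub> z = x \<otimes>\<^bsub>DG\<^esub> (y \<otimes>\<^bsub>DG\<^esub> z)"
  proof (rule inj)
    have "\<theta> (x \<otimes>\<^bsub>DG\<^esub> y \<otimes>\<^bsub>DG\<^esub> z) = mul (mul (\<theta> x) (\<theta> y)) (\<theta> z)"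
      by (simp only: \<theta>_mult[OF mult_closed[OF x y] z] \<theta>_mult[OF x y])
    also have "\<dots> = mul (\<theta> x) (mul (\<theta> y) (\<theta> z))"
      by (rule mul_mul[OF n(1)[OF x] n(2)[OF y] n(2)[OF z], symmetric])
    also have "\<dots> = \<theta> (x \<otimes>\<^bsub>DG\<^esub> (y \<otimes>\<^bsub>DG\<^esub> z))"
      by (simp only: \<theta>_mult[OF x mult_closed[OF y z]] \<theta>_mult[OF y z])
    finally show "\<theta> (x \<otimes>\<^bsub>DG\<^esub> y \<otimes>\<^bsub>DG\<^esub> z) = \<theta> (x \<otimes>\<^bsub>DG\<^esub> (y \<otimes>\<^bsub>DG\<^esub> z))" .
  qed (intro mult_closed x y z)+
qed (rule one_closed)

lemma diagram_cells_DG: "diagram_cells (cells K) (neg_cells K) (\<lambda>f. snd (ctop K f)) (\<lambda>f. snd (cbot K f)) (cinv K) DG (snd w) \<theta>"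
  by (intro diagram_cells.intro diagram_cells_axioms.intro group_DG \<theta>_bij \<theta>_mult cell_system_axioms)

end

end

section \<open>Normal forms of 1-paths and the tree chains of a left forest\<close>

locale left_forest_complex = directed_2_complex K
  for K :: "('v, 'e, 'f) two_complex" +
  fixes Tl :: "('v, 'e, 'f) atom set"
  assumes complete: "complete_complex K" and left_forest: "left_forest K Tl"
begin

text \<open>The reflexive closure of \<open>derives\<close>.\<close>

definition der :: "('v, 'e) walk \<Rightarrow> ('v, 'e) walk \<Rightarrow> bool" where
  "der p q \<longleftrightarrow> (\<exists>\<delta>. pos_path2 K \<delta> \<and> path2_top \<delta> = p \<and> path2_bot K \<delta> = q)"

abbreviation "irr \<equiv> irreducible_path K"

lemma der_iff: "der p q \<longleftrightarrow> (\<exists>es. sq.awalk p es q \<and> (\<forall>a\<in>set es. fst (snd a) \<in> pos_cells K))"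
proof
  assume "der p q"
  then obtain es where "path2 K (p, es)" "\<forall>(p, f, q)\<in>set es. f \<in> pos_cells K" "path2_bot K (p, es) = q"
    by (auto simp: der_def pos_path2_def)
  then show "\<exists>es. sq.awalk p es q \<and> (\<forall>a\<in>set es. fst (snd a) \<in> pos_cells K)"
    using path2_iff path2_bot_eq by (intro exI[of _ es]) auto
next
  assume "\<exists>es. sq.awalk p es q \<and> (\<forall>a\<in>set es. fst (snd a) \<in> pos_cells K)"
  then obtain es where es: "sq.awalk p es q" "\<forall>a\<in>set es. fst (snd a) \<in> pos_cells K" by blast
  then have "path2 K (p, es)" "path2_bot K (p, es) = q"
    using path2_iff[of p es] path2_bot_eq sq_last[OF es(1)] by auto
  then show "der p q" unfolding der_def pos_path2_def using es(2) by (intro exI[of _ "(p, es)"]) auto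
qed

lemma der_trans: "der p q \<Longrightarrow> der q r \<Longrightarrow> der p r"
proof -
  assume "der p q" "der q r"
  then obtain es fs where "sq.awalk p es q" "\<forall>a\<in>set es. fst (snd a) \<in> pos_cells K"
    "sq.awalk q fs r" "\<forall>a\<in>set fs. fst (snd a) \<in> pos_cells K" by (auto simp: der_iff)
  then show "der p r" unfolding der_iff by (intro exI[of _ "es @ fs"] conjI sq.awalk_appendI) auto
qed

lemma der_refl: "path1 K p \<Longrightarrow> der p p"
  unfolding der_iff by (intro exI[of _ "[]"]) (simp add: sq.awalk_simps)

lemma der_path: "der p q \<Longrightarrow> path1 K p" "der p q \<Longrightarrow> path1 K q"
  unfolding der_iff by (auto elim!: sq.awalkE')

lemma derives_der: "derives K p q \<longleftrightarrow> p \<noteq> q \<and> der p q"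
  by (simp add: derives_def der_def)

lemma irr_der: "irr a \<Longrightarrow> der a c \<Longrightarrow> c = a"
  unfolding irreducible_path_def derives_der by metis

text \<open>By Noetherian induction.\<close>

lemma ex_irr: "path1 K p \<Longrightarrow> \<exists>a. irr a \<and> der p a"
proof -
  have "wf {(q, p). derives K p q}"
    using complete unfolding complete_complex_def noetherian_complex_def wf_iff_no_infinite_down_chain by auto
  then show "path1 K p \<Longrightarrow> \<exists>a. irr a \<and> der p a"
  proof (induction p rule: wf_induct_rule)
    case (less p)
    show ?case
    proof (cases "irr p")
      case True
      then show ?thesis using der_refl less.prems by blast
    next
      case False
      then obtain q where q: "derives K p q" using less.prems by (auto simp: irreducible_path_def)
      then have "der p q" using derives_der by blast
      moreover then have "path1 K q" by (rule der_path(2))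
      ultimately show ?thesis using less.IH[of q] q der_trans by blast
    qed
  qed
qed

text \<open>By confluence, as nothing can be derived from an irreducible 1-path.\<close>

lemma irr_unique:
  assumes "irr a" "irr b" "der p a" "der p b"
  shows "a = b"
proof -
  obtain d1 d2 where d: "pos_path2 K d1" "fst d1 = p" "path2_bot K d1 = a" "pos_path2 K d2" "fst d2 = p" "path2_bot K d2 = b"
    using assms(3,4) by (auto simp: der_def)
  then obtain e1 e2 where e: "pos_path2 K e1" "pos_path2 K e2" "fst e1 = a" "fst e2 = b"
    "path2_bot K (d1 \<cdot> e1) = path2_bot K (d2 \<cdot> e2)"
    using complete unfolding complete_complex_def confluent_complex_def by metis
  have bot: "path2_bot K (d \<cdot> e) = path2_bot K e" if "path2_bot K d = fst e" for d e
    using that by (simp add: path2_bot_def walk_end_def walk_append_def sq.awlast_append)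
  have "der a (path2_bot K e1)" "der b (path2_bot K e2)" unfolding der_def using e by blast+
  then show ?thesis using irr_der assms(1,2) e(5) bot[of d1 e1] bot[of d2 e2] d e by metis
qed

definition NF :: "('v, 'e) walk \<Rightarrow> ('v, 'e) walk" where "NF p = (THE a. irr a \<and> der p a)"

lemma NF: "path1 K p \<Longrightarrow> irr (NF p) \<and> der p (NF p)"
  unfolding NF_def by (rule theI') (use ex_irr irr_unique in blast)

lemma NF_eqI: "irr a \<Longrightarrow> der p a \<Longrightarrow> NF p = a"
  using NF der_path irr_unique by blast

lemma NF_der: "der p q \<Longrightarrow> NF p = NF q"
  using NF[of q] der_path der_trans by (intro NF_eqI) blast+

text \<open>A cell or its inverse is positive, so one of the two sides derives the other.\<close>

lemma NF_atom:
  assumes "is_atom K a" shows "NF (atom_top K a) = NF (atom_bot K a)"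
proof -
  obtain v p f q where a: "a = atom_at v p f q" "f \<in> cells K" "path1 K (v, p @ tp f @ q)"
    using assms by (auto simp: is_atom_iff)
  then have pb: "path1 K (v, p @ bt f @ q)" using path1_cell_iff by auto
  show ?thesis
  proof (cases "f \<in> pos_cells K")
    case True
    have "der (atom_top K a) (atom_bot K a)"
      unfolding der_iff
    proof (intro exI[of _ "[a]"] conjI)
      show "sq.awalk (atom_top K a) [a] (atom_bot K a)" using a pb assms by (simp add: sq.awalk_simps)
      show "\<forall>b\<in>set [a]. fst (snd b) \<in> pos_cells K" using True by (simp add: a(1) atom_at_def)
    qed
    then show ?thesis by (rule NF_der)
  next
    case False
    then have "f \<in> neg_cells K" using a orientation_cover by auto
    then obtain g where "g \<in> pos_cells K" "f = cinv K g" by (auto simp: neg_cells_def)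
    then have c: "cinv K f \<in> pos_cells K" using cinv_invol pos_cell by simp
    let ?i = "atom_at v p (cinv K f) q"
    have i: "is_atom K ?i" "atom_top K ?i = atom_bot K a" "atom_bot K ?i = atom_top K a"
      using a pb cinv_cell[OF a(2)] top_cinv bot_cinv by (simp_all add: is_atom_atom_at)
    have "fst (snd ?i) \<in> pos_cells K" using c by (simp add: atom_at_def)
    then have "der (atom_bot K a) (atom_top K a)"
      unfolding der_iff by (intro exI[of _ "[?i]"]) (use a pb i in \<open>simp add: sq.awalk_simps\<close>)
    then show ?thesis using NF_der by simp
  qed
qed

lemma NF_walk: "sq.awalk x es y \<Longrightarrow> NF x = NF y"
  by (induction es arbitrary: x) (auto simp: sq.awalk_simps NF_atom)

text \<open>A non-empty 1-path is determined by its edges. The empty list stands for the empty 1-paths at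
  all vertices at once; none of them is the top of an atomic 2-path, so it is in normal form and has
  no tree chain.\<close>

definition src :: "'e list \<Rightarrow> 'v" where "src u = tail (base K) (hd u)"

definition ok :: "'e list \<Rightarrow> bool" where "ok u \<longleftrightarrow> u = [] \<or> path1 K (src u, u)"

definition red :: "'e list \<Rightarrow> 'e list" where "red u = (if u = [] then [] else snd (NF (src u, u)))"

lemma src_eq: "path1 K (v, u) \<Longrightarrow> u \<noteq> [] \<Longrightarrow> src u = v"
  using path1_hd by (simp add: src_def)

lemma okI: "path1 K (v, u) \<Longrightarrow> ok u"
  using src_eq by (auto simp: ok_def)

lemma red_Nil [simp]: "red [] = []" by (simp add: red_def)

lemma walk_start: "sq.awalk (v, u) es y \<Longrightarrow> fst y = v"
  using runs_word_of by blast

lemma NF_red: "path1 K (v, u) \<Longrightarrow> u \<noteq> [] \<Longrightarrow> NF (v, u) = (v, red u)"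
proof -
  assume u: "path1 K (v, u)" "u \<noteq> []"
  have "fst (NF (v, u)) = v" using NF[OF u(1)] walk_start unfolding der_iff by blast
  then show ?thesis using src_eq[OF u] u(2) by (auto simp: red_def prod_eq_iff)
qed

lemma runs_Nil: "runs [] V v \<Longrightarrow> snd ` set V \<subseteq> cells K \<Longrightarrow> v = []"
proof (induction V arbitrary: v)
  case (Cons a V)
  then obtain x where "runs [] V x" "step x a v" by auto
  moreover then have "x = []" using Cons by simp
  ultimately show ?case using Cons.prems tp_ne[of "snd a"] by (auto simp: step_def)
qed simp

lemma conn_Nil: "conn [] v \<Longrightarrow> v = []" "conn u [] \<Longrightarrow> u = []"
proof -
  show *: "conn [] v \<Longrightarrow> v = []" for v
    unfolding conn_def using runs_Nil[OF _ normal_word_cells] by metis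
  show "conn u [] \<Longrightarrow> u = []" using *[OF conn_sym] .
qed

lemma conn_walk:
  assumes "conn u v" "path1 K (x, u)"
  shows "\<exists>es. sq.awalk (x, u) es (x, v)"
proof -
  obtain V where "normal_word V" "runs u V v" using assms(1) unfolding conn_def by metis
  then show ?thesis using walk_of_word[OF _ normal_word_cells assms(2)] by metis
qed

lemma walk_conn:
  assumes "sq.awalk (x, u) es (x', v)" shows "conn u v"
  by (rule connI[OF _ word_of_cells[OF assms]]) (use runs_word_of[OF assms] in simp)

lemma walk_path1: "sq.awalk x es y \<Longrightarrow> path1 K x" "sq.awalk x es y \<Longrightarrow> path1 K y"
  by (auto elim!: sq.awalkE')

lemma conn_path1: "conn u v \<Longrightarrow> path1 K (x, u) \<Longrightarrow> path1 K (x, v)"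
  using conn_walk walk_path1(2) by metis

lemma red_conn: "ok u \<Longrightarrow> conn u (red u)"
proof (cases "u = []")
  case False
  assume "ok u"
  then have u: "path1 K (src u, u)" using False by (simp add: ok_def)
  then obtain es where "sq.awalk (src u, u) es (src u, red u)"
    using NF[OF u] NF_red[OF u False] unfolding der_iff by auto
  then show ?thesis by (rule walk_conn)
qed simp

lemma red_eq: "ok u \<Longrightarrow> conn u v \<Longrightarrow> red u = red v"
proof (cases "u = []")
  case True
  then show "conn u v \<Longrightarrow> ?thesis" using conn_Nil by blast
next
  case False
  assume "ok u" and c: "conn u v"
  then have u: "path1 K (src u, u)" using False by (simp add: ok_def)
  have v: "v \<noteq> []" using c False conn_Nil by blast
  have pv: "path1 K (src u, v)" by (rule conn_path1[OF c u])
  have "NF (src u, u) = NF (src u, v)" using conn_walk[OF c u] NF_walk by blast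
  then show ?thesis using NF_red[OF u False] NF_red[OF pv v] by simp
qed

lemma ok_factor: "ok (p @ u @ q) \<Longrightarrow> ok u"
proof -
  assume o: "ok (p @ u @ q)"
  show "ok u"
  proof (cases "u = []")
    case False
    then have "path1 K (src (p @ u @ q), p @ u @ q)" using o by (simp add: ok_def)
    then have "path1 K (base.awlast (src (p @ u @ q)) p, u)" by (simp only: path1_append)
    then show ?thesis by (rule okI)
  qed (simp add: ok_def)
qed

lemma ok_tp_bt: "f \<in> cells K \<Longrightarrow> ok (p @ tp f @ q) \<longleftrightarrow> ok (p @ bt f @ q)"
proof -
  assume f: "f \<in> cells K"
  have "path1 K (v, p @ tp f @ q) \<longleftrightarrow> path1 K (v, p @ bt f @ q)" for v using path1_cell_iff[OF f] by simp
  moreover have "p @ tp f @ q \<noteq> []" "p @ bt f @ q \<noteq> []" using tp_ne[OF f] bt_ne[OF f] by auto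
  ultimately show ?thesis using okI ok_def by metis
qed

lemma irr_red: "path1 K (v, u) \<Longrightarrow> irr (v, u) \<longleftrightarrow> red u = u"
proof (cases "u = []")
  case True
  assume v: "path1 K (v, u)"
  have "q = (v, [])" if "der (v, []) q" for q
    using that runs_word_of[of v "[]"] runs_Nil word_of_cells unfolding der_iff by (metis prod.collapse)
  then show ?thesis using True v by (auto simp: irreducible_path_def derives_der)
next
  case False
  assume v: "path1 K (v, u)"
  show ?thesis using NF[OF v] NF_red[OF v False] NF_eqI[OF _ der_refl[OF v]] by auto
qed

subsection \<open>Walks in the forest\<close>

abbreviation "TG \<equiv> (squier_graph K)\<lparr>arcs := Tl\<rparr>"

lemma Tl_atom: "a \<in> Tl \<Longrightarrow> is_atom K a"
  using left_forest unfolding left_forest_def spanning_forest_def by auto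

lemma Tl_inv: "a \<in> Tl \<Longrightarrow> atom_inv K a \<in> Tl"
  using left_forest unfolding left_forest_def spanning_forest_def by auto

sublocale tg: wf_digraph "(squier_graph K)\<lparr>arcs := Tl\<rparr>"
proof
  fix e assume "e \<in> arcs TG"
  then have "e \<in> arcs (squier_graph K)" using Tl_atom by simp
  then show "tail TG e \<in> verts TG" "head TG e \<in> verts TG" using sq.wellformed by auto
qed

lemma tg_simps: "tg.awalk x [] y \<longleftrightarrow> x = y \<and> path1 K x"
  "tg.awalk x (e # es) y \<longleftrightarrow> e \<in> Tl \<and> x = atom_top K e \<and> tg.awalk (atom_bot K e) es y"
  by (auto simp: tg.awalk_simps)

lemma tg_sq: "tg.awalk x es y \<Longrightarrow> sq.awalk x es y"
  by (induction es arbitrary: x) (auto simp: tg_simps sq.awalk_simps Tl_atom)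

lemma tg_append: "tg.awalk x (es @ fs) y \<longleftrightarrow> (\<exists>z. tg.awalk x es z \<and> tg.awalk z fs y)"
proof (induction es arbitrary: x)
  case Nil
  then show ?case using tg_sq walk_path1 by (auto simp: tg_simps)
qed (auto simp: tg_simps)

text \<open>The 1-cubes of the Squier complex are the edges with a negative cell; an edge with a positive
  cell is one of them with the orientation reversed.\<close>

fun edge_chain :: "('v, 'e, 'f) atom \<Rightarrow> (('e + 'f) list \<Rightarrow>\<^sub>0 int)" where
  "edge_chain (p, f, q) = (if f \<in> neg_cells K then frag_of (ed (snd p) @ Inr f # ed (snd q))
     else - frag_of (ed (snd p) @ Inr (cinv K f) # ed (snd q)))"

definition walk_chain :: "('v, 'e, 'f) atom list \<Rightarrow> (('e + 'f) list \<Rightarrow>\<^sub>0 int)" where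
  "walk_chain es = sum_list (map edge_chain es)"

lemma walk_chain_simps [simp]: "walk_chain [] = 0" "walk_chain (e # es) = edge_chain e + walk_chain es" "walk_chain (es @ fs) = walk_chain es + walk_chain fs"
  by (simp_all add: walk_chain_def)

lemma edge_chain_inv: "is_atom K a \<Longrightarrow> edge_chain (atom_inv K a) = - edge_chain a"
  using cinv_neg cinv_invol by (cases a) auto

lemma atom_inv_ends: "is_atom K a \<Longrightarrow> atom_top K (atom_inv K a) = atom_bot K a \<and> atom_bot K (atom_inv K a) = atom_top K a"
  using top_cinv bot_cinv by (cases a) auto

lemma not_successively: "\<not> successively P es \<Longrightarrow> \<exists>as d e bs. es = as @ d # e # bs \<and> \<not> P d e"
proof (induction es rule: induct_list012)
  case (3 x y zs)
  show ?case
  proof (cases "P x y")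
    case True
    then obtain as d e bs where "y # zs = as @ d # e # bs \<and> \<not> P d e" using 3 by auto
    then show ?thesis by (intro exI[of _ "x # as"]) auto
  next
    case False
    then show ?thesis by (metis append_Nil)
  qed
qed auto

text \<open>A non-empty closed walk in the forest backtracks somewhere. The two edges involved contribute
  opposite chains and can be left out. Hence the chain of a walk in the forest depends only on its
  end points.\<close>

lemma closed_chain: "tg.awalk x es x \<Longrightarrow> walk_chain es = 0"
proof (induction es rule: length_induct)
  case (1 es)
  show ?case
  proof (cases "es = []")
    case False
    have "\<not> successively (\<lambda>d e. e \<noteq> atom_inv K d) es"
      using left_forest False 1(2) unfolding left_forest_def spanning_forest_def by blast
    then obtain as d bs where es: "es = as @ d # atom_inv K d # bs" using not_successively by blast
    then obtain z where z: "tg.awalk x as z" "tg.awalk z (d # atom_inv K d # bs) x"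
      using 1(2) tg_append by blast
    then have d: "is_atom K d" "z = atom_top K d" "tg.awalk (atom_bot K (atom_inv K d)) bs x"
      using Tl_atom by (auto simp: tg_simps)
    then have "tg.awalk z bs x" using atom_inv_ends by simp
    then have "tg.awalk x (as @ bs) x" using z(1) tg_append by blast
    then have "walk_chain (as @ bs) = 0" by (rule 1(1)[rule_format, rotated]) (simp add: es)
    then show ?thesis using es edge_chain_inv[OF d(1)] by simp
  qed simp
qed

lemma reverse_walk: "tg.awalk x es y \<Longrightarrow> \<exists>fs. tg.awalk y fs x \<and> walk_chain fs = - walk_chain es"
proof (induction es arbitrary: x)
  case Nil
  then show ?case by (intro exI[of _ "[]"]) (auto simp: tg_simps)
next
  case (Cons e es)
  then have "tg.awalk (atom_bot K e) es y" by (simp only: tg_simps)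
  then obtain fs where fs: "tg.awalk y fs (atom_bot K e)" "walk_chain fs = - walk_chain es" using Cons.IH by blast
  have e: "e \<in> Tl" "is_atom K e" "x = atom_top K e" using Cons.prems Tl_atom by (auto simp: tg_simps)
  have "path1 K x" using walk_path1(1)[OF tg_sq[OF Cons.prems]] .
  then have "tg.awalk (atom_bot K e) [atom_inv K e] x"
    using e atom_inv_ends[OF e(2)] Tl_inv by (simp add: tg_simps)
  then have "tg.awalk y (fs @ [atom_inv K e]) x" using fs(1) tg_append by blast
  then show ?case using fs edge_chain_inv[OF e(2)] by (intro exI[of _ "fs @ [atom_inv K e]"]) simp
qed

lemma chain_unique:
  assumes "tg.awalk x es y" "tg.awalk x fs y" shows "walk_chain es = walk_chain fs"
proof -
  obtain gs where gs: "tg.awalk y gs x" "walk_chain gs = - walk_chain fs" using reverse_walk[OF assms(2)] by blast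
  then have "tg.awalk x (es @ gs) x" using assms(1) tg_append by blast
  then have "walk_chain (es @ gs) = 0" by (rule closed_chain)
  then show ?thesis using gs(2) by simp
qed

lemma ex_walk:
  assumes "path1 K (v, u)" "u \<noteq> []"
  shows "\<exists>es. tg.awalk (v, u) es (v, red u)"
proof -
  have "\<exists>es. sq.awalk (v, u) es (v, red u)"
    using NF[OF assms(1)] NF_red[OF assms] unfolding der_iff by auto
  then have "reachable (squier_graph K) (v, u) (v, red u)" using sq.reachable_awalk by blast
  then have "reachable TG (v, u) (v, red u)"
    using left_forest unfolding left_forest_def spanning_forest_def by blast
  then show ?thesis using tg.reachable_awalk by blast
qed

definition tree_chain :: "'e list \<Rightarrow> (('e + 'f) list \<Rightarrow>\<^sub>0 int)" where
  "tree_chain u = (if u = [] then 0 else walk_chain (SOME es. tg.awalk (src u, u) es (src u, red u)))"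

lemma tree_chain_Nil [simp]: "tree_chain [] = 0" by (simp add: tree_chain_def)

lemma tree_chain_eq:
  assumes "tg.awalk (v, u) es (v, red u)" "u \<noteq> []"
  shows "tree_chain u = walk_chain es"
proof -
  have "path1 K (v, u)" using walk_path1(1)[OF tg_sq[OF assms(1)]] .
  then have s: "src u = v" using src_eq assms(2) by blast
  have "tg.awalk (v, u) (SOME es. tg.awalk (v, u) es (v, red u)) (v, red u)"
    using assms(1) by (rule someI)
  then have "walk_chain (SOME es. tg.awalk (v, u) es (v, red u)) = walk_chain es" using assms(1) by (rule chain_unique)
  then show ?thesis using s assms(2) by (simp add: tree_chain_def)
qed

lemma ex_tree_chain:
  assumes "ok u" "u \<noteq> []"
  shows "\<exists>v es. path1 K (v, u) \<and> tg.awalk (v, u) es (v, red u) \<and> tree_chain u = walk_chain es"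
  using assms ex_walk[of "src u" u] tree_chain_eq unfolding ok_def by blast

lemma ext_cube_bd_edge_chain: "is_atom K a \<Longrightarrow> ext_cube_bd (edge_chain a) = frag_of (ed (snd (atom_top K a))) - frag_of (ed (snd (atom_bot K a)))"
proof -
  assume "is_atom K a"
  then obtain v p f q where a: "a = atom_at v p f q" "f \<in> cells K" by (auto simp: is_atom_iff)
  have "cube_bd (ed p @ Inr g # ed q) = frag_of (ed (p @ tp g @ q)) - frag_of (ed (p @ bt g @ q))" for g
    by (simp add: cube_bd_ed)
  then show ?thesis unfolding a(1) atom_at_simps using top_cinv[OF a(2)] bot_cinv[OF a(2)] by (simp add: atom_at_def lin)
qed

lemma ext_cube_bd_walk_chain: "sq.awalk x es y \<Longrightarrow> ext_cube_bd (walk_chain es) = frag_of (ed (snd x)) - frag_of (ed (snd y))"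
proof (induction es arbitrary: x)
  case Nil
  then show ?case by (simp add: sq.awalk_simps)
next
  case (Cons e es)
  have w: "sq.awalk (atom_bot K e) es y" and e: "is_atom K e" "x = atom_top K e"
    using Cons.prems by (simp_all add: sq.awalk_simps)
  show ?case using Cons.IH[OF w] ext_cube_bd_edge_chain[OF e(1)] e(2) by (simp add: lin)
qed

lemma tree_chain_d: "ok u \<Longrightarrow> ext_cube_bd (tree_chain u) = frag_of (ed u) - frag_of (ed (red u))"
proof (cases "u = []")
  case False
  assume "ok u"
  then obtain v es where "tg.awalk (v, u) es (v, red u)" "tree_chain u = walk_chain es" using ex_tree_chain[OF _ False] by blast
  then show ?thesis using ext_cube_bd_walk_chain[OF tg_sq] by fastforce
qed simp

text \<open>Extension of an atomic 2-path to the right. A left forest is closed under it, so that walks in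
  the forest can be extended to the right as well.\<close>

definition widen :: "'e list \<Rightarrow> ('v, 'e, 'f) atom \<Rightarrow> ('v, 'e, 'f) atom" where
  "widen b a = (fst a, fst (snd a), (fst (snd (snd a)), snd (snd (snd a)) @ b))"

lemma widen_atom_at [simp]: "widen b (atom_at v p f q) = atom_at v p f (q @ b)"
  by (simp add: widen_def atom_at_def)

lemma edge_chain_widen: "edge_chain (widen b a) = edge_chain a \<star> frag_of (ed b)"
  by (cases a) (auto simp: widen_def)

lemma walk_chain_widen: "walk_chain (map (widen b) es) = walk_chain es \<star> frag_of (ed b)"
  by (induction es) (auto simp: edge_chain_widen)

lemma widen_walk:
  "tg.awalk (v, x) es y \<Longrightarrow> path1 K (v, x @ b) \<Longrightarrow> tg.awalk (v, x @ b) (map (widen b) es) (v, snd y @ b)"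
proof (induction es arbitrary: x)
  case Nil
  then show ?case by (auto simp: tg_simps)
next
  case (Cons e es)
  have eT: "e \<in> Tl" and top: "(v, x) = atom_top K e" and w: "tg.awalk (atom_bot K e) es y"
    using Cons.prems by (simp_all add: tg_simps)
  obtain v' p f q where e: "e = atom_at v' p f q" and f: "f \<in> cells K"
    using Tl_atom[OF eT] by (auto simp: is_atom_iff)
  have vx: "v' = v" "x = p @ tp f @ q" using top e by auto
  have pt: "path1 K (v, p @ tp f @ q @ b)" using Cons.prems(2) vx by simp
  then have pb: "path1 K (v, (p @ bt f @ q) @ b)" using path1_cell_iff[OF f] by simp
  have at: "is_atom K (atom_at v p f (q @ b))" using pt f by (simp add: is_atom_atom_at)
  have "atom_at v p f (q @ b) \<in> Tl"
    using left_forest eT at unfolding left_forest_def e vx(1) atom_at_def by blast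
  moreover have "tg.awalk (v, (p @ bt f @ q) @ b) (map (widen b) es) (v, snd y @ b)"
    using w pb by (intro Cons.IH) (simp_all add: e vx)
  ultimately show ?case by (simp add: tg_simps e vx)
qed

lemma red_red: "ok u \<Longrightarrow> red (red u) = red u"
  using red_eq[OF _ red_conn] by simp

text \<open>The path from \<open>a\<close> to \<open>red a\<close>, extended by \<open>b\<close> and followed by the path from \<open>red a \<cdot> b\<close> to its
  irreducible form, is a walk in the forest from \<open>a b\<close> to \<open>red (a b)\<close>.\<close>

lemma tree_chain_append: "ok (a @ b) \<Longrightarrow> tree_chain (a @ b) = tree_chain a \<star> frag_of (ed b) + tree_chain (red a @ b)"
proof (cases "a = []")
  case False
  assume o: "ok (a @ b)"
  then have pab: "path1 K (src (a @ b), a @ b)" using False by (simp add: ok_def)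
  then have "path1 K (src (a @ b), a)" by (simp add: path1_append)
  then have pa: "path1 K (src a, a)" "src (a @ b) = src a" using src_eq[OF _ False] by auto
  have c: "conn a (red a)" using red_conn okI pa(1) by blast
  have ne: "red a \<noteq> []" using conn_Nil(2)[of a] c False by auto
  obtain es where es: "tg.awalk (src a, a) es (src a, red a)" using ex_walk[OF pa(1) False] by blast
  have w1: "tg.awalk (src a, a @ b) (map (widen b) es) (src a, red a @ b)"
    using widen_walk[OF es, of b] pab pa(2) by simp
  have cab: "conn (a @ b) (red a @ b)" using conn_append[OF c conn_refl] .
  have pr: "path1 K (src a, red a @ b)" by (rule walk_path1(2)[OF tg_sq[OF w1]])
  obtain fs where fs: "tg.awalk (src a, red a @ b) fs (src a, red (red a @ b))"
    using ex_walk[OF pr] ne by blast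
  have r: "red (red a @ b) = red (a @ b)" using red_eq[OF o cab] by simp
  have "tg.awalk (src a, a @ b) (map (widen b) es @ fs) (src a, red (a @ b))"
    using w1 fs unfolding r tg_append by blast
  then have "tree_chain (a @ b) = walk_chain (map (widen b) es @ fs)" by (rule tree_chain_eq) (use False in simp)
  moreover have "tree_chain a = walk_chain es" by (rule tree_chain_eq[OF es False])
  moreover have "tree_chain (red a @ b) = walk_chain fs" by (rule tree_chain_eq[OF fs]) (use ne in simp)
  ultimately show ?thesis by (simp add: walk_chain_widen)
qed simp

definition tree_prefix :: "('e list \<times> 'f) set" where "tree_prefix = {(p, f). \<exists>v q. ((v, p), f, q) \<in> Tl}"

lemma Tl_red: "((v, p), f, q) \<in> Tl \<Longrightarrow> red p = p"
proof -
  assume a: "((v, p), f, q) \<in> Tl"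
  then have "irr (v, p)" using left_forest unfolding left_forest_def by blast
  then show ?thesis using irr_red by (auto simp: irreducible_path_def)
qed

lemma edge_chain_in:
  assumes "e \<in> Tl" "conn u (snd (atom_top K e))"
  shows "edge_chain e \<in> chains {ed p @ Inr f # ed q | p f q. f \<in> neg_cells K \<and> (p, f) \<in> tree_prefix \<and> red p = p \<and> conn u (p @ tp f @ q)}"
proof -
  obtain v p f q where e: "e = atom_at v p f q" "f \<in> cells K" "path1 K (v, p @ tp f @ q)"
    using Tl_atom[OF assms(1)] by (auto simp: is_atom_iff)
  have r: "red p = p" using Tl_red assms(1) by (simp add: e(1) atom_at_def)
  have c: "conn u (p @ tp f @ q)" using assms(2) e by simp
  show ?thesis
  proof (cases "f \<in> neg_cells K")
    case True
    have "(p, f) \<in> tree_prefix" using assms(1) by (auto simp: tree_prefix_def e(1) atom_at_def)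
    then show ?thesis using True r c by (auto simp: e(1) atom_at_def)
  next
    case False
    have "atom_at v p (cinv K f) q \<in> Tl" using Tl_inv[OF assms(1)] atom_at_inv[OF e(2)] e(1) by simp
    then have "(p, cinv K f) \<in> tree_prefix" by (auto simp: tree_prefix_def atom_at_def)
    moreover have "conn u (p @ tp (cinv K f) @ q)"
      using conn_trans[OF c conn_step[OF e(2)]] top_cinv[OF e(2)] by simp
    moreover have "cinv K f \<in> neg_cells K" using cinv_neg[OF e(2)] False by simp
    ultimately have "ed p @ Inr (cinv K f) # ed q \<in>
        {ed p @ Inr f # ed q | p f q. f \<in> neg_cells K \<and> (p, f) \<in> tree_prefix \<and> red p = p \<and> conn u (p @ tp f @ q)}"
      using r by blast
    then show ?thesis using False by (simp only: e(1) atom_at_def edge_chain.simps if_False snd_conv)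
      (intro chains_simps, simp only: frag_of_in_chains)
  qed
qed

lemma walk_chain_in:
  "tg.awalk x es y \<Longrightarrow> conn u (snd x) \<Longrightarrow>
    walk_chain es \<in> chains {ed p @ Inr f # ed q | p f q. f \<in> neg_cells K \<and> (p, f) \<in> tree_prefix \<and> red p = p \<and> conn u (p @ tp f @ q)}"
proof (induction es arbitrary: x)
  case (Cons e es)
  have e: "e \<in> Tl" "x = atom_top K e" "tg.awalk (atom_bot K e) es y"
    using Cons.prems by (simp_all add: tg_simps)
  obtain v p f q where a: "e = atom_at v p f q" "f \<in> cells K"
    using Tl_atom[OF e(1)] by (auto simp: is_atom_iff)
  have "conn u (snd (atom_bot K e))"
    using conn_trans[OF Cons.prems(2)] conn_step[OF a(2), of p q] by (simp add: e(2) a(1))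
  then have "walk_chain es \<in> chains {ed p @ Inr f # ed q | p f q. f \<in> neg_cells K \<and> (p, f) \<in> tree_prefix \<and> red p = p \<and> conn u (p @ tp f @ q)}"
    using Cons.IH[OF e(3)] by simp
  moreover have "conn u (snd (atom_top K e))" using Cons.prems(2) e(2) by simp
  ultimately show ?case
    unfolding walk_chain_simps by (intro chains_simps(2) edge_chain_in[OF e(1)])
qed simp

lemma tree_chain_in: "ok u \<Longrightarrow>
  tree_chain u \<in> chains {ed p @ Inr f # ed q | p f q. f \<in> neg_cells K \<and> (p, f) \<in> tree_prefix \<and> red p = p \<and> conn u (p @ tp f @ q)}"
proof (cases "u = []")
  case False
  assume "ok u"
  then obtain v es where "tg.awalk (v, u) es (v, red u)" "tree_chain u = walk_chain es" using ex_tree_chain[OF _ False] by blast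
  then show ?thesis using walk_chain_in[of "(v, u)" es "(v, red u)" u] by simp
qed simp

text \<open>The edge followed by the tree path of its bottom is a walk in the forest from its top.\<close>

lemma tree_chain_T:
  assumes pf: "(p, f) \<in> tree_prefix" and f: "f \<in> neg_cells K" and o: "ok (p @ tp f)"
  shows "frag_of (ed p @ [Inr f]) = tree_chain (p @ tp f) - tree_chain (p @ bt f)"
proof -
  obtain v q where vq: "((v, p), f, q) \<in> Tl" using pf by (auto simp: tree_prefix_def)
  have fc: "f \<in> cells K" using f neg_cell by blast
  obtain v' p' f' q' where "((v, p), f, q) = atom_at v' p' f' q'" "path1 K (v', p' @ tp f' @ q')"
    using Tl_atom[OF vq] unfolding is_atom_iff by blast
  then have "path1 K (v, (p @ tp f) @ snd q)" by (auto simp: atom_at_def)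
  then have pt: "path1 K (v, p @ tp f)" by (simp only: path1_append)
  have at: "is_atom K (atom_at v p f [])" using pt fc by (simp add: is_atom_atom_at)
  then have T: "atom_at v p f [] \<in> Tl" using left_forest vq unfolding left_forest_def atom_at_def by blast
  have pb: "path1 K (v, p @ bt f)" using pt path1_cell_iff[OF fc, of v p "[]"] by simp
  have ne: "p @ tp f \<noteq> []" "p @ bt f \<noteq> []" using tp_ne[OF fc] bt_ne[OF fc] by auto
  obtain es where es: "tg.awalk (v, p @ bt f) es (v, red (p @ bt f))" using ex_walk[OF pb ne(2)] by blast
  have "red (p @ tp f) = red (p @ bt f)"
    using red_eq[OF o] conn_step[OF fc, of p "[]"] by simp
  then have "tg.awalk (v, p @ tp f) (atom_at v p f [] # es) (v, red (p @ tp f))"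
    using es T by (simp add: tg_simps)
  then have "tree_chain (p @ tp f) = walk_chain (atom_at v p f [] # es)" by (rule tree_chain_eq[OF _ ne(1)])
  moreover have "tree_chain (p @ bt f) = walk_chain es" by (rule tree_chain_eq[OF es ne(2)])
  ultimately show ?thesis using f by (simp add: atom_at_def)
qed

sublocale left_normal "cells K" "neg_cells K" "\<lambda>f. snd (ctop K f)" "\<lambda>f. snd (cbot K f)" "cinv K" ok red tree_prefix tree_chain
  by unfold_locales (fact ok_factor ok_tp_bt red_conn red_eq tree_chain_d tree_chain_append tree_chain_in | erule (2) tree_chain_T)+

end

section \<open>Essential cubes as words\<close>

lemma ed_inj: "ed p = ed q \<longleftrightarrow> p = q"
  by (simp add: inj_map_eq_map)

lemma ed_Inr_inj: "ed p @ Inr f # x = ed q @ Inr g # y \<longleftrightarrow> p = q \<and> f = g \<and> x = y"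
proof (induction p arbitrary: q)
  case Nil
  then show ?case by (cases q) auto
next
  case (Cons e p)
  then show ?case by (cases q) auto
qed

lemma ed_Inr_neq: "ed p \<noteq> ed q @ Inr g # y" "ed q @ Inr g # y \<noteq> ed p"
proof -
  show "ed p \<noteq> ed q @ Inr g # y"
  proof
    assume "ed p = ed q @ Inr g # y"
    then have "cell_count (ed p :: ('a + 'b) list) = cell_count (ed q @ Inr g # y)" by (rule arg_cong)
    then show False by simp
  qed
  then show "ed q @ Inr g # y \<noteq> ed p" by metis
qed

text \<open>The word of a cube. The vertices that it forgets are determined by the initial vertex.\<close>

fun flatten :: "('v, 'e, 'f) cube \<Rightarrow> ('e + 'f) list" where
  "flatten (u, []) = ed (snd u)"
| "flatten (u, (f, v) # c) = ed (snd u) @ Inr f # flatten (v, c)"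

context directed_2_complex
begin

lemma is_cube_path1: "is_cube K (u, c) \<Longrightarrow> path1 K u"
  by (cases c) auto

lemma is_cube_start:
  "is_cube K (u, c) \<Longrightarrow> path1 K u' \<Longrightarrow> path1_end K u' = path1_end K u \<Longrightarrow> is_cube K (u', c)"
  by (cases c) auto

lemma flatten_cube: "is_cube K (u, l) \<Longrightarrow> path1 K (fst u, cube_top (flatten (u, l))) \<and> cell_set (flatten (u, l)) \<subseteq> neg_cells K
    \<and> cell_count (flatten (u, l)) = length l"
proof (induction l arbitrary: u)
  case (Cons x l)
  obtain f v where x: "x = (f, v)" by (cases x)
  have u: "path1 K u" "f \<in> neg_cells K" "path1_end K u = fst (ctop K f)" "cell_end f = fst v" "is_cube K (v, l)"
    using Cons.prems by (simp_all add: x)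
  have IH: "path1 K (fst v, cube_top (flatten (v, l)))" "cell_set (flatten (v, l)) \<subseteq> neg_cells K" "cell_count (flatten (v, l)) = length l"
    using Cons.IH[OF u(5)] by auto
  have e: "base.awlast (fst u) (snd u) = fst (ctop K f)" using u(3) by (simp add: walk_end_def)
  have "path1 K (fst u, snd u @ tp f @ cube_top (flatten (v, l)))"
    unfolding path1_cell_iff(1)[OF neg_cell[OF u(2)]] using u(1,4) e IH(1) by simp
  then show ?case using IH u(2) by (simp add: x)
qed simp

lemma flatten_inj: "is_cube K (u, l) \<Longrightarrow> is_cube K (u', l') \<Longrightarrow> fst u = fst u' \<Longrightarrow> flatten (u, l) = flatten (u', l') \<Longrightarrow> u = u' \<and> l = l'"
proof (induction l arbitrary: u u' l')
  case Nil
  then show ?case by (cases l') (auto simp: ed_inj ed_Inr_neq prod_eq_iff)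
next
  case (Cons x l)
  obtain f v where x: "x = (f, v)" by (cases x)
  obtain g v' m where l': "l' = (g, v') # m"
    using Cons.prems(4) by (cases l') (auto simp: x ed_Inr_neq)
  have eq: "snd u = snd u'" "f = g" "flatten (v, l) = flatten (v', m)"
    using Cons.prems(4) by (simp_all add: x l' ed_Inr_inj)
  have "fst v = fst v'" using Cons.prems(1,2) eq(2) by (simp add: x l')
  then have "v = v' \<and> l = m"
    using Cons.prems(1,2) eq(3) by (intro Cons.IH) (simp_all add: x l')
  then show ?case using eq Cons.prems(3) by (simp add: x l' prod_eq_iff)
qed

lemma flatten_surj:
  "path1 K (v, cube_top x) \<Longrightarrow> cell_set x \<subseteq> neg_cells K \<Longrightarrow> \<exists>u l. is_cube K (u, l) \<and> fst u = v \<and> flatten (u, l) = x"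
proof (induction x arbitrary: v rule: cube_top.induct)
  case 1
  then show ?case by (intro exI[of _ "(v, [])"] exI[of _ "[]"]) simp
next
  case (2 e c)
  have p: "path1 K (v, [e])" "path1 K (base.awlast v [e], cube_top c)"
    using 2(2) path1_append[of v "[e]" "cube_top c"] by auto
  then obtain u l where ul: "is_cube K (u, l)" "fst u = base.awlast v [e]" "flatten (u, l) = c"
    using 2(1)[OF p(2)] 2(3) by auto
  have u: "path1 K (base.awlast v [e], snd u)" using is_cube_path1[OF ul(1)] ul(2) by (metis prod.collapse)
  have "path1 K (v, e # snd u)" using path1_append[of v "[e]" "snd u"] p(1) u by simp
  moreover have "path1_end K (v, e # snd u) = path1_end K u"
    using base.awlast_append[of v "[e]" "snd u"] ul(2) by (simp add: walk_end_def)
  ultimately have "is_cube K ((v, e # snd u), l)" by (rule is_cube_start[OF ul(1)])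
  moreover have "flatten ((v, e # snd u), l) = Inl e # c"
    using ul(3) by (cases l) auto
  ultimately show ?case by (intro exI[of _ "(v, e # snd u)"] exI[of _ l]) simp
next
  case (3 f c)
  have f: "f \<in> neg_cells K" using 3(3) by simp
  have p: "path1 K (v, [])" "base.awlast v [] = fst (ctop K f)" "path1 K (cell_end f, cube_top c)"
    using 3(2) path1_cell_iff(1)[OF neg_cell[OF f], of v "[]" "cube_top c"] by auto
  then obtain u l where ul: "is_cube K (u, l)" "fst u = cell_end f" "flatten (u, l) = c"
    using 3(1)[OF p(3)] 3(3) by auto
  have "is_cube K ((v, []), (f, u) # l)"
    using p f ul by (simp add: walk_end_def)
  then show ?case using ul(3) by (intro exI[of _ "(v, [])"] exI[of _ "(f, u) # l"]) simp
qed

text \<open>A face replaces one cell of the word by the edges of its top or bottom.\<close>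

lemma face:
  assumes s: "s = ctop K \<or> s = cbot K"
  shows "is_cube K (u, l) \<Longrightarrow> i < length l \<Longrightarrow>
    \<exists>u' l'. cube_face s i (u, l) = (u', l') \<and> is_cube K (u', l') \<and> fst u' = fst u \<and> Suc (length l') = length l
      \<and> (\<exists>A f B. f \<in> neg_cells K \<and> flatten (u, l) = A @ Inr f # B \<and> flatten (u', l') = A @ ed (snd (s f)) @ B)"
proof (induction l arbitrary: u i)
  case (Cons x l)
  obtain f v where x: "x = (f, v)" by (cases x)
  have u: "path1 K u" "f \<in> neg_cells K" "path1_end K u = fst (ctop K f)" "cell_end f = fst v" "is_cube K (v, l)"
    using Cons.prems by (simp_all add: x)
  have fc: "f \<in> cells K" using neg_cell u(2) by blast
  show ?case
  proof (cases i)
    case 0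
    have sf: "path1 K (s f)" "fst (s f) = fst (ctop K f)" "path1_end K (s f) = cell_end f"
      using s top_path[OF fc] bot_path[OF fc] same_start[OF fc] same_end[OF fc] by auto
    have v: "path1 K v" by (rule is_cube_path1[OF u(5)])
    have "path1_end K (s f) = fst v" using sf u by simp
    note c1 = path1_cat[OF sf(1) v this]
    have "path1_end K u = fst (s f \<cdot> v)" using sf u by (simp add: walk_append_def)
    note c2 = path1_cat[OF u(1) c1(1) this]
    have "is_cube K (u \<cdot> s f \<cdot> v, l)"
      using c1 c2 by (intro is_cube_start[OF u(5)]) auto
    moreover have "flatten (u \<cdot> s f \<cdot> v, l) = ed (snd u) @ ed (snd (s f)) @ flatten (v, l)"
      by (cases l) (auto simp: walk_append_def)
    ultimately show ?thesis using u(2)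
      by (intro exI[of _ "u \<cdot> s f \<cdot> v"] exI[of _ l] conjI exI[of _ "ed (snd u)"] exI[of _ f] exI[of _ "flatten (v, l)"])
         (auto simp: x 0 walk_append_def)
  next
    case (Suc j)
    then obtain v' l' A g B where IH: "cube_face s j (v, l) = (v', l')" "is_cube K (v', l')" "fst v' = fst v"
      "Suc (length l') = length l" "g \<in> neg_cells K" "flatten (v, l) = A @ Inr g # B" "flatten (v', l') = A @ ed (snd (s g)) @ B"
      using Cons.IH[OF u(5), of j] Cons.prems(2) by auto
    show ?thesis
      using IH u
      by (intro exI[of _ u] exI[of _ "(f, v') # l'"] conjI exI[of _ "ed (snd u) @ Inr f # A"] exI[of _ g] exI[of _ B])
         (auto simp: x Suc)
  qed
qed simp

abbreviation "R \<equiv> (face_rel K \<union> (face_rel K)\<inverse>)\<^sup>*"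

lemma R_sym: "(a, b) \<in> R \<Longrightarrow> (b, a) \<in> R"
  by (simp add: sym_Un_converse sym_rtrancl symD)

lemma face_R:
  assumes "is_cube K c" "i < cube_dim c" "s = ctop K \<or> s = cbot K"
  shows "(c, cube_face s i c) \<in> R"
  using assms unfolding face_rel_def by (intro r_into_rtrancl UnI1) blast

lemma face_conn:
  assumes "(c, c') \<in> face_rel K"
  shows "is_cube K c \<and> is_cube K c' \<and> fst (fst c) = fst (fst c') \<and> conn (cube_top (flatten c)) (cube_top (flatten c'))"
proof -
  obtain s i where c: "is_cube K c" "i < cube_dim c" "s = ctop K \<or> s = cbot K" "c' = cube_face s i c"
    using assms unfolding face_rel_def by blast
  obtain u l where ul: "c = (u, l)" by (cases c)
  obtain u' l' A f B where f: "cube_face s i (u, l) = (u', l')" "is_cube K (u', l')" "fst u' = fst u"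
    "f \<in> neg_cells K" "flatten (u, l) = A @ Inr f # B" "flatten (u', l') = A @ ed (snd (s f)) @ B"
    using face[OF c(3), of u l i] c(1,2) ul by auto
  have "conn (cube_top (flatten c)) (cube_top (flatten c'))"
    using c(3) f(5,6) conn_step[OF neg_cell[OF f(4)], of "cube_top A" "cube_top B"] by (auto simp: ul c(4) f(1))
  then show ?thesis using c f ul by simp
qed

lemma R_conn:
  assumes "(c, c') \<in> R" "is_cube K c"
  shows "is_cube K c' \<and> fst (fst c) = fst (fst c') \<and> conn (cube_top (flatten c)) (cube_top (flatten c'))"
  using assms
proof (induction rule: rtrancl_induct)
  case (step y z)
  then have y: "is_cube K y" "fst (fst c) = fst (fst y)" "conn (cube_top (flatten c)) (cube_top (flatten y))" by auto
  have "is_cube K z \<and> fst (fst y) = fst (fst z) \<and> conn (cube_top (flatten y)) (cube_top (flatten z))"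
    using step(2) face_conn[of y z] face_conn[of z y] conn_sym by auto
  then show ?case using y conn_trans by auto
qed simp

text \<open>Collapsing all cells to their tops connects a cube to its top vertex.\<close>

lemma cube_R_vertex: "is_cube K (u, l) \<Longrightarrow> ((u, l), ((fst u, cube_top (flatten (u, l))), [])) \<in> R"
proof (induction "length l" arbitrary: u l)
  case 0
  then show ?case by simp
next
  case (Suc n)
  have l: "0 < length l" using Suc(2) by (cases l) simp_all
  obtain u' l' A f B where f: "cube_face (ctop K) 0 (u, l) = (u', l')" "is_cube K (u', l')" "fst u' = fst u"
    "Suc (length l') = length l" "flatten (u, l) = A @ Inr f # B" "flatten (u', l') = A @ ed (tp f) @ B"
    using face[of "ctop K" u l 0] Suc(3) l by auto
  have 1: "((u, l), (u', l')) \<in> R"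
    using face_R[OF Suc(3), of 0 "ctop K"] l f(1) by simp
  have 2: "((u', l'), ((fst u', cube_top (flatten (u', l'))), [])) \<in> R"
    by (rule Suc(1)[OF _ f(2)]) (use f(4) Suc(2) in simp)
  have 3: "cube_top (flatten (u', l')) = cube_top (flatten (u, l))" unfolding f(5,6) by simp
  show ?case using rtrancl_trans[OF 1 2] unfolding 3 f(3) .
qed

text \<open>The ends of an edge of the Squier graph are the two faces of a 1-cube.\<close>

lemma edge_R:
  assumes f: "f \<in> cells K" and p: "path1 K (v, p @ tp f @ q)"
  shows "(((v, p @ tp f @ q), []), ((v, p @ bt f @ q), [])) \<in> R"
proof -
  have *: "(((v, p @ tp g @ q), []), ((v, p @ bt g @ q), [])) \<in> R"
    if g: "g \<in> neg_cells K" and p: "path1 K (v, p @ tp g @ q)" for g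
  proof -
    let ?c = "((v, p), [(g, (cell_end g, q))])"
    have c: "is_cube K ?c"
      using path1_cell_iff(1)[OF neg_cell[OF g], of v p q] p g by (simp add: path1_end_eq)
    have "(?c, ((v, p @ tp g @ q), [])) \<in> R" "(?c, ((v, p @ bt g @ q), [])) \<in> R"
      using face_R[OF c, of 0 "ctop K"] face_R[OF c, of 0 "cbot K"] by (simp_all add: walk_append_def)
    then show ?thesis by (rule rtrancl_trans[OF R_sym])
  qed
  show ?thesis
  proof (cases "f \<in> neg_cells K")
    case False
    have "path1 K (v, p @ tp (cinv K f) @ q)" using p path1_cell_iff[OF f] top_cinv[OF f] by simp
    then show ?thesis using *[of "cinv K f"] cinv_neg[OF f] False R_sym top_cinv[OF f] bot_cinv[OF f] by simp
  qed (use * p in blast)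
qed

lemma runs_R:
  assumes "runs u V u'" "snd ` set V \<subseteq> cells K" "path1 K (v, u)"
  shows "(((v, u), []), ((v, u'), [])) \<in> R"
proof -
  obtain es where "sq.awalk (v, u) es (v, u')" using walk_of_word[OF assms] by blast
  moreover have "sq.awalk x es y \<Longrightarrow> ((x, []), (y, [])) \<in> R" for x y
  proof (induction es arbitrary: x)
    case Nil
    then show ?case by (simp add: sq.awalk_simps)
  next
    case (Cons e es)
    then have e: "is_atom K e" "x = atom_top K e" "sq.awalk (atom_bot K e) es y" by (simp_all add: sq.awalk_simps)
    obtain v p f q where a: "e = atom_at v p f q" "f \<in> cells K" "path1 K (v, p @ tp f @ q)"
      using e(1) unfolding is_atom_iff by blast
    have "((x, []), (atom_bot K e, [])) \<in> R" using edge_R[OF a(2,3)] by (simp add: e(2) a(1))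
    then show ?case using Cons.IH[OF e(3)] by (rule rtrancl_trans)
  qed
  ultimately show ?thesis by blast
qed

text \<open>A cube belongs to the component of \<open>w\<close> if and only if its top vertex does.\<close>

lemma squier_component_iff:
  assumes w: "path1 K w"
  shows "c \<in> squier_component K w \<longleftrightarrow> is_cube K c \<and> fst (fst c) = fst w \<and> conn (snd w) (cube_top (flatten c))"
proof
  assume "c \<in> squier_component K w"
  then have "((w, []), c) \<in> R" by (simp add: squier_component_def)
  then show "is_cube K c \<and> fst (fst c) = fst w \<and> conn (snd w) (cube_top (flatten c))"
    using R_conn[of "(w, [])" c] w by simp
next
  assume c: "is_cube K c \<and> fst (fst c) = fst w \<and> conn (snd w) (cube_top (flatten c))"
  obtain u l where ul: "c = (u, l)" by (cases c)
  obtain V where V: "normal_word V" "runs (snd w) V (cube_top (flatten c))" using c unfolding conn_def by blast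
  have "((w, []), ((fst w, cube_top (flatten c)), [])) \<in> R"
    using runs_R[OF V(2) normal_word_cells[OF V(1)], of "fst w"] w by simp
  moreover have "is_cube K (u, l)" "fst u = fst w" using c ul by simp_all
  then have "(((fst w, cube_top (flatten c)), []), c) \<in> R"
    using R_sym[OF cube_R_vertex[of u l]] unfolding ul by simp
  ultimately have "((w, []), c) \<in> R" by (rule rtrancl_trans)
  then show "c \<in> squier_component K w" by (simp add: squier_component_def)
qed

end

context left_forest_complex
begin

text \<open>The initial vertex of \<open>u\<close>, which \<open>tree_prefix\<close> does not record, is determined by the edges of
  \<open>u\<close> or, if there are none, by the cell.\<close>

lemma tree_prefix_iff:
  assumes "path1 K u" "path1_end K u = fst (ctop K f)"
  shows "(\<exists>q. (u, f, q) \<in> Tl) \<longleftrightarrow> (snd u, f) \<in> tree_prefix"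
proof
  assume "(snd u, f) \<in> tree_prefix"
  then obtain v q where vq: "((v, snd u), f, q) \<in> Tl" by (auto simp: tree_prefix_def)
  then have a: "path1 K (v, snd u)" "path1_end K (v, snd u) = fst (ctop K f)" using Tl_atom[OF vq] by auto
  have "v = fst u"
  proof (cases "snd u = []")
    case True
    then show ?thesis using a(2) assms(2) by (simp add: walk_end_def)
  next
    case False
    then show ?thesis using path1_same_start[OF a(1) _ False, of "fst u"] assms(1) by simp
  qed
  then show "\<exists>q. (u, f, q) \<in> Tl" using vq by auto
qed (auto simp: tree_prefix_def intro!: exI[of _ "fst u"])

lemma essential_flatten: "is_cube K (u, l) \<Longrightarrow> essential K Tl (u, l) \<longleftrightarrow> ess_word [] (flatten (u, l))"
proof (induction l arbitrary: u)
  case Nil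
  then show ?case using irr_red[of "fst u" "snd u"] ess_word_ed[of "[]" "snd u" "[]"] by simp
next
  case (Cons x l)
  obtain f v where x: "x = (f, v)" by (cases x)
  have u: "path1 K u" "path1_end K u = fst (ctop K f)" "is_cube K (v, l)"
    using Cons.prems by (simp_all add: x)
  show ?case
    using Cons.IH[OF u(3)] tree_prefix_iff[OF u(1,2)] irr_red[of "fst u" "snd u"] u(1) by (simp add: x ess_word_ed)
qed

lemma essential_cubes_bij:
  assumes w: "path1 K w"
  shows "bij_betw flatten (essential_cubes K Tl w n) {x \<in> comp_cubes (snd w) n. ess_word [] x}"
proof (rule bij_betw_imageI)
  let ?E = "essential_cubes K Tl w n" and ?X = "{x \<in> comp_cubes (snd w) n. ess_word [] x}"
  have E: "(u, l) \<in> ?E \<longleftrightarrow> is_cube K (u, l) \<and> fst u = fst w \<and> flatten (u, l) \<in> ?X" for u l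
    using squier_component_iff[OF w, of "(u, l)"] essential_flatten[of u l] flatten_cube[of u l]
    by (auto simp: essential_cubes_def comp_cubes_def)
  show "inj_on flatten ?E"
  proof (rule inj_onI)
    fix c c' assume c: "c \<in> ?E" and c': "c' \<in> ?E" and eq: "flatten c = flatten c'"
    obtain u l where ul: "c = (u, l)" by (cases c)
    obtain u' l' where ul': "c' = (u', l')" by (cases c')
    have "u = u' \<and> l = l'"
      using c c' eq unfolding ul ul' E by (intro flatten_inj) auto
    then show "c = c'" by (simp add: ul ul')
  qed
  show "flatten ` ?E = ?X"
  proof (rule equalityI; rule subsetI)
    fix x assume "x \<in> flatten ` ?E"
    then obtain u l where "(u, l) \<in> ?E" "x = flatten (u, l)" by auto
    then show "x \<in> ?X" unfolding E by simp
  next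
    fix x assume x: "x \<in> ?X"
    then have "path1 K (fst w, cube_top x)" using conn_path1[of "snd w" "cube_top x" "fst w"] w by (simp add: comp_cubes_def)
    then obtain u l where "is_cube K (u, l)" "fst u = fst w" "flatten (u, l) = x"
      using flatten_surj[of "fst w" x] x by (auto simp: comp_cubes_def)
    then have "(u, l) \<in> ?E" "x = flatten (u, l)" using x unfolding E by auto
    then show "x \<in> flatten ` ?E" by blast
  qed
qed

end

theorem theorem9p7:
  fixes K :: "('v, 'e, 'f) two_complex"
    and T\<^sub>l :: "('v, 'e, 'f) atom set"
    and w :: "('v, 'e) walk"
    and n :: nat
  assumes "directed_2_complex K"
    and "complete_complex K"
    and "left_forest K T\<^sub>l"
    and "path1 K w" and "snd w \<noteq> []"
  shows "group_homology n (diagram_group K w) \<cong> free_Abelian_group (essential_cubes K T\<^sub>l w n)"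
proof -
  interpret left_forest_complex K T\<^sub>l
    by (intro left_forest_complex.intro left_forest_complex_axioms.intro assms)
  interpret D: diagram_cells "cells K" "neg_cells K" "\<lambda>f. snd (ctop K f)" "\<lambda>f. snd (cbot K f)" "cinv K"
      "diagram_group K w" "snd w" \<theta>
    by (rule diagram_cells_DG[OF assms(4)])
  let ?X = "{x \<in> comp_cubes (snd w) n. ess_word [] x}"
  have "ok (snd w)" using okI[of "fst w"] assms(4) by simp
  then have 1: "group_homology n (diagram_group K w) \<cong> free_Abelian_group ?X"
    using D.diagram_group_homology cubes_collapse by blast
  have "?X \<approx> essential_cubes K T\<^sub>l w n"
    using essential_cubes_bij[OF assms(4)] eqpoll_def eqpoll_sym by blast
  then have "free_Abelian_group ?X \<cong> free_Abelian_group (essential_cubes K T\<^sub>l w n)"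
    by (simp add: isomorphic_free_Abelian_groups)
  with 1 show ?thesis by (rule iso_trans)
qed

end
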